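(* Let $\mathbb{G}$ be a homogeneous group of homogeneous dimension $Q$ with a homogeneous quasi-norm $|\cdot|$. Let $\phi_{5},\psi_{5}$ be positive weight functions on $\mathbb{G}$, let $1<p\le q<\infty$ and $1/p+1/p'=1$. Then there exists a positive constant $C$ such that $$\left(\int_{\mathbb{G}}\phi_{5}(x)|f(x)|^{q}dx\right)^{1/q}\le C\left(\int_{\mathbb{G}}\psi_{5}(x)|\mathcal{R}_{|x|}f(x)|^{p}dx\right)^{1/p}$$ holds for all radial functions $f$ with $f(0)=0$ if and only if $$A_{5}:=\sup_{R>0}\left(\int_{\{|x|\ge R\}}\phi_{5}(x)\,dx\right)^{1/q}\left(\int_{0}^{R}\left(\int_{\mathfrak S}r^{Q-1}\psi_{5}(ry)\,d\sigma(y)\right)^{1-p'}dr\right)^{1/p'}<\infty,$$ where $\mathcal{R}_{|x|}:=\frac{d}{d|x|}$ is the radial derivative.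
   Context: A homogeneous group $\mathbb{G}$ is a connected simply connected Lie group whose Lie algebra $\mathfrak g$ is equipped with a family of dilations $D_\lambda=\mathrm{Exp}(A\ln\lambda)$, $\lambda>0$, where $A$ is a diagonalisable linear operator on $\mathfrak g$ with positive eigenvalues and each $D_\lambda$ is a Lie algebra morphism. Through the exponential map, $\mathbb G$ is identified with $\mathbb R^n$ (identity element $0$), the dilations act on $\mathbb G$ (written $x\mapsto\lambda x$), and Lebesgue measure $dx$ is a Haar measure. The homogeneous dimension is $Q=\mathrm{Tr}\,A$. A homogeneous quasi-norm is a continuous function $|\cdot|:\mathbb G\to[0,\infty)$ with $|x^{-1}|=|x|$, $|\lambda x|=\lambda|x|$ for $\lambda>0$, and $|x|=0$ iff $x=0$. $\mathfrak S=\{x\in\mathbb G:|x|=1\}$ is the unit quasi-sphere and $\sigma$ is the unique positive Borel measure on $\mathfrak S$ such that $\int_{\mathbb G}f(x)\,dx=\int_0^\infty\int_{\mathfrak S}f(ry)r^{Q-1}d\sigma(y)\,dr$ for all $f\in L^1(\mathbb G)$. A radial function is one of the form $f(x)=\tilde f(|x|)$, and then $\mathcal R_{|x|}f(x)=\tilde f'(|x|)$; the profile $\tilde f$ is understood to be locally absolutely continuous on $[0,\infty)$. *)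

theory Defs
  imports "HOL-Analysis.Analysis"
begin

text \<open>Directional derivatives of all orders exist and are differentiable; on a Euclidean
  space this is the usual notion of a smooth map.\<close>

primrec C_order :: "nat \<Rightarrow> ('a::euclidean_space \<Rightarrow> 'b::euclidean_space) \<Rightarrow> bool" where
  "C_order 0 f \<longleftrightarrow> continuous_on UNIV f"
| "C_order (Suc k) f \<longleftrightarrow>
     f differentiable_on UNIV \<and> (\<forall>v. C_order k (\<lambda>x. frechet_derivative f (at x) v))"

definition smooth_map :: "('a::euclidean_space \<Rightarrow> 'b::euclidean_space) \<Rightarrow> bool" where
  "smooth_map f \<longleftrightarrow> (\<forall>k. C_order k f)"

text \<open>The Lie algebra is the tangent space at the identity 0, identified with the left-invariant
  vector fields; the bracket of two vector fields \<open>X\<close>, \<open>Y\<close> is \<open>DY X - DX Y\<close>, evaluated at 0.\<close>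

definition left_invariant_field ::
    "(real^'n \<Rightarrow> real^'n \<Rightarrow> real^'n) \<Rightarrow> real^'n \<Rightarrow> real^'n \<Rightarrow> real^'n" where
  "left_invariant_field mul v x = frechet_derivative (mul x) (at 0) v"

definition lie_bracket ::
    "(real^'n \<Rightarrow> real^'n \<Rightarrow> real^'n) \<Rightarrow> real^'n \<Rightarrow> real^'n \<Rightarrow> real^'n" where
  "lie_bracket mul u v =
     frechet_derivative (left_invariant_field mul v) (at 0) u
     - frechet_derivative (left_invariant_field mul u) (at 0) v"

text \<open>\<open>dilation A l x\<close> is \<open>Exp(A ln l) x\<close>, the exponential series of the operator \<open>A ln l\<close>
  applied to \<open>x\<close>.\<close>

definition dilation :: "(real^'n \<Rightarrow> real^'n) \<Rightarrow> real \<Rightarrow> real^'n \<Rightarrow> real^'n" where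
  "dilation A l x = (\<Sum>k. ((ln l) ^ k / fact k) *\<^sub>R (A ^^ k) x)"

definition homogeneous_dim :: "(real^'n \<Rightarrow> real^'n) \<Rightarrow> real" where
  "homogeneous_dim A = trace (matrix A)"

definition diagonalisable :: "(real^'n \<Rightarrow> real^'n) \<Rightarrow> bool" where
  "diagonalisable A \<longleftrightarrow>
     (\<exists>B. independent B \<and> span B = UNIV \<and> (\<forall>b\<in>B. \<exists>c. A b = c *\<^sub>R b))"

text \<open>A Lie group with underlying manifold \<open>real^'n\<close> (so it is connected and simply connected) and
  identity 0. The assumption \<open>exp_coordinates\<close> says that every \<open>\<lambda>t. t *\<^sub>R x\<close> is a one-parameter
  subgroup, that is, that the group is identified with its Lie algebra through the exponential
  map.\<close>

locale homogeneous_group = group mul 0 ginv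
  for mul :: "real^'n \<Rightarrow> real^'n \<Rightarrow> real^'n" and ginv :: "real^'n \<Rightarrow> real^'n" +
  fixes A :: "real^'n \<Rightarrow> real^'n"
  assumes smooth_mul: "smooth_map (\<lambda>(x, y). mul x y)"
    and smooth_ginv: "smooth_map ginv"
    and exp_coordinates: "mul (s *\<^sub>R x) (t *\<^sub>R x) = (s + t) *\<^sub>R x"
    and linear_A: "linear A"
    and diagonalisable_A: "diagonalisable A"
    and eigenvalues_pos: "v \<noteq> 0 \<Longrightarrow> A v = c *\<^sub>R v \<Longrightarrow> 0 < c"
    and dilation_morphism: "0 < l \<Longrightarrow>
      dilation A l (lie_bracket mul u v) = lie_bracket mul (dilation A l u) (dilation A l v)"

locale homogeneous_quasi_norm = homogeneous_group mul ginv A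
  for mul :: "real^'n \<Rightarrow> real^'n \<Rightarrow> real^'n" and ginv A +
  fixes N :: "real^'n \<Rightarrow> real"
  assumes continuous: "continuous_on UNIV N"
    and nonneg: "0 \<le> N x"
    and symmetric: "N (ginv x) = N x"
    and homogeneous: "0 < l \<Longrightarrow> N (dilation A l x) = l * N x"
    and definite: "N x = 0 \<longleftrightarrow> x = 0"

definition quasi_sphere :: "(real^'n \<Rightarrow> real) \<Rightarrow> (real^'n) set" where
  "quasi_sphere N = {x. N x = 1}"

text \<open>The defining property of the measure on the quasi-sphere. Since it is a Borel measure, the
  functions tested are the Borel measurable representatives of the elements of \<open>L\<^sup>1\<close>: for a
  function that is only Lebesgue measurable, the inner integrand may fail to be measurable for
  every \<open>r\<close>.\<close>

definition polar_measure ::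
    "(real^'n \<Rightarrow> real^'n) \<Rightarrow> (real^'n \<Rightarrow> real) \<Rightarrow> (real^'n) measure \<Rightarrow> bool" where
  "polar_measure A N \<sigma> \<longleftrightarrow>
     sets \<sigma> = sets (restrict_space borel (quasi_sphere N)) \<and>
     (\<forall>f :: real^'n \<Rightarrow> real. integrable lborel f \<longrightarrow>
        (LINT x|lborel. f x) =
        (LINT r:{0<..}|lborel.
           (LINT y|\<sigma>. f (dilation A r y) * r powr (homogeneous_dim A - 1))))"

definition absolutely_continuous_on :: "real \<Rightarrow> real \<Rightarrow> (real \<Rightarrow> real) \<Rightarrow> bool" where
  "absolutely_continuous_on a b g \<longleftrightarrow>
     (\<forall>\<epsilon>>0. \<exists>\<delta>>0. \<forall>I :: (real \<times> real) set.
        finite I \<and> (\<forall>(s, t)\<in>I. a \<le> s \<and> s < t \<and> t \<le> b) \<and>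
        pairwise (\<lambda>(s, t) (u, v). disjnt {s<..<t} {u<..<v}) I \<and>
        (\<Sum>(s, t)\<in>I. t - s) < \<delta>
        \<longrightarrow> (\<Sum>(s, t)\<in>I. \<bar>g t - g s\<bar>) < \<epsilon>)"

definition locally_absolutely_continuous :: "(real \<Rightarrow> real) \<Rightarrow> bool" where
  "locally_absolutely_continuous g \<longleftrightarrow> (\<forall>b>0. absolutely_continuous_on 0 b g)"

definition radial_with_profile ::
    "(real^'n \<Rightarrow> real) \<Rightarrow> (real^'n \<Rightarrow> real) \<Rightarrow> (real \<Rightarrow> real) \<Rightarrow> bool" where
  "radial_with_profile N f g \<longleftrightarrow>
     (\<forall>x. f x = g (N x)) \<and> locally_absolutely_continuous g"

text \<open>The radial derivative of the radial function with profile \<open>g\<close>. It is meaningful where \<open>g\<close> is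
  differentiable, hence almost everywhere; \<^const>\<open>deriv\<close> is an arbitrary number elsewhere.\<close>

definition radial_deriv :: "(real^'n \<Rightarrow> real) \<Rightarrow> (real \<Rightarrow> real) \<Rightarrow> real^'n \<Rightarrow> real" where
  "radial_deriv N g x = deriv g (N x)"

text \<open>Real powers of extended nonnegative numbers, with \<open>\<infinity> ^ a = \<infinity>\<close> for \<open>a > 0\<close>, and
  \<open>\<infinity> ^ a = 0\<close>, \<open>0 ^ a = \<infinity>\<close> for \<open>a < 0\<close>.\<close>

definition ennreal_powr :: "ennreal \<Rightarrow> real \<Rightarrow> ennreal" (infixr \<open>powr\<^sub>e\<close> 80) where
  "x powr\<^sub>e a =
     (if a = 0 then 1
      else if x = \<infinity> then (if 0 < a then \<infinity> else 0)
      else if x = 0 then (if 0 < a then 0 else \<infinity>)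
      else ennreal (enn2real x powr a))"

definition weight :: "(real^'n \<Rightarrow> real) \<Rightarrow> bool" where
  "weight w \<longleftrightarrow> w \<in> borel_measurable borel \<and> (\<forall>x. 0 < w x)"

text \<open>The product of extended nonnegative numbers uses the convention \<open>0 * \<infinity> = 0\<close>.\<close>

definition A5 ::
    "(real^'n \<Rightarrow> real^'n) \<Rightarrow> (real^'n \<Rightarrow> real) \<Rightarrow> (real^'n) measure \<Rightarrow>
     (real^'n \<Rightarrow> real) \<Rightarrow> (real^'n \<Rightarrow> real) \<Rightarrow> real \<Rightarrow> real \<Rightarrow> real \<Rightarrow> ennreal" where
  "A5 A N \<sigma> \<phi> \<psi> p p' q =
     (SUP R\<in>{0<..}.
        (\<integral>\<^sup>+x\<in>{x. R \<le> N x}. ennreal (\<phi> x) \<partial>lborel) powr\<^sub>e (1 / q) *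
        (\<integral>\<^sup>+r\<in>{0<..<R}.
           (\<integral>\<^sup>+y. ennreal (r powr (homogeneous_dim A - 1) * \<psi> (dilation A r y)) \<partial>\<sigma>)
             powr\<^sub>e (1 - p') \<partial>lborel) powr\<^sub>e (1 / p'))"

end

theory Submission
  imports Defs
begin

text \<open>In polar coordinates both sides depend only on the profile \<open>g\<close>, and the weights become the
  spherical integrals \<open>\<Phi>(r)\<close>, \<open>\<Psi>(r)\<close> of \<open>\<phi>\<close>, \<open>\<psi>\<close>; the claim is then the weighted Hardy inequality on
  the half-line. Since \<open>g\<close> is locally absolutely continuous, \<open>g\<close> is the integral of its derivative \<open>h\<close>:
  the measure of the total variation of \<open>g\<close> has a density (Radon-Nikodym), and an integral is
  differentiable almost everywhere (by the Vitali covering theorem).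

  If \<open>A\<^sub>5 < \<infinity>\<close>, put \<open>F(x) = \<integral>\<^sub>0\<^sup>x \<bar>h\<bar>\<close> and choose \<open>\<xi>\<^sub>k\<close> with \<open>F(\<xi>\<^sub>k) = 2\<^sup>k\<close>. Hoelder's inequality on
  \<open>(\<xi>\<^sub>k\<^sub>-\<^sub>1, \<xi>\<^sub>k)\<close> bounds \<open>2\<^sup>k\<^sup>-\<^sup>1\<close> by the weighted norm of \<open>h\<close> there times a power of \<open>\<integral> \<Psi>\<^sup>1\<^sup>-\<^sup>p\<^sup>'\<close>,
  so the condition controls the part of \<open>\<integral> \<Phi> F\<^sup>q\<close> where \<open>2\<^sup>k < F \<le> 2\<^sup>k\<^sup>+\<^sup>1\<close>; the pieces add up because
  \<open>q \<ge> p\<close>. Conversely, the inequality is tested on the primitives of the truncations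
  \<open>min (\<Psi>\<^sup>1\<^sup>-\<^sup>p\<^sup>') n\<close> restricted to \<open>(0, R)\<close>, and \<open>n\<close> tends to infinity.\<close>

section \<open>Lebesgue differentiation on the line\<close>

text \<open>The measure \<sigma> is given only through Bochner integrals of integrable functions,
  and these are 0 by default where they diverge. Integrals of nonnegative functions that may be
  infinite need more: an identity between Lebesgue measure and the image of
  \<open>r powr (Q - 1) dr d\<sigma>\<close>, which is extracted from that property. Since \<Phi>
  and \<Psi> may be infinite and 0 * \<infinity> = 0, a finite \<open>A5\<close> could conceal a
  divergent integral of \<open>\<Psi> powr\<^sub>e (1 - p')\<close>; positivity of the tail of
  \<Phi>, which comes from \<phi> > 0, excludes this. The exponent of the test functions is the one
  for which Hoelder's inequality is an equality: (1 - p')(p - 1) = -1. That power of \<Psi> need not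
  be integrable near 0, whereas its truncations have Lipschitz primitives and finite integrals, by
  which one may divide. The levels are those of F and not of |g| because F is monotone. The constant
  is \<open>4 * A5\<close> up to a positive summand: on a level F is at most 2^(k+1), four times the
  increment 2^(k-1) that Hoelder's inequality controls.\<close>

lemma set_integral_countable_disjoint_nonneg:
  fixes k :: "'a \<Rightarrow> real"
  assumes C: "countable C" and disj: "disjoint_family_on A C"
    and meas: "\<And>i. i \<in> C \<Longrightarrow> A i \<in> sets M"
    and int: "set_integrable M (\<Union>i\<in>C. A i) k"
    and nonneg: "\<And>i. i \<in> C \<Longrightarrow> 0 \<le> (LINT x:A i|M. k x)"
  shows "0 \<le> (LINT x:(\<Union>i\<in>C. A i)|M. k x)"
proof (cases "C = {}")
  case True
  then show ?thesis by (simp add: set_lebesgue_integral_def)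
next
  case False
  \<comment> \<open>The union runs over an image set, so repetitions in the enumeration of a finite
    \<open>C\<close> do not spoil disjointness.\<close>
  define B where "B n = (\<Union>i\<in>from_nat_into C ` {..n}. A i)" for n
  have sub: "from_nat_into C ` {..n} \<subseteq> C" for n
    using False by (auto intro: from_nat_into)
  have U: "(\<Union>n. B n) = (\<Union>i\<in>C. A i)"
  proof -
    have "(\<Union>n. B n) = (\<Union>i\<in>range (from_nat_into C). A i)"
      unfolding B_def by blast
    then show ?thesis using range_from_nat_into[OF False C] by simp
  qed
  have Bm: "B n \<in> sets M" for n
    unfolding B_def using sub meas by (intro sets.finite_UN) auto
  have inc: "incseq B"
    unfolding B_def incseq_def by (intro allI impI UN_mono image_mono) auto
  have "(\<lambda>n. LINT x:B n|M. k x) \<longlonglongrightarrow> (LINT x:(\<Union>n. B n)|M. k x)"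
    by (rule set_integral_cont_up[OF Bm inc]) (use int in \<open>simp add: U\<close>)
  moreover have "0 \<le> (LINT x:B n|M. k x)" for n
  proof -
    have "(LINT x:B n|M. k x) = (\<Sum>i\<in>from_nat_into C ` {..n}. LINT x:A i|M. k x)"
      unfolding B_def
    proof (rule set_integral_finite_Union)
      show "disjoint_family_on A (from_nat_into C ` {..n})"
        using disj sub disjoint_family_on_mono by blast
      fix i assume "i \<in> from_nat_into C ` {..n}"
      then have i: "i \<in> C" using sub by auto
      show "A i \<in> sets M" by (rule meas[OF i])
      show "set_integrable M (A i) k"
        by (rule set_integrable_subset[OF int meas[OF i]]) (use i in auto)
    qed auto
    also have "\<dots> \<ge> 0" using sub nonneg by (intro sum_nonneg) auto
    finally show ?thesis .
  qed
  ultimately show ?thesis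
    using U by (metis LIMSEQ_le_const)
qed

lemma cball_midpoint: "s \<le> t \<Longrightarrow> cball ((s + t) / 2) ((t - s) / 2) = {s..t}" for s t :: real
  by (simp add: cball_eq_atLeastAtMost field_simps)

lemma emeasure_lborel_interval_finite [simp]:
  fixes a b :: real
  shows "emeasure lborel {a<..<b} < top" "emeasure lborel {a..b} < top"
  using emeasure_lborel_box_finite[of a b] emeasure_lborel_cbox_finite[of a b] by (simp_all add: box_real)

text \<open>Vitali intervals with average above \<open>\<beta>\<close>, taken inside an open \<open>U\<close> around \<open>F = {h < \<alpha>}\<close>, cover the
  exceptional set by some \<open>W\<close> with \<open>0 \<le> \<integral>\<^sub>W (h - \<beta>) \<le> (\<alpha> - \<beta>) |W \<inter> F| + \<integral>\<^sub>U\<^sub>-\<^sub>F |h - \<beta>|\<close>; the last term is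
  small by outer regularity of the measure \<open>|h - \<beta>| dx\<close>.\<close>

lemma negligible_average_exceeds_bounded:
  fixes h :: "real \<Rightarrow> real" and \<alpha> \<beta> n :: real
  assumes h: "integrable lborel h" and "\<alpha> < \<beta>"
  shows "negligible {x. x \<in> {-n<..<n} \<and> h x < \<alpha> \<and> (\<forall>d>0. \<exists>s t. s \<le> x \<and> x \<le> t \<and> s < t \<and> t - s < d
            \<and> \<beta> * (t - s) < (LINT y:{s..t}|lborel. h y))}" (is "negligible ?E")
proof -
  let ?B = "{-n<..<n}"
  define k where "k x = h x - \<beta>" for x
  define F where "F = {x \<in> ?B. h x < \<alpha>}"
  have [measurable]: "h \<in> borel_measurable borel" using h by simp
  have [measurable]: "k \<in> borel_measurable borel" unfolding k_def by measurable
  have F[measurable]: "F \<in> sets borel" unfolding F_def by measurable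
  have kB: "set_integrable lborel ?B k"
    unfolding k_def
    by (intro set_integral_diff) (auto simp: set_integrable_def intro!: integrable_mult_left integrable_mult_indicator[OF _ h, simplified]
        integrable_real_indicator)
  \<comment> \<open>Restricted to the bounded interval \<open>?B\<close>, the measure
    \<open>|k| dx\<close> is finite, as outer regularity requires.\<close>
  define M where "M = density lborel (\<lambda>x. ennreal \<bar>indicator ?B x *\<^sub>R k x\<bar>)"
  have MS: "sets M = sets borel" unfolding M_def by simp
  have M_eq: "emeasure M X = ennreal (LINT x:X|lborel. \<bar>indicator ?B x *\<^sub>R k x\<bar>)" if X: "X \<in> sets borel" for X
  proof -
    have "integrable lborel (\<lambda>x. indicator X x *\<^sub>R \<bar>indicator ?B x *\<^sub>R k x\<bar>)"
      using kB X unfolding set_integrable_def by (intro integrable_mult_indicator) auto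
    then show ?thesis
      unfolding M_def set_lebesgue_integral_def using X
      by (subst emeasure_density)
         (auto simp: nn_integral_eq_integral[symmetric] ennreal_mult' indicator_def intro!: nn_integral_cong)
  qed
  have Mfin: "emeasure M (space M) \<noteq> \<infinity>"
    using M_eq[of UNIV] by (simp add: M_def)
  have key: "\<exists>T. ?E \<subseteq> T \<and> T \<in> lmeasurable \<and> measure lebesgue T \<le> e" if "0 < e" for e
  proof -
    \<comment> \<open>The estimate ends in \<open>(\<beta> - \<alpha>) * measure lborel (W \<inter>
      F) \<le> \<epsilon>\<close>; this choice leaves \<open>e\<close> after division.\<close>
    define \<epsilon> where "\<epsilon> = e * (\<beta> - \<alpha>)"
    have \<epsilon>: "0 < \<epsilon>" unfolding \<epsilon>_def using that \<open>\<alpha> < \<beta>\<close> by simp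
    have "emeasure M F = (INF U \<in> {U. F \<subseteq> U \<and> open U}. emeasure M U)"
      by (rule outer_regular[OF MS Mfin]) (rule F)
    moreover have "emeasure M F < emeasure M F + ennreal \<epsilon>"
      using \<epsilon> M_eq[OF F] by (simp add: ennreal_plus[symmetric] ennreal_lessI del: ennreal_plus)
    ultimately obtain U0 where U0: "F \<subseteq> U0" "open U0" "emeasure M U0 < emeasure M F + ennreal \<epsilon>"
      by (auto simp: Inf_less_iff)
    \<comment> \<open>Cutting with \<open>?B\<close> keeps \<open>k\<close> integrable on
      \<open>U\<close> and makes the density of \<open>M\<close> equal to \<open>|k|\<close>
      there.\<close>
    define U where "U = U0 \<inter> ?B"
    have U: "F \<subseteq> U" "open U" "U \<subseteq> ?B" using U0 by (auto simp: U_def F_def)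
    have [measurable]: "U \<in> sets borel" "U0 \<in> sets borel" using U(2) U0(2) by auto
    have UF: "(LINT x:U - F|lborel. \<bar>k x\<bar>) \<le> \<epsilon>"
    proof -
      have "emeasure M (U - F) + emeasure M F \<le> emeasure M U0"
        using U0 by (subst plus_emeasure) (auto simp: MS U_def intro!: emeasure_mono)
      then have "emeasure M F + emeasure M (U - F) \<le> emeasure M F + ennreal \<epsilon>"
        using U0(3) by (metis add.commute order.trans order.strict_implies_order)
      moreover have "emeasure M F \<noteq> top" using M_eq[OF F] by simp
      ultimately have "emeasure M (U - F) \<le> ennreal \<epsilon>" by (simp only: ennreal_add_left_cancel_le) simp
      then have "(LINT x:U - F|lborel. \<bar>indicator ?B x *\<^sub>R k x\<bar>) \<le> \<epsilon>"
        using \<epsilon> by (subst (asm) M_eq) (auto simp: ennreal_le_iff)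
      also have "(LINT x:U - F|lborel. \<bar>indicator ?B x *\<^sub>R k x\<bar>) = (LINT x:U - F|lborel. \<bar>k x\<bar>)"
        using U(3) by (intro set_lebesgue_integral_cong) auto
      finally show ?thesis .
    qed
    define K where "K = {(s, t). s < t \<and> {s..t} \<subseteq> U \<and> \<beta> * (t - s) < (LINT y:{s..t}|lborel. h y)}"
    define a where "a = (\<lambda>(s, t). (s + t) / 2 :: real)"
    define r where "r = (\<lambda>(s, t). (t - s) / 2 :: real)"
    have ar: "cball (a i) (r i) = {fst i..snd i}" if "i \<in> K" for i
      using that by (auto simp: K_def a_def r_def cball_midpoint)
    have r_pos: "0 < r i" if "i \<in> K" for i using that by (auto simp: K_def r_def)
    have fine: "\<exists>i. i \<in> K \<and> x \<in> cball (a i) (r i) \<and> r i < d" if x: "x \<in> ?E" and d: "0 < d" for x d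
    proof -
      have xF: "x \<in> F" using x unfolding F_def by blast
      have xE: "\<exists>s t. s \<le> x \<and> x \<le> t \<and> s < t \<and> t - s < d
            \<and> \<beta> * (t - s) < (LINT y:{s..t}|lborel. h y)" if "0 < d" for d
        using x that by blast
      have "x \<in> U" using U(1) xF by blast
      then obtain d' where d': "0 < d'" "ball x d' \<subseteq> U" using U(2) openE by blast
      obtain s t where st: "s \<le> x" "x \<le> t" "s < t" "t - s < min d d'" "\<beta> * (t - s) < (LINT y:{s..t}|lborel. h y)"
        using xE[of "min d d'"] d d'(1) by auto
      have "{s..t} \<subseteq> ball x d'" using st by (auto simp: dist_real_def)
      then have "{s..t} \<subseteq> U" using d'(2) by blast
      then have stK: "(s, t) \<in> K" using st(3,5) unfolding K_def by simp
      show ?thesis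
      proof (intro exI[of _ "(s, t)"] conjI stK)
        show "x \<in> cball (a (s, t)) (r (s, t))" unfolding ar[OF stK] using st(1,2) by simp
        show "r (s, t) < d" using st(3,4) by (simp add: r_def)
      qed
    qed
    obtain C where C: "countable C" "C \<subseteq> K"
       "pairwise (\<lambda>i j. disjnt (cball (a i) (r i)) (cball (a j) (r j))) C"
       "negligible (?E - (\<Union>i\<in>C. cball (a i) (r i)))"
      by (rule Vitali_covering_theorem_cballs[of K r ?E a, OF r_pos fine])
    define W where "W = (\<Union>i\<in>C. {fst i..snd i})"
    have WU: "W \<subseteq> U" using C(2) by (fastforce simp: W_def K_def)
    have W: "W = (\<Union>i\<in>C. cball (a i) (r i))" unfolding W_def using C(2) ar by (intro SUP_cong) auto
    have [measurable]: "W \<in> sets borel" unfolding W_def using C(1) by (intro sets.countable_UN') auto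
    have kset: "set_integrable lborel X k" if "X \<in> sets borel" "X \<subseteq> ?B" for X
      using set_integrable_subset[OF kB _ that(2)] that(1) by simp
    have "0 \<le> (LINT x:W|lborel. k x)"
      unfolding W_def
    proof (rule set_integral_countable_disjoint_nonneg[OF C(1)])
      show "disjoint_family_on (\<lambda>i. {fst i..snd i}) C"
        unfolding disjoint_family_on_def
      proof (intro ballI impI)
        fix i j assume ij: "i \<in> C" "j \<in> C" "i \<noteq> j"
        then have "disjnt (cball (a i) (r i)) (cball (a j) (r j))" using C(3) by (rule_tac pairwiseD)
        then show "{fst i..snd i} \<inter> {fst j..snd j} = {}" using ij C(2) ar[of i] ar[of j] unfolding disjnt_def by (metis subsetD)
      qed
      show "set_integrable lborel (\<Union>i\<in>C. {fst i..snd i}) k"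
        using kset[of W] WU U(3) by (simp add: W_def[symmetric])
      fix i assume i: "i \<in> C"
      then obtain s t where st: "i = (s, t)" "s < t" "{s..t} \<subseteq> U" "\<beta> * (t - s) < (LINT y:{s..t}|lborel. h y)"
        using C(2) by (auto simp: K_def)
      have "(LINT x:{s..t}|lborel. k x) = (LINT y:{s..t}|lborel. h y) - (LINT y:{s..t}|lborel. \<beta>)"
        unfolding k_def
        by (intro set_integral_diff) (auto simp: set_integrable_def intro!: integrable_mult_left integrable_mult_indicator[OF _ h, simplified]
        integrable_real_indicator)
      also have "(LINT y:{s..t}|lborel. \<beta>) = \<beta> * (t - s)"
        using st by (simp add: set_lebesgue_integral_def)
      finally show "0 \<le> (LINT x:{fst i..snd i}|lborel. k x)" using st by simp
    qed auto
    also have "(LINT x:W|lborel. k x) = (LINT x:W \<inter> F|lborel. k x) + (LINT x:W - F|lborel. k x)"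
    proof -
      have "(LINT x:(W \<inter> F) \<union> (W - F)|lborel. k x) = (LINT x:W \<inter> F|lborel. k x) + (LINT x:W - F|lborel. k x)"
        using WU U(3) by (intro set_integral_Un kset) auto
      then show ?thesis by (simp add: Int_Diff_Un)
    qed
    also have "(LINT x:W - F|lborel. k x) \<le> (LINT x:U - F|lborel. \<bar>k x\<bar>)"
      unfolding set_lebesgue_integral_def
    proof (rule integral_mono)
      show "integrable lborel (\<lambda>x. indicator (W - F) x *\<^sub>R k x)"
        using kset[of "W - F"] WU U(3) by (auto simp: set_integrable_def)
      show "integrable lborel (\<lambda>x. indicator (U - F) x *\<^sub>R \<bar>k x\<bar>)"
        using set_integrable_abs[OF kset[of "U - F"]] U(3) by (auto simp: set_integrable_def)
    qed (use WU in \<open>auto simp: indicator_def\<close>)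
    also have "(LINT x:W \<inter> F|lborel. k x) \<le> (LINT x:W \<inter> F|lborel. \<alpha> - \<beta>)"
    proof (rule set_integral_mono)
      show "set_integrable lborel (W \<inter> F) k" using WU U(3) by (intro kset) auto
      have "emeasure lborel (W \<inter> F) \<le> emeasure lborel ?B" using WU U(3) by (intro emeasure_mono) auto
      also have "\<dots> < \<infinity>" by simp
      finally show "set_integrable lborel (W \<inter> F) (\<lambda>x. \<alpha> - \<beta>)"
        by (auto simp: set_integrable_def intro!: integrable_real_indicator)
    qed (auto simp: k_def F_def)
    also have "\<dots> = (\<alpha> - \<beta>) * measure lborel (W \<inter> F)"
      by (simp add: set_lebesgue_integral_def)
    finally have "(\<beta> - \<alpha>) * measure lborel (W \<inter> F) \<le> \<epsilon>" using UF by (simp add: algebra_simps)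
    then have m: "measure lborel (W \<inter> F) \<le> e"
      using \<open>\<alpha> < \<beta>\<close> by (simp add: \<epsilon>_def mult.commute)
    have WF: "W \<inter> F \<in> lmeasurable"
      by (rule bounded_set_imp_lmeasurable)
         (use WU U(3) in \<open>auto intro!: bounded_subset[OF bounded_box[of "-n" n]] simp: box_real\<close>)
    let ?N = "?E - W"
    have N: "negligible ?N" using C(4) W by simp
    show ?thesis
    proof (intro exI[of _ "(W \<inter> F) \<union> ?N"] conjI)
      show "?E \<subseteq> (W \<inter> F) \<union> ?N" by (auto simp: F_def)
      show "(W \<inter> F) \<union> ?N \<in> lmeasurable"
        by (rule fmeasurable.Un[OF WF negligible_imp_measurable[OF N]])
      have "measure lebesgue ((W \<inter> F) \<union> ?N) \<le> measure lebesgue (W \<inter> F) + measure lebesgue ?N"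
        by (rule measure_Un_le[OF fmeasurableD[OF WF] fmeasurableD[OF negligible_imp_measurable[OF N]]])
      moreover have "measure lebesgue (W \<inter> F) = measure lborel (W \<inter> F)"
        by (rule measure_completion) simp
      ultimately show "measure lebesgue ((W \<inter> F) \<union> ?N) \<le> e"
        using m negligible_imp_measure0[OF N] by linarith
    qed
  qed
  then show ?thesis by (auto simp: negligible_outer_le)
qed

text \<open>The constant \<beta> need not be integrable over the line, hence the exhaustion by
  bounded intervals.\<close>

lemma negligible_average_exceeds:
  fixes h :: "real \<Rightarrow> real" and \<alpha> \<beta> :: real
  assumes h: "integrable lborel h" and "\<alpha> < \<beta>"
  shows "negligible {x. h x < \<alpha> \<and> (\<forall>d>0. \<exists>s t. s \<le> x \<and> x \<le> t \<and> s < t \<and> t - s < d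
            \<and> \<beta> * (t - s) < (LINT y:{s..t}|lborel. h y))}" (is "negligible (Collect ?P)")
proof -
  have "Collect ?P = (\<Union>n::nat. {x. x \<in> {-real n<..<real n} \<and> ?P x})"
  proof (intro set_eqI iffI)
    fix x assume x: "x \<in> Collect ?P"
    obtain n :: nat where "\<bar>x\<bar> < real n" using reals_Archimedean2 by blast
    then have "x \<in> {-real n<..<real n}" by auto
    then show "x \<in> (\<Union>n::nat. {x. x \<in> {-real n<..<real n} \<and> ?P x})" using x by blast
  qed blast
  then show ?thesis
    using negligible_average_exceeds_bounded[OF assms] by (simp only: negligible_Union_nat)
qed

text \<open>Applied to \<open>h\<close> and to \<open>- h\<close> with rational \<alpha> < \<beta>,
  the previous lemma removes countably many null sets. Outside them the averages over short
  intervals containing x lie between h x - e and h x + e. The intervals need not be centred at x, so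
  difference quotients from either side are covered.\<close>

theorem lebesgue_differentiation:
  fixes h :: "real \<Rightarrow> real"
  assumes h: "integrable lborel h"
  shows "AE x in lborel. ((\<lambda>x. LINT t:{..x}|lborel. h t) has_real_derivative h x) (at x)"
proof -
  let ?H = "\<lambda>x. LINT t:{..x}|lborel. h t"
  define N where "N h \<alpha> \<beta> = {x. h x < \<alpha> \<and> (\<forall>d>0. \<exists>s t. s \<le> x \<and> x \<le> t \<and> s < t \<and> t - s < d
            \<and> \<beta> * (t - s) < (LINT y:{s..t}|lborel. h y))}" for h :: "real \<Rightarrow> real" and \<alpha> \<beta>
  have hs: "set_integrable lborel X h" if "X \<in> sets borel" for X
    using h that unfolding set_integrable_def by (intro integrable_mult_indicator) auto
  have H: "?H t - ?H s = (LINT y:{s..t}|lborel. h y)" if "s \<le> t" for s t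
  proof -
    have "(LINT y:{..t}|lborel. h y) = (LINT y:{..<s} \<union> {s..t}|lborel. h y)"
      using that by (simp add: ivl_disj_un_one(4))
    also have "\<dots> = (LINT y:{..<s}|lborel. h y) + (LINT y:{s..t}|lborel. h y)"
      by (intro set_integral_Un hs) auto
    also have "(LINT y:{..<s}|lborel. h y) = (LINT y:{..s}|lborel. h y)"
      unfolding set_lebesgue_integral_def
      by (intro integral_cong_AE) (use AE_lborel_singleton[of s] h in \<open>auto simp: indicator_def elim!: eventually_mono\<close>)
    finally show ?thesis by simp
  qed
  have ae: "AE x in lborel. x \<notin> N h \<alpha> \<beta>" if "integrable lborel h" "\<alpha> < \<beta>" for h :: "real \<Rightarrow> real" and \<alpha> \<beta>
  proof -
    have "N h \<alpha> \<beta> \<in> null_sets lebesgue"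
      using negligible_average_exceeds[OF that] by (simp add: N_def negligible_iff_null_sets)
    then have "AE x in lebesgue. x \<notin> N h \<alpha> \<beta>" by (rule AE_not_in)
    then show ?thesis by (simp only: AE_completion_iff)
  qed
  have "AE x in lborel. \<forall>(a, b) \<in> {(a, b). (a::rat) < b}. x \<notin> N h (of_rat a) (of_rat b) \<and> x \<notin> N (\<lambda>x. - h x) (of_rat a) (of_rat b)"
    by (subst AE_ball_countable) (auto intro!: ae h simp: of_rat_less)
  then show ?thesis
  proof eventually_elim
    case (elim x)
    have upper: "\<exists>d>0. \<forall>s t. s \<le> x \<longrightarrow> x \<le> t \<longrightarrow> s < t \<longrightarrow> t - s < d \<longrightarrow> (LINT y:{s..t}|lborel. k y) \<le> (k x + e) * (t - s)"
      if k: "\<forall>(a, b) \<in> {(a, b). (a::rat) < b}. x \<notin> N k (of_rat a) (of_rat b)" and e: "0 < e" for k e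
    proof -
      \<comment> \<open>Two rationals with k x < a < b < k x + e: since \<open>x\<close> is outside
        the exceptional set of (a, b), the averages over short intervals around \<open>x\<close> are
        at most b.\<close>
      obtain b where b: "k x < of_rat b" "of_rat b < k x + e" using of_rat_dense[of "k x" "k x + e"] e by auto
      obtain a where a: "k x < of_rat a" "of_rat a < (of_rat b :: real)" using of_rat_dense[OF b(1)] by auto
      then have "x \<notin> N k (of_rat a) (of_rat b)" using k a(2) by (auto simp: of_rat_less)
      then obtain d where d: "d > 0" "\<And>s t. s \<le> x \<Longrightarrow> x \<le> t \<Longrightarrow> s < t \<Longrightarrow> t - s < d \<Longrightarrow> (LINT y:{s..t}|lborel. k y) \<le> of_rat b * (t - s)"
        using a(1) unfolding N_def mem_Collect_eq by (metis not_less)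
      have "(LINT y:{s..t}|lborel. k y) \<le> (k x + e) * (t - s)" if "s \<le> x" "x \<le> t" "s < t" "t - s < d" for s t
        using d(2)[OF that] b(2) that by (smt (verit) mult_right_mono)
      then show ?thesis using d(1) by blast
    qed
    have "\<exists>d>0. \<forall>y. y \<noteq> x \<longrightarrow> dist y x < d \<longrightarrow> dist ((?H y - ?H x) / (y - x)) (h x) \<le> e" if e: "0 < e" for e
    proof -
      obtain d1 where d1: "d1 > 0" "\<And>s t. s \<le> x \<Longrightarrow> x \<le> t \<Longrightarrow> s < t \<Longrightarrow> t - s < d1 \<Longrightarrow> (LINT y:{s..t}|lborel. h y) \<le> (h x + e) * (t - s)"
        using upper[OF _ e, of h] elim by auto
      obtain d2 where d2: "d2 > 0" "\<And>s t. s \<le> x \<Longrightarrow> x \<le> t \<Longrightarrow> s < t \<Longrightarrow> t - s < d2 \<Longrightarrow> (LINT y:{s..t}|lborel. - h y) \<le> (- h x + e) * (t - s)"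
        using upper[OF _ e, of "\<lambda>x. - h x"] elim by auto
      have "dist ((?H y - ?H x) / (y - x)) (h x) \<le> e" if y: "y \<noteq> x" "dist y x < min d1 d2" for y
      proof -
        let ?s = "min x y" and ?t = "max x y"
        have st: "?s \<le> x" "x \<le> ?t" "?s < ?t" "?t - ?s < d1" "?t - ?s < d2" using y by (auto simp: dist_real_def)
        define I where "I = (LINT y:{?s..?t}|lborel. h y)"
        have quot: "(?H y - ?H x) / (y - x) = I / (?t - ?s)"
          using H[of ?s ?t] y unfolding I_def[symmetric] by (auto simp: min_def max_def field_simps split: if_splits)
        have "I \<le> (h x + e) * (?t - ?s)" unfolding I_def by (rule d1(2)[OF st(1-4)])
        moreover have "- I \<le> (- h x + e) * (?t - ?s)"
          using d2(2)[OF st(1-3,5)] unfolding I_def by (simp add: set_lebesgue_integral_def)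
        ultimately have "I / (?t - ?s) \<le> h x + e" "h x - e \<le> I / (?t - ?s)"
          using st(3) pos_divide_le_eq[of "?t - ?s" I "h x + e"] pos_le_divide_eq[of "?t - ?s" "h x - e" I]
          by (auto simp: algebra_simps)
        then show ?thesis unfolding quot by (simp add: dist_real_def abs_le_iff)
      qed
      then show ?thesis using d1(1) d2(1) by (intro exI[of _ "min d1 d2"]) auto
    qed
    \<comment> \<open>The bound \<open>\<le> e\<close> for every e becomes strict by passing to a
      smaller e.\<close>
    then show ?case
      unfolding has_field_derivative_iff LIM_def
      by (meson dense order.strict_trans1)
  qed
qed

section \<open>Absolutely continuous functions are integrals\<close>

text \<open>The condition of absolute continuity for one fixed pair \<epsilon>, \<delta>, so that
  \<delta> can be chosen once and then applied to many families.\<close>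

definition ac_modulus :: "(real \<Rightarrow> real) \<Rightarrow> real \<Rightarrow> real \<Rightarrow> real \<Rightarrow> real \<Rightarrow> bool" where
  "ac_modulus g a b \<epsilon> \<delta> \<longleftrightarrow> (\<forall>I :: (real \<times> real) set.
        finite I \<and> (\<forall>(s, t)\<in>I. a \<le> s \<and> s < t \<and> t \<le> b) \<and>
        pairwise (\<lambda>(s, t) (u, v). disjnt {s<..<t} {u<..<v}) I \<and>
        (\<Sum>(s, t)\<in>I. t - s) < \<delta>
        \<longrightarrow> (\<Sum>(s, t)\<in>I. \<bar>g t - g s\<bar>) < \<epsilon>)"

lemma absolutely_continuous_on_iff_modulus:
  "absolutely_continuous_on a b g \<longleftrightarrow> (\<forall>\<epsilon>>0. \<exists>\<delta>>0. ac_modulus g a b \<epsilon> \<delta>)"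
  unfolding absolutely_continuous_on_def ac_modulus_def ..

text \<open>Partitions produce indexed families with degenerate intervals, whereas the definition
  speaks of sets of pairs with s < t. Degenerate intervals contribute nothing to either sum, and
  disjoint nonempty ones are distinct, so discarding the former makes the indexing
  injective.\<close>

lemma ac_modulus_family:
  fixes s t :: "'k \<Rightarrow> real"
  assumes m: "ac_modulus g a b \<epsilon> \<delta>" and K: "finite K"
    and st: "\<And>k. k \<in> K \<Longrightarrow> a \<le> s k \<and> s k \<le> t k \<and> t k \<le> b"
    and disj: "\<And>k l. k \<in> K \<Longrightarrow> l \<in> K \<Longrightarrow> k \<noteq> l \<Longrightarrow> disjnt {s k<..<t k} {s l<..<t l}"
    and len: "(\<Sum>k\<in>K. t k - s k) < \<delta>"
  shows "(\<Sum>k\<in>K. \<bar>g (t k) - g (s k)\<bar>) < \<epsilon>"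
proof -
  define L where "L = {k \<in> K. s k < t k}"
  let ?I = "(\<lambda>k. (s k, t k)) ` L"
  have L: "finite L" "L \<subseteq> K" using K by (auto simp: L_def)
  have inj: "inj_on (\<lambda>k. (s k, t k)) L"
  proof (rule inj_onI)
    fix k l assume kl: "k \<in> L" "l \<in> L" "(s k, t k) = (s l, t l)"
    show "k = l"
    proof (rule ccontr)
      assume "k \<noteq> l"
      then have "disjnt {s k<..<t k} {s l<..<t l}" using kl by (intro disj) (auto simp: L_def)
      then have "{s k<..<t k} = {}" using kl by (simp add: disjnt_def)
      then show False using kl by (simp add: L_def)
    qed
  qed
  have "(\<Sum>k\<in>L. t k - s k) = (\<Sum>k\<in>K. t k - s k)"
    using st by (intro sum.mono_neutral_left[OF K L(2)]) (force simp: L_def)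
  then have "(\<Sum>(s, t)\<in>?I. t - s) < \<delta>"
    using len by (simp add: sum.reindex[OF inj])
  moreover have "pairwise (\<lambda>(s, t) (u, v). disjnt {s<..<t} {u<..<v}) ?I"
    using disj L(2) by (auto simp: pairwise_def)
  moreover have "\<forall>(s, t)\<in>?I. a \<le> s \<and> s < t \<and> t \<le> b"
    using st by (auto simp: L_def)
  moreover have "finite ?I" using L(1) by simp
  ultimately have "(\<Sum>(s, t)\<in>?I. \<bar>g t - g s\<bar>) < \<epsilon>"
    using m[unfolded ac_modulus_def, rule_format, of ?I] by blast
  then have "(\<Sum>k\<in>L. \<bar>g (t k) - g (s k)\<bar>) < \<epsilon>" by (simp add: sum.reindex[OF inj])
  also have "(\<Sum>k\<in>L. \<bar>g (t k) - g (s k)\<bar>) = (\<Sum>k\<in>K. \<bar>g (t k) - g (s k)\<bar>)"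
    using st by (intro sum.mono_neutral_left[OF K L(2)]) (force simp: L_def)
  finally show ?thesis .
qed

lemma locally_absolutely_continuous_diff:
  assumes "locally_absolutely_continuous f" "locally_absolutely_continuous g"
  shows "locally_absolutely_continuous (\<lambda>x. f x - g x)"
  unfolding locally_absolutely_continuous_def absolutely_continuous_on_iff_modulus
proof (intro allI impI)
  fix b \<epsilon> :: real assume b: "0 < b" and \<epsilon>: "0 < \<epsilon>"
  obtain d where d: "d > 0" "ac_modulus f 0 b (\<epsilon>/2) d"
    using assms(1) b \<epsilon> unfolding locally_absolutely_continuous_def absolutely_continuous_on_iff_modulus
    by (meson half_gt_zero)
  obtain e where e: "e > 0" "ac_modulus g 0 b (\<epsilon>/2) e"
    using assms(2) b \<epsilon> unfolding locally_absolutely_continuous_def absolutely_continuous_on_iff_modulus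
    by (meson half_gt_zero)
  have "ac_modulus (\<lambda>x. f x - g x) 0 b \<epsilon> (min d e)"
    unfolding ac_modulus_def
  proof (intro allI impI)
    fix I :: "(real \<times> real) set"
    assume I: "finite I \<and> (\<forall>(s, t)\<in>I. 0 \<le> s \<and> s < t \<and> t \<le> b) \<and>
        pairwise (\<lambda>(s, t) (u, v). disjnt {s<..<t} {u<..<v}) I \<and> (\<Sum>(s, t)\<in>I. t - s) < min d e"
    have "(\<Sum>(s, t)\<in>I. \<bar>f t - g t - (f s - g s)\<bar>) \<le> (\<Sum>(s, t)\<in>I. \<bar>f t - f s\<bar> + \<bar>g t - g s\<bar>)"
      by (intro sum_mono) auto
    also have "\<dots> = (\<Sum>(s, t)\<in>I. \<bar>f t - f s\<bar>) + (\<Sum>(s, t)\<in>I. \<bar>g t - g s\<bar>)"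
      by (simp add: case_prod_unfold sum.distrib)
    also have "\<dots> < \<epsilon>/2 + \<epsilon>/2"
      using d(2)[unfolded ac_modulus_def, rule_format, of I] e(2)[unfolded ac_modulus_def, rule_format, of I] I
      by (intro add_strict_mono) auto
    finally show "(\<Sum>(s, t)\<in>I. \<bar>f t - g t - (f s - g s)\<bar>) < \<epsilon>" by simp
  qed
  then show "\<exists>\<delta>>0. ac_modulus (\<lambda>x. f x - g x) 0 b \<epsilon> \<delta>" using d e by (intro exI[of _ "min d e"]) auto
qed

lemma locally_absolutely_continuous_imp_continuous:
  assumes "locally_absolutely_continuous g"
  shows "continuous_on {0..} g"
  unfolding continuous_on_iff
proof (intro ballI allI impI)
  fix x e :: real assume x: "x \<in> {0..}" and e: "0 < e"
  obtain d where d: "d > 0" "ac_modulus g 0 (x + 1) e d"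
    using assms x e unfolding locally_absolutely_continuous_def absolutely_continuous_on_iff_modulus
    by (metis add_nonneg_pos atLeast_iff zero_less_one)
  have "dist (g y) (g x) < e" if y: "y \<in> {0..}" "dist y x < min d 1" for y
  proof -
    have "(\<Sum>k\<in>{()}. \<bar>g (max x y) - g (min x y)\<bar>) < e"
      using x y by (intro ac_modulus_family[OF d(2)]) (auto simp: dist_real_def)
    then show ?thesis by (auto simp: dist_real_def max_def min_def split: if_splits)
  qed
  then show "\<exists>d>0. \<forall>x'\<in>{0..}. dist x' x < d \<longrightarrow> dist (g x') (g x) < e"
    using d(1) by (intro exI[of _ "min d 1"]) auto
qed

section \<open>Total variation\<close>

text \<open>Partition points form infinite monotone sequences of which only the first
  \<open>n\<close> increments count. Repeated points are allowed, so that cutting with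
  \<open>min\<close> and \<open>max\<close> stays within the class.\<close>

definition variation_sums :: "(real \<Rightarrow> real) \<Rightarrow> real \<Rightarrow> real \<Rightarrow> real set" where
  "variation_sums g a b =
     {v. \<exists>n (x :: nat \<Rightarrow> real). mono x \<and> range x \<subseteq> {a..b} \<and> v = (\<Sum>i<n. \<bar>g (x (Suc i)) - g (x i)\<bar>)}"

definition total_variation :: "(real \<Rightarrow> real) \<Rightarrow> real \<Rightarrow> real \<Rightarrow> real" where
  "total_variation g a b = Sup (variation_sums g a b)"

lemma variation_sums_nonempty: "a \<le> b \<Longrightarrow> variation_sums g a b \<noteq> {}"
  unfolding variation_sums_def by (auto intro!: exI[of _ "0::nat"] exI[of _ "\<lambda>_. a"] monoI)

text \<open>Replacing each point by its minimum and by its maximum with \<open>b\<close> splits a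
  partition without inserting \<open>b\<close>: an increment that crosses \<open>b\<close> is
  bounded by the triangle inequality, any other one occurs on one side only.\<close>

lemma variation_sums_split:
  assumes v: "v \<in> variation_sums g a c" and "a \<le> b" "b \<le> c"
  obtains v1 v2 where "v1 \<in> variation_sums g a b" "v2 \<in> variation_sums g b c" "v \<le> v1 + v2"
proof -
  obtain n and x :: "nat \<Rightarrow> real" where x: "mono x" "range x \<subseteq> {a..c}" "v = (\<Sum>i<n. \<bar>g (x (Suc i)) - g (x i)\<bar>)"
    using v by (auto simp: variation_sums_def)
  define y z where "y i = min (x i) b" and "z i = max (x i) b" for i
  have "v \<le> (\<Sum>i<n. \<bar>g (y (Suc i)) - g (y i)\<bar> + \<bar>g (z (Suc i)) - g (z i)\<bar>)"
    unfolding x(3) y_def z_def by (intro sum_mono) (auto simp: min_def max_def)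
  also have "\<dots> = (\<Sum>i<n. \<bar>g (y (Suc i)) - g (y i)\<bar>) + (\<Sum>i<n. \<bar>g (z (Suc i)) - g (z i)\<bar>)"
    by (rule sum.distrib)
  finally have le: "v \<le> (\<Sum>i<n. \<bar>g (y (Suc i)) - g (y i)\<bar>) + (\<Sum>i<n. \<bar>g (z (Suc i)) - g (z i)\<bar>)" .
  have "mono y" "mono z" using x(1) unfolding mono_def y_def z_def by (meson max.mono min.mono order_refl)+
  moreover have "range y \<subseteq> {a..b}" "range z \<subseteq> {b..c}"
    using x(2) assms(2,3) by (auto simp: y_def z_def image_subset_iff)
  ultimately have "(\<Sum>i<n. \<bar>g (y (Suc i)) - g (y i)\<bar>) \<in> variation_sums g a b"
    "(\<Sum>i<n. \<bar>g (z (Suc i)) - g (z i)\<bar>) \<in> variation_sums g b c"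
    unfolding variation_sums_def by blast+
  then show ?thesis using le that by blast
qed

text \<open>The intervals of a monotone sequence are disjoint and their lengths telescope to at most
  \<open>t - s\<close>, so the modulus applies to them.\<close>

lemma variation_sums_small:
  assumes m: "ac_modulus g a b \<epsilon> \<delta>" and "a \<le> s" "t \<le> b" "t - s < \<delta>"
    and v: "v \<in> variation_sums g s t"
  shows "v < \<epsilon>"
proof -
  obtain n and x :: "nat \<Rightarrow> real" where x: "mono x" "range x \<subseteq> {s..t}" "v = (\<Sum>i<n. \<bar>g (x (Suc i)) - g (x i)\<bar>)"
    using v by (auto simp: variation_sums_def)
  have xb: "s \<le> x i" "x i \<le> t" for i using x(2) by (auto simp: image_subset_iff)
  have "(\<Sum>i<n. x (Suc i) - x i) = x n - x 0" by (rule sum_lessThan_telescope)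
  also have "\<dots> < \<delta>" using xb[of n] xb[of 0] assms by linarith
  finally have len: "(\<Sum>i<n. x (Suc i) - x i) < \<delta>" .
  show ?thesis unfolding x(3)
  proof (rule ac_modulus_family[OF m _ _ _ len])
    fix i show "a \<le> x i \<and> x i \<le> x (Suc i) \<and> x (Suc i) \<le> b"
      using xb[of i] xb[of "Suc i"] assms x(1) by (auto simp: mono_def)
  next
    fix i j :: nat assume "i \<noteq> j"
    then consider "Suc i \<le> j" | "Suc j \<le> i" by linarith
    then show "disjnt {x i<..<x (Suc i)} {x j<..<x (Suc j)}"
      by cases (use x(1) in \<open>fastforce simp: disjnt_def mono_def dest: order.strict_trans1\<close>)+
  qed simp
qed

text \<open>With \<delta> a modulus for 1, every piece of length \<delta>/2 has variation sums below
  1; induction on the number of pieces bounds the whole.\<close>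

lemma variation_sums_bdd:
  assumes ac: "absolutely_continuous_on a b g"
  shows "bdd_above (variation_sums g a b)"
proof -
  obtain \<delta> where \<delta>: "\<delta> > 0" "ac_modulus g a b 1 \<delta>"
    using ac unfolding absolutely_continuous_on_iff_modulus by (meson zero_less_one)
  have *: "v \<le> real m" if "c \<le> b" "c - a \<le> real m * (\<delta>/2)" "v \<in> variation_sums g a c" for m c v
    using that
  proof (induction m arbitrary: c v)
    case 0
    then obtain n and x :: "nat \<Rightarrow> real" where x: "range x \<subseteq> {a..c}" "v = (\<Sum>i<n. \<bar>g (x (Suc i)) - g (x i)\<bar>)"
      by (auto simp: variation_sums_def)
    have "x i = a" for i using x(1) 0(2) by (simp add: image_subset_iff) (meson order.antisym order.trans)
    then show ?case using x by simp
  next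
    case (Suc m)
    \<comment> \<open>Half of \<delta>, because the modulus asks for a total length strictly below
      \<delta>; the \<open>max\<close> covers an interval shorter than that.\<close>
    define c' where "c' = max a (c - \<delta>/2)"
    have "variation_sums g a c \<noteq> {}" using Suc.prems by auto
    then have "a \<le> c" by (force simp: variation_sums_def image_subset_iff)
    then have c': "a \<le> c'" "c' \<le> c" using \<delta> by (auto simp: c'_def)
    obtain v1 v2 where v: "v1 \<in> variation_sums g a c'" "v2 \<in> variation_sums g c' c" "v \<le> v1 + v2"
      using variation_sums_split[OF Suc.prems(3) c'] by blast
    have "c' - a \<le> real m * (\<delta>/2)"
      using Suc.prems(2) \<delta> by (auto simp: c'_def algebra_simps max_def)
    then have "v1 \<le> real m" using Suc.IH[of c' v1] c' v Suc.prems by auto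
    moreover have "v2 < 1"
      by (rule variation_sums_small[OF \<delta>(2) _ _ _ v(2)]) (use c' Suc.prems \<delta> in \<open>auto simp: c'_def\<close>)
    ultimately show ?case using v by simp
  qed
  obtain m :: nat where "(b - a) / (\<delta>/2) \<le> real m" using real_arch_simple by blast
  then have "b - a \<le> real m * (\<delta>/2)" using \<delta> by (simp add: field_simps)
  then show ?thesis using *[of b m] by (intro bdd_aboveI[of _ "real m"]) auto
qed

lemma absolutely_continuous_on_subinterval:
  assumes "absolutely_continuous_on a b g" "a \<le> s" "t \<le> b"
  shows "absolutely_continuous_on s t g"
  unfolding absolutely_continuous_on_iff_modulus
proof (intro allI impI)
  fix \<epsilon> :: real assume "\<epsilon> > 0"
  then obtain \<delta> where d: "\<delta> > 0" "ac_modulus g a b \<epsilon> \<delta>"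
    using assms(1) unfolding absolutely_continuous_on_iff_modulus by blast
  have "ac_modulus g s t \<epsilon> \<delta>"
    unfolding ac_modulus_def
    by (intro allI impI d(2)[unfolded ac_modulus_def, rule_format]) (use assms in fastforce)
  with d show "\<exists>\<delta>>0. ac_modulus g s t \<epsilon> \<delta>" by blast
qed

lemma total_variation_subadditive:
  assumes ac: "absolutely_continuous_on a c g" and "a \<le> b" "b \<le> c"
  shows "total_variation g a c \<le> total_variation g a b + total_variation g b c"
  unfolding total_variation_def[of g a c]
proof (rule cSup_least)
  show "variation_sums g a c \<noteq> {}" using assms by (intro variation_sums_nonempty) simp
  fix v assume "v \<in> variation_sums g a c"
  then obtain v1 v2 where v: "v1 \<in> variation_sums g a b" "v2 \<in> variation_sums g b c" "v \<le> v1 + v2"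
    using variation_sums_split assms by blast
  have "v1 \<le> total_variation g a b" "v2 \<le> total_variation g b c"
    unfolding total_variation_def using assms
    by (auto intro!: cSup_upper v variation_sums_bdd intro: absolutely_continuous_on_subinterval[OF ac])
  then show "v \<le> total_variation g a b + total_variation g b c" using v by simp
qed

lemma total_variation_increment:
  assumes ac: "absolutely_continuous_on a c g" and "a \<le> b" "b \<le> c"
  shows "total_variation g a b + \<bar>g c - g b\<bar> \<le> total_variation g a c"
proof -
  have "total_variation g a b \<le> total_variation g a c - \<bar>g c - g b\<bar>"
    unfolding total_variation_def[of g a b]
  proof (rule cSup_least)
    show "variation_sums g a b \<noteq> {}" using assms by (intro variation_sums_nonempty)
    fix v assume "v \<in> variation_sums g a b"
    then obtain n and x :: "nat \<Rightarrow> real" where x: "mono x" "range x \<subseteq> {a..b}" "v = (\<Sum>i<n. \<bar>g (x (Suc i)) - g (x i)\<bar>)"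
      by (auto simp: variation_sums_def)
    \<comment> \<open>The partition is continued by \<open>b\<close> and then \<open>c\<close>: the
      step to \<open>b\<close> only adds a nonnegative term, the step to \<open>c\<close> gives the
      increment of \<open>g\<close>.\<close>
    define y where "y i = (if i \<le> n then x i else if i = Suc n then b else c)" for i
    have xb: "a \<le> x i" "x i \<le> b" for i using x(2) by (auto simp: image_subset_iff)
    have xc: "x i \<le> c" for i using xb(2)[of i] assms(3) by linarith
    have "mono y" unfolding mono_def y_def using x(1) xb xc assms(2,3) by (auto simp: mono_def)
    moreover have "range y \<subseteq> {a..c}" using xb xc assms(2,3) by (auto simp: y_def)
    ultimately have "(\<Sum>i<Suc (Suc n). \<bar>g (y (Suc i)) - g (y i)\<bar>) \<in> variation_sums g a c"
      unfolding variation_sums_def by blast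
    then have "(\<Sum>i<Suc (Suc n). \<bar>g (y (Suc i)) - g (y i)\<bar>) \<le> total_variation g a c"
      unfolding total_variation_def by (intro cSup_upper variation_sums_bdd ac)
    moreover have "(\<Sum>i<n. \<bar>g (y (Suc i)) - g (y i)\<bar>) = v"
      unfolding x(3) by (intro sum.cong) (auto simp: y_def)
    ultimately show "v \<le> total_variation g a c - \<bar>g c - g b\<bar>" by (simp add: y_def)
  qed
  then show ?thesis by simp
qed

lemma total_variation_mono:
  assumes "absolutely_continuous_on a c g" and "a \<le> b" "b \<le> c"
  shows "total_variation g a b \<le> total_variation g a c"
  using total_variation_increment[OF assms] by linarith

lemma locally_absolutely_continuous_on:
  assumes "locally_absolutely_continuous g" "0 \<le> a"
  shows "absolutely_continuous_on a b g"
proof -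
  have "absolutely_continuous_on 0 (max b 1) g"
    using assms by (simp add: locally_absolutely_continuous_def)
  then show ?thesis by (rule absolutely_continuous_on_subinterval) (use assms in auto)
qed

text \<open>Choose for each interval a partition that nearly attains its variation. All these
  partitions together form one disjoint family of total length below \<delta>, to which the modulus
  of \<open>g\<close> for \<epsilon>/2 applies.\<close>

lemma locally_absolutely_continuous_total_variation:
  assumes g: "locally_absolutely_continuous g"
  shows "locally_absolutely_continuous (total_variation g 0)"
  unfolding locally_absolutely_continuous_def absolutely_continuous_on_iff_modulus
proof (intro allI impI)
  fix b \<epsilon> :: real assume b: "0 < b" and \<epsilon>: "0 < \<epsilon>"
  obtain \<delta> where \<delta>: "\<delta> > 0" "ac_modulus g 0 b (\<epsilon>/2) \<delta>"
    using g b \<epsilon> unfolding locally_absolutely_continuous_def absolutely_continuous_on_iff_modulus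
    by (meson half_gt_zero)
  let ?V = "total_variation g 0"
  have "ac_modulus ?V 0 b \<epsilon> \<delta>"
    unfolding ac_modulus_def
  proof (intro allI impI, elim conjE)
    fix I :: "(real \<times> real) set"
    assume fin: "finite I" and I: "\<forall>(s, t)\<in>I. 0 \<le> s \<and> s < t \<and> t \<le> b"
      and disj: "pairwise (\<lambda>(s, t) (u, v). disjnt {s<..<t} {u<..<v}) I"
      and len: "(\<Sum>(s, t)\<in>I. t - s) < \<delta>"
    \<comment> \<open>The \<open>card I\<close> errors add up to at most \<epsilon>/2; the summand 1
      keeps the denominator positive for empty \<open>I\<close>.\<close>
    define \<eta> where "\<eta> = \<epsilon> / (2 * (card I + 1))"
    have \<eta>: "0 < \<eta>" using \<epsilon> by (simp add: \<eta>_def)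
    have I': "0 \<le> fst p" "fst p < snd p" "snd p \<le> b" if "p \<in> I" for p
      using I that by (auto simp: case_prod_unfold)
    define P where "P p n x \<longleftrightarrow> mono x \<and> range x \<subseteq> {fst p..snd p} \<and>
       total_variation g (fst p) (snd p) < (\<Sum>i<n. \<bar>g (x (Suc i)) - g (x i)\<bar>) + \<eta>"
      for p and n :: nat and x :: "nat \<Rightarrow> real"
    have "\<exists>n x. P p n x" if p: "p \<in> I" for p
    proof -
      have "total_variation g (fst p) (snd p) - \<eta> < Sup (variation_sums g (fst p) (snd p))"
        using \<eta> by (simp add: total_variation_def)
      moreover have "variation_sums g (fst p) (snd p) \<noteq> {}"
        using I'[OF p] by (intro variation_sums_nonempty) simp
      ultimately obtain v where "v \<in> variation_sums g (fst p) (snd p)" "total_variation g (fst p) (snd p) - \<eta> < v"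
        by (rule less_cSupE)
      then show ?thesis unfolding variation_sums_def P_def by (auto simp: algebra_simps)
    qed
    then obtain n and x :: "real \<times> real \<Rightarrow> nat \<Rightarrow> real" where nx: "\<And>p. p \<in> I \<Longrightarrow> P p (n p) (x p)"
      by metis
    have x: "mono (x p)" "range (x p) \<subseteq> {fst p..snd p}"
      "total_variation g (fst p) (snd p) < (\<Sum>i<n p. \<bar>g (x p (Suc i)) - g (x p i)\<bar>) + \<eta>" if "p \<in> I" for p
      using nx[OF that] unfolding P_def by blast+
    have xb: "fst p \<le> x p i" "x p i \<le> snd p" if "p \<in> I" for p i
      using x(2)[OF that] by (auto simp: image_subset_iff)
    let ?K = "SIGMA p:I. {..<n p}"
    have fam: "(\<Sum>k\<in>?K. \<bar>g (x (fst k) (Suc (snd k))) - g (x (fst k) (snd k))\<bar>) < \<epsilon>/2"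
    proof (rule ac_modulus_family[OF \<delta>(2)])
      show "finite ?K" using fin by simp
      fix k assume "k \<in> ?K"
      then have p: "fst k \<in> I" by auto
      show "0 \<le> x (fst k) (snd k) \<and> x (fst k) (snd k) \<le> x (fst k) (Suc (snd k)) \<and> x (fst k) (Suc (snd k)) \<le> b"
        using xb[OF p, of "snd k"] xb[OF p, of "Suc (snd k)"] I'[OF p] x(1)[OF p] by (auto simp: mono_def)
    next
      fix k l assume kl: "k \<in> ?K" "l \<in> ?K" "k \<noteq> l"
      have p: "fst k \<in> I" "fst l \<in> I" using kl by auto
      show "disjnt {x (fst k) (snd k)<..<x (fst k) (Suc (snd k))} {x (fst l) (snd l)<..<x (fst l) (Suc (snd l))}"
      proof (cases "fst k = fst l")
        case True
        then have "snd k \<noteq> snd l" using kl by (auto simp: prod_eq_iff)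
        then consider "Suc (snd k) \<le> snd l" | "Suc (snd l) \<le> snd k" by linarith
        then show ?thesis
        proof cases
          case 1
          then have "x (fst k) (Suc (snd k)) \<le> x (fst l) (snd l)" using True x(1)[OF p(1)] by (simp add: mono_def)
          then show ?thesis by (auto simp: disjnt_def)
        next
          case 2
          then have "x (fst l) (Suc (snd l)) \<le> x (fst k) (snd k)" using True x(1)[OF p(1)] by (simp add: mono_def)
          then show ?thesis by (auto simp: disjnt_def)
        qed
      next
        case False
        then have "disjnt {fst (fst k)<..<snd (fst k)} {fst (fst l)<..<snd (fst l)}"
          using disj p unfolding pairwise_def by (metis (mono_tags, lifting) case_prod_unfold)
        moreover have "{x (fst k) (snd k)<..<x (fst k) (Suc (snd k))} \<subseteq> {fst (fst k)<..<snd (fst k)}"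
          using xb[OF p(1), of "snd k"] xb[OF p(1), of "Suc (snd k)"] by auto
        moreover have "{x (fst l) (snd l)<..<x (fst l) (Suc (snd l))} \<subseteq> {fst (fst l)<..<snd (fst l)}"
          using xb[OF p(2), of "snd l"] xb[OF p(2), of "Suc (snd l)"] by auto
        ultimately show ?thesis by (meson disjnt_subset1 disjnt_subset2)
      qed
    next
      have "(\<Sum>k\<in>?K. x (fst k) (Suc (snd k)) - x (fst k) (snd k)) = (\<Sum>p\<in>I. \<Sum>i<n p. x p (Suc i) - x p i)"
        using fin by (subst sum.Sigma) (auto simp: case_prod_unfold)
      also have "\<dots> = (\<Sum>p\<in>I. x p (n p) - x p 0)" by (simp add: sum_lessThan_telescope)
      also have "\<dots> \<le> (\<Sum>p\<in>I. snd p - fst p)" using xb by (intro sum_mono diff_mono) auto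
      also have "\<dots> < \<delta>" using len by (simp add: case_prod_unfold)
      finally show "(\<Sum>k\<in>?K. x (fst k) (Suc (snd k)) - x (fst k) (snd k)) < \<delta>" .
    qed
    have "(\<Sum>(s, t)\<in>I. \<bar>?V t - ?V s\<bar>) = (\<Sum>p\<in>I. \<bar>?V (snd p) - ?V (fst p)\<bar>)" by (simp add: case_prod_unfold)
    also have "\<dots> \<le> (\<Sum>p\<in>I. (\<Sum>i<n p. \<bar>g (x p (Suc i)) - g (x p i)\<bar>) + \<eta>)"
    proof (rule sum_mono)
      fix p assume p: "p \<in> I"
      have "?V (fst p) \<le> ?V (snd p)" "?V (snd p) \<le> ?V (fst p) + total_variation g (fst p) (snd p)"
        using I'[OF p] locally_absolutely_continuous_on[OF g]
        by (auto intro!: total_variation_mono total_variation_subadditive)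
      then show "\<bar>?V (snd p) - ?V (fst p)\<bar> \<le> (\<Sum>i<n p. \<bar>g (x p (Suc i)) - g (x p i)\<bar>) + \<eta>"
        using x(3)[OF p] by linarith
    qed
    also have "\<dots> = (\<Sum>p\<in>I. \<Sum>i<n p. \<bar>g (x p (Suc i)) - g (x p i)\<bar>) + card I * \<eta>"
      by (simp add: sum.distrib)
    also have "(\<Sum>p\<in>I. \<Sum>i<n p. \<bar>g (x p (Suc i)) - g (x p i)\<bar>) = (\<Sum>k\<in>?K. \<bar>g (x (fst k) (Suc (snd k))) - g (x (fst k) (snd k))\<bar>)"
      using fin by (subst sum.Sigma) (auto simp: case_prod_unfold)
    also have "\<dots> + card I * \<eta> < \<epsilon>/2 + \<epsilon>/2"
    proof (rule add_less_le_mono[OF fam])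
      show "card I * \<eta> \<le> \<epsilon>/2" using \<epsilon> by (simp add: \<eta>_def field_simps)
    qed
    finally show "(\<Sum>(s, t)\<in>I. \<bar>?V t - ?V s\<bar>) < \<epsilon>" by simp
  qed
  then show "\<exists>\<delta>>0. ac_modulus ?V 0 b \<epsilon> \<delta>" using \<delta> by blast
qed

section \<open>Stieltjes measures and their densities\<close>

text \<open>Cover the null set by an open set of length below \<delta> and cut this into
  nonoverlapping closed intervals. Any finitely many of them have mass at most \<epsilon> by
  absolute continuity, and continuity from below passes to the whole union.\<close>

lemma null_sets_interval_measure:
  fixes W :: "real \<Rightarrow> real"
  assumes W: "locally_absolutely_continuous W" and mono: "mono W" and cont: "continuous_on UNIV W"
    and Z: "Z \<in> null_sets lborel" and n: "Z \<subseteq> {0<..<n}"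
  shows "Z \<in> null_sets (interval_measure W)"
proof (cases "0 < n")
  case False
  then have "Z = {}" using n by force
  then show ?thesis by simp
next
  case True
  let ?M = "interval_measure W"
  have Icc: "emeasure ?M {a..b} = ennreal (W b - W a)" if "a \<le> b" for a b
    using that mono cont by (intro emeasure_interval_measure_Icc) (auto simp: mono_def)
  have "emeasure ?M Z \<le> ennreal \<epsilon>" if \<epsilon>: "0 < \<epsilon>" for \<epsilon>
  proof -
    obtain \<delta> where \<delta>: "\<delta> > 0" "ac_modulus W 0 n \<epsilon> \<delta>"
      using W True \<epsilon> unfolding locally_absolutely_continuous_def absolutely_continuous_on_iff_modulus by blast
    have "Z \<in> sets lebesgue" using Z by auto
    then obtain T where T: "open T" "Z \<subseteq> T" "emeasure lebesgue (T - Z) < ennreal \<delta>"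
      using sets_lebesgue_outer_open[OF _ \<delta>(1)] by metis
    define U where "U = T \<inter> {0<..<n}"
    have U: "open U" "Z \<subseteq> U" "U \<subseteq> {0..n}" using T n by (auto simp: U_def)
    have [measurable]: "U \<in> sets borel" "T \<in> sets borel" "Z \<in> sets borel" using U T Z by auto
    have "emeasure lborel U \<le> emeasure lborel (T - Z)"
    proof -
      have "emeasure lborel U \<le> emeasure lborel T" by (intro emeasure_mono) (auto simp: U_def)
      also have "\<dots> = emeasure lborel (T - Z)" by (rule emeasure_Diff_null_set[symmetric]) (use Z in auto)
      finally show ?thesis .
    qed
    also have "\<dots> < ennreal \<delta>" using T(3) by simp
    finally have mU: "emeasure lborel U < ennreal \<delta>" .
    have box: "box 0 n \<noteq> {}" using True by simp
    \<comment> \<open>The gauge is \<open>U\<close> at every point of \<open>U\<close>, so the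
      covering lemma returns intervals inside \<open>U\<close>.\<close>
    have gauge: "gauge (\<lambda>x. if x \<in> U then U else UNIV)" using U(1) by (auto simp: gauge_def)
    have Ucbox: "U \<subseteq> cbox 0 n" using U(3) by simp
    obtain D where D: "countable D" 
      "\<And>K. K \<in> D \<Longrightarrow> interior K \<noteq> {} \<and> (\<exists>c d. K = cbox c d)"
      "pairwise (\<lambda>A B. interior A \<inter> interior B = {}) D"
      "\<And>K. K \<in> D \<Longrightarrow> \<exists>x \<in> U \<inter> K. K \<subseteq> (if x \<in> U then U else UNIV)"
      "U \<subseteq> \<Union>D"
      by (rule covering_lemma[OF Ucbox box gauge]) blast
    have DU: "K \<subseteq> U" if "K \<in> D" for K using D(4)[OF that] by (auto split: if_splits)
    have "\<exists>c d. c < d \<and> K = {c..d}" if K: "K \<in> D" for K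
    proof -
      obtain c d where "K = {c..d}" "interior K \<noteq> {}" using D(2)[OF K] by auto
      then show ?thesis by (intro exI[of _ c] exI[of _ d]) auto
    qed
    then obtain c d where cd: "\<And>K. K \<in> D \<Longrightarrow> c K < d K \<and> K = {c K..d K}" by metis
    have intK: "interior K = {c K<..<d K}" if "K \<in> D" for K
      using cd[OF that] by (metis interior_atLeastAtMost_real)
    \<comment> \<open>Neighbouring intervals may share end points. Lengths are therefore added over
      the disjoint interiors, while the masses of the closed intervals are only bounded by
      subadditivity.\<close>
    have fin: "emeasure ?M (\<Union>F) \<le> ennreal \<epsilon>" if F: "finite F" "F \<subseteq> D" for F
    proof -
      have disjF: "disjoint_family_on (\<lambda>K. {c K<..<d K}) F"
        using D(3) F(2) intK by (auto simp: disjoint_family_on_def pairwise_def subset_iff)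
      have "ennreal (\<Sum>K\<in>F. d K - c K) = (\<Sum>K\<in>F. emeasure lborel {c K<..<d K})"
        using cd F(2) by (subst sum_ennreal[symmetric]) (auto intro!: sum.cong simp: less_imp_le subset_iff)
      also have "\<dots> = emeasure lborel (\<Union>K\<in>F. {c K<..<d K})"
        using F(1) disjF by (intro sum_emeasure) auto
      also have "\<dots> \<le> emeasure lborel U"
      proof (rule emeasure_mono)
        show "(\<Union>K\<in>F. {c K<..<d K}) \<subseteq> U"
        proof
          fix x assume "x \<in> (\<Union>K\<in>F. {c K<..<d K})"
          then obtain K where "K \<in> D" "x \<in> interior K" using F(2) intK by auto
          then show "x \<in> U" using DU interior_subset by blast
        qed
      qed simp
      also note mU
      finally have len: "(\<Sum>K\<in>F. d K - c K) < \<delta>"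
        by (subst (asm) ennreal_less_iff) (use cd F(2) in \<open>auto intro!: sum_nonneg simp: less_imp_le subset_iff\<close>)
      have "(\<Sum>K\<in>F. \<bar>W (d K) - W (c K)\<bar>) < \<epsilon>"
      proof (rule ac_modulus_family[OF \<delta>(2) F(1) _ _ len])
        fix K assume K: "K \<in> F"
        then have "{c K..d K} \<subseteq> {0..n}" "c K < d K" using DU U(3) cd F(2) by blast+
        then show "0 \<le> c K \<and> c K \<le> d K \<and> d K \<le> n" by auto
      next
        fix K L assume "K \<in> F" "L \<in> F" "K \<noteq> L"
        then show "disjnt {c K<..<d K} {c L<..<d L}" using disjF by (auto simp: disjoint_family_on_def disjnt_def)
      qed
      have "emeasure ?M (\<Union>F) = emeasure ?M (\<Union>K\<in>F. {c K..d K})"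
        using cd F(2) by (intro arg_cong[where f="emeasure ?M"]) blast
      also have "\<dots> \<le> (\<Sum>K\<in>F. emeasure ?M {c K..d K})"
        using F(1) by (intro emeasure_subadditive_finite) auto
      also have "\<dots> = (\<Sum>K\<in>F. ennreal \<bar>W (d K) - W (c K)\<bar>)"
      proof (rule sum.cong[OF refl])
        fix K assume "K \<in> F"
        then have "c K \<le> d K" using cd F(2) by (auto simp: less_imp_le subset_iff)
        then show "emeasure ?M {c K..d K} = ennreal \<bar>W (d K) - W (c K)\<bar>"
          using monoD[OF mono, of "c K" "d K"] by (simp only: Icc) simp
      qed
      also have "\<dots> = ennreal (\<Sum>K\<in>F. \<bar>W (d K) - W (c K)\<bar>)" by (rule sum_ennreal) simp
      also have "\<dots> \<le> ennreal \<epsilon>" using \<open>(\<Sum>K\<in>F. \<bar>W (d K) - W (c K)\<bar>) < \<epsilon>\<close> by (intro ennreal_leI) simp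
      finally show ?thesis .
    qed
    have "emeasure ?M (\<Union>D) \<le> ennreal \<epsilon>"
    proof (cases "D = {}")
      case True
      then show ?thesis by simp
    next
      case False
      define B where "B k = \<Union>(from_nat_into D ` {..k})" for k :: nat
      have sub: "from_nat_into D ` {..k} \<subseteq> D" for k using False by (auto intro: from_nat_into)
      have "(\<Union>k. B k) = \<Union>(range (from_nat_into D))" unfolding B_def by blast
      then have UB: "(\<Union>k. B k) = \<Union>D" using range_from_nat_into[OF False D(1)] by simp
      have incB: "incseq B"
        unfolding incseq_def B_def by (intro allI impI Union_mono image_mono) auto
      have Dsets: "K \<in> sets borel" if "K \<in> D" for K using cd[OF that] by (metis borel_closed closed_atLeastAtMost)
      have "B k \<in> sets borel" for k unfolding B_def using sub Dsets by (intro sets.finite_Union) auto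
      then have "(SUP k. emeasure ?M (B k)) = emeasure ?M (\<Union>k. B k)"
        using incB by (intro SUP_emeasure_incseq) auto
      moreover have "(SUP k. emeasure ?M (B k)) \<le> ennreal \<epsilon>"
        unfolding B_def by (intro SUP_least fin sub) simp
      ultimately show ?thesis unfolding UB by simp
    qed
    moreover have "emeasure ?M Z \<le> emeasure ?M (\<Union>D)"
    proof (rule emeasure_mono)
      show "Z \<subseteq> \<Union>D" using U(2) D(5) by blast
      have "\<Union>D = U" using DU D(5) by blast
      then show "\<Union>D \<in> sets ?M" by simp
    qed
    ultimately show ?thesis by (rule order.trans[rotated])
  qed
  then have "emeasure ?M Z \<le> 0" by (rule_tac ennreal_le_epsilon) simp
  then show ?thesis using Z by (auto simp: null_sets_def)
qed

text \<open>Constancy left of 0 extends continuity from [0, \<infinity>) to the line and makes every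
  \<open>{- k..0}\<close> a null set of the Stieltjes measure; the rest of a null set is exhausted
  by its parts in (0, k).\<close>

lemma absolutely_continuous_interval_measure:
  fixes W :: "real \<Rightarrow> real"
  assumes W: "locally_absolutely_continuous W" and mono: "mono W" and W0: "\<And>x. x \<le> 0 \<Longrightarrow> W x = W 0"
  shows "continuous_on UNIV W" "absolutely_continuous lborel (interval_measure W)"
proof -
  have "continuous_on UNIV (\<lambda>x. W (max 0 x))"
    using locally_absolutely_continuous_imp_continuous[OF W]
    by (rule continuous_on_compose2) (auto intro: continuous_on_max continuous_on_const continuous_on_id)
  also have "(\<lambda>x. W (max 0 x)) = W"
  proof
    show "W (max 0 x) = W x" for x using W0[of x] by (cases "x \<le> 0") (simp_all add: max_def)
  qed
  finally show cont: "continuous_on UNIV W" .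
  let ?M = "interval_measure W"
  have Icc: "emeasure ?M {a..b} = ennreal (W b - W a)" if "a \<le> b" for a b
    using that mono cont by (intro emeasure_interval_measure_Icc) (auto simp: mono_def)
  show "absolutely_continuous lborel ?M"
    unfolding absolutely_continuous_def
  proof
    fix Z assume Z: "Z \<in> null_sets (lborel :: real measure)"
    then have [measurable]: "Z \<in> sets borel" by auto
    have neg: "{- real k..0} \<in> null_sets ?M" for k
    proof -
      have "W (- real k) = W 0" by (rule W0) simp
      then show ?thesis by (simp add: null_sets_def Icc)
    qed
    have pos: "Z \<inter> {0<..<real k} \<in> null_sets ?M" for k
      by (rule null_sets_interval_measure[OF W mono cont, of _ "real k"])
         (auto intro!: null_set_Int2 Z)
    have "(\<Union>k. {- real k..0} \<union> (Z \<inter> {0<..<real k})) \<in> null_sets ?M"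
      using neg pos by (intro null_sets_UN null_sets.Un) auto
    note N = this
    have sub: "Z \<subseteq> (\<Union>k. {- real k..0} \<union> (Z \<inter> {0<..<real k}))"
    proof
      fix x assume "x \<in> Z"
      obtain k :: nat where "\<bar>x\<bar> < real k" using reals_Archimedean2 by blast
      then show "x \<in> (\<Union>k. {- real k..0} \<union> (Z \<inter> {0<..<real k}))" using \<open>x \<in> Z\<close> by (intro UN_I[of k]) auto
    qed
    show "Z \<in> null_sets ?M" by (rule null_sets_subset[OF N _ sub]) simp
  qed
qed

text \<open>The Radon-Nikodym density of the Stieltjes measure takes values in [0, \<infinity>]. It
  is finite almost everywhere because bounded intervals have finite mass, so a real-valued version
  has the same integrals.\<close>

lemma monotone_ac_density:
  fixes W :: "real \<Rightarrow> real"
  assumes W: "locally_absolutely_continuous W" and mono: "mono W" and W0: "\<And>x. x \<le> 0 \<Longrightarrow> W x = W 0"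
  obtains h :: "real \<Rightarrow> real" where "h \<in> borel_measurable borel" "\<And>x. 0 \<le> h x"
    "\<And>s t. s \<le> t \<Longrightarrow> (\<integral>\<^sup>+y\<in>{s..t}. ennreal (h y) \<partial>lborel) = ennreal (W t - W s)"
proof -
  note ac = absolutely_continuous_interval_measure[OF assms]
  have sets_eq: "sets (interval_measure W) = sets lborel"
    by simp
  have "\<exists>f\<in>borel_measurable lborel. density lborel f = interval_measure W"
    by (rule sigma_finite_measure.Radon_Nikodym[OF sigma_finite_lborel ac(2) sets_eq])
  then obtain f where f[measurable]: "f \<in> borel_measurable borel" and df: "density lborel f = interval_measure W" by auto
  have I: "(\<integral>\<^sup>+y\<in>{s..t}. f y \<partial>lborel) = ennreal (W t - W s)" if "s \<le> t" for s t
  proof -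
    have "(\<integral>\<^sup>+y\<in>{s..t}. f y \<partial>lborel) = emeasure (density lborel f) {s..t}"
      by (simp add: emeasure_density)
    also have "\<dots> = ennreal (W t - W s)"
      unfolding df using that mono ac(1) by (intro emeasure_interval_measure_Icc) (auto simp: mono_def)
    finally show ?thesis .
  qed
  have "AE y in lborel. \<forall>k::nat. f y * indicator {- real k..real k} y \<noteq> \<infinity>"
    unfolding AE_all_countable
    by (intro allI nn_integral_PInf_AE) (auto simp: I)
  then have fin: "AE y in lborel. f y \<noteq> \<infinity>"
  proof eventually_elim
    case (elim y)
    obtain k :: nat where "\<bar>y\<bar> < real k" using reals_Archimedean2 by blast
    then show ?case using elim[rule_format, of k] by (auto simp: indicator_def abs_less_iff split: if_splits)
  qed
  show ?thesis
  proof (rule that[of "\<lambda>y. enn2real (f y)"])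
    fix s t :: real assume st: "s \<le> t"
    have "(\<integral>\<^sup>+y\<in>{s..t}. ennreal (enn2real (f y)) \<partial>lborel) = (\<integral>\<^sup>+y\<in>{s..t}. f y \<partial>lborel)"
      by (intro nn_integral_cong_AE, use fin in eventually_elim) (auto simp: top.not_eq_extremum)
    then show "(\<integral>\<^sup>+y\<in>{s..t}. ennreal (enn2real (f y)) \<partial>lborel) = ennreal (W t - W s)" using I[OF st] by simp
  qed auto
qed

text \<open>Local absolute continuity says nothing about \<open>g\<close> on the negative axis;
  composing with \<open>max 0\<close> makes it constant there, as \<open>monotone_ac_density\<close>
  requires.\<close>

lemma locally_absolutely_continuous_max:
  assumes "locally_absolutely_continuous g"
  shows "locally_absolutely_continuous (\<lambda>x. g (max 0 x))"
proof -
  have "ac_modulus (\<lambda>x. g (max 0 x)) 0 b \<epsilon> \<delta>" if "ac_modulus g 0 b \<epsilon> \<delta>" for b \<epsilon> \<delta>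
    unfolding ac_modulus_def
  proof (intro allI impI)
    fix I :: "(real \<times> real) set"
    assume I: "finite I \<and> (\<forall>(s, t)\<in>I. 0 \<le> s \<and> s < t \<and> t \<le> b) \<and>
        pairwise (\<lambda>(s, t) (u, v). disjnt {s<..<t} {u<..<v}) I \<and> (\<Sum>(s, t)\<in>I. t - s) < \<delta>"
    then have "(\<Sum>(s, t)\<in>I. \<bar>g (max 0 t) - g (max 0 s)\<bar>) = (\<Sum>(s, t)\<in>I. \<bar>g t - g s\<bar>)"
      by (intro sum.cong) (auto simp: max_def)
    also have "\<dots> < \<epsilon>" using that[unfolded ac_modulus_def, rule_format, OF I] .
    finally show "(\<Sum>(s, t)\<in>I. \<bar>g (max 0 t) - g (max 0 s)\<bar>) < \<epsilon>" .
  qed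
  then show ?thesis
    using assms unfolding locally_absolutely_continuous_def absolutely_continuous_on_iff_modulus by blast
qed

text \<open>Jordan decomposition: the total variation V and the difference V - g are both increasing
  and absolutely continuous, and the difference of their densities is the density of
  \<open>g\<close>.\<close>

lemma locally_absolutely_continuous_density:
  assumes g: "locally_absolutely_continuous g"
  obtains h :: "real \<Rightarrow> real" where "h \<in> borel_measurable borel"
    "\<And>x. 0 \<le> x \<Longrightarrow> set_integrable lborel {0..x} h"
    "\<And>x. 0 \<le> x \<Longrightarrow> (LINT y:{0..x}|lborel. h y) = g x - g 0"
proof -
  define V where "V x = total_variation g 0 (max 0 x)" for x
  define W where "W x = V x - g (max 0 x)" for x
  have lacV: "locally_absolutely_continuous V"
    unfolding V_def by (intro locally_absolutely_continuous_max locally_absolutely_continuous_total_variation g)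
  have lacW: "locally_absolutely_continuous W"
    unfolding W_def by (intro locally_absolutely_continuous_diff lacV locally_absolutely_continuous_max g)
  have inc: "V s + \<bar>g (max 0 t) - g (max 0 s)\<bar> \<le> V t" if "s \<le> t" for s t
    unfolding V_def using that locally_absolutely_continuous_on[OF g]
    by (intro total_variation_increment) auto
  have mV: "mono V" and mW: "mono W"
    unfolding mono_def W_def using inc by (smt (verit))+
  obtain v where v: "v \<in> borel_measurable borel" "\<And>x. 0 \<le> v x"
    "\<And>s t. s \<le> t \<Longrightarrow> (\<integral>\<^sup>+y\<in>{s..t}. ennreal (v y) \<partial>lborel) = ennreal (V t - V s)"
    by (rule monotone_ac_density[OF lacV mV]) (auto simp: V_def max_def)
  obtain w where w: "w \<in> borel_measurable borel" "\<And>x. 0 \<le> w x"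
    "\<And>s t. s \<le> t \<Longrightarrow> (\<integral>\<^sup>+y\<in>{s..t}. ennreal (w y) \<partial>lborel) = ennreal (W t - W s)"
    by (rule monotone_ac_density[OF lacW mW]) (auto simp: W_def V_def max_def)
  have *: "set_integrable lborel {0..x} k \<and> (LINT y:{0..x}|lborel. k y) = K x - K 0"
    if "k \<in> borel_measurable borel" "\<And>x. 0 \<le> k x" "mono K"
    "\<And>s t. s \<le> t \<Longrightarrow> (\<integral>\<^sup>+y\<in>{s..t}. ennreal (k y) \<partial>lborel) = ennreal (K t - K s)" "0 \<le> x" for k K :: "real \<Rightarrow> real" and x
  proof -
    have eq: "(\<integral>\<^sup>+y. ennreal (indicator {0..x} y *\<^sub>R k y) \<partial>lborel) = ennreal (K x - K 0)"
      unfolding that(4)[OF that(5), symmetric] by (intro nn_integral_cong) (auto simp: indicator_def)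
    have "has_bochner_integral lborel (\<lambda>y. indicator {0..x} y *\<^sub>R k y) (K x - K 0)"
      by (rule has_bochner_integral_nn_integral[OF _ _ _ eq]) (use that in \<open>auto simp: mono_def\<close>)
    then show ?thesis unfolding set_integrable_def set_lebesgue_integral_def by (auto simp: has_bochner_integral_iff)
  qed
  show ?thesis
  proof (rule that[of "\<lambda>y. v y - w y"])
    fix x :: real assume x: "0 \<le> x"
    note vw = *[OF v(1,2) mV v(3) x] *[OF w(1,2) mW w(3) x]
    then show "set_integrable lborel {0..x} (\<lambda>y. v y - w y)" by (intro set_integral_diff) auto
    have "(LINT y:{0..x}|lborel. v y - w y) = (LINT y:{0..x}|lborel. v y) - (LINT y:{0..x}|lborel. w y)"
      using vw by (intro set_integral_diff) auto
    then show "(LINT y:{0..x}|lborel. v y - w y) = g x - g 0" using vw x by (simp add: W_def V_def max_def)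
  qed (use v w in measurable)
qed

section \<open>Polar coordinates\<close>

text \<open>In a basis of eigenvectors the exponential series splits into scalar series with sums
  exp (e b * ln l) = l powr e b; \<open>\<rho> b\<close> is the coordinate along \<open>b\<close>.
  Linearity, measurability and the behaviour as l tends to 0 can be read off this formula.\<close>

lemma dilation_eigenbasis:
  fixes A :: "real^'n \<Rightarrow> real^'n"
  assumes A: "linear A" "diagonalisable A"
    and pos: "\<forall>v c. v \<noteq> 0 \<longrightarrow> A v = c *\<^sub>R v \<longrightarrow> 0 < c"
  obtains B and e :: "real^'n \<Rightarrow> real" and \<rho> :: "real^'n \<Rightarrow> real^'n \<Rightarrow> real"
  where "finite B" "\<And>b. b \<in> B \<Longrightarrow> 0 < e b" "\<And>b. linear (\<rho> b)"
    "\<And>l x. 0 < l \<Longrightarrow> dilation A l x = (\<Sum>b\<in>B. (l powr e b * \<rho> b x) *\<^sub>R b)"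
proof -
  obtain B where B: "independent B" "span B = UNIV" and eig: "\<And>b. b \<in> B \<Longrightarrow> \<exists>c. A b = c *\<^sub>R b"
    using A(2) unfolding diagonalisable_def by blast
  obtain e where e: "\<And>b. b \<in> B \<Longrightarrow> A b = e b *\<^sub>R b" using eig by metis
  have fin: "finite B" using B(1) by (rule independent_imp_finite)
  define \<rho> where "\<rho> b x = representation B x b" for b x
  have lin: "linear (\<rho> b)" for b
    unfolding \<rho>_def using B by (intro linearI) (simp_all add: representation_add representation_scale)
  have x_eq: "x = (\<Sum>b\<in>B. \<rho> b x *\<^sub>R b)" for x
    unfolding \<rho>_def using sum_representation_eq[OF B(1) _ fin, of x] B(2) by simp
  have pow: "(A ^^ k) x = (\<Sum>b\<in>B. (e b ^ k * \<rho> b x) *\<^sub>R b)" for k x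
  proof (induction k)
    case 0
    then show ?case using x_eq[of x] by simp
  next
    case (Suc k)
    have "(A ^^ Suc k) x = A (\<Sum>b\<in>B. (e b ^ k * \<rho> b x) *\<^sub>R b)" using Suc by simp
    also have "\<dots> = (\<Sum>b\<in>B. (e b ^ k * \<rho> b x) *\<^sub>R A b)"
      by (simp add: linear_sum[OF A(1)] linear_scale[OF A(1)])
    also have "\<dots> = (\<Sum>b\<in>B. (e b ^ Suc k * \<rho> b x) *\<^sub>R b)"
      by (intro sum.cong) (auto simp: e)
    finally show ?case .
  qed
  have dil: "dilation A l x = (\<Sum>b\<in>B. (l powr e b * \<rho> b x) *\<^sub>R b)" if "0 < l" for l x
  proof -
    have "(\<lambda>k. \<Sum>b\<in>B. ((e b * ln l) ^ k /\<^sub>R fact k) *\<^sub>R (\<rho> b x *\<^sub>R b)) sums (\<Sum>b\<in>B. exp (e b * ln l) *\<^sub>R (\<rho> b x *\<^sub>R b))"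
      by (intro sums_sum sums_scaleR_left exp_converges)
    also have "(\<lambda>k. \<Sum>b\<in>B. ((e b * ln l) ^ k /\<^sub>R fact k) *\<^sub>R (\<rho> b x *\<^sub>R b)) = (\<lambda>k. ((ln l) ^ k / fact k) *\<^sub>R (A ^^ k) x)"
      by (intro ext) (simp add: pow scaleR_sum_right power_mult_distrib field_simps)
    also have "(\<Sum>b\<in>B. exp (e b * ln l) *\<^sub>R (\<rho> b x *\<^sub>R b)) = (\<Sum>b\<in>B. (l powr e b * \<rho> b x) *\<^sub>R b)"
      using that by (simp add: powr_def)
    finally show ?thesis unfolding dilation_def by (rule sums_unique[symmetric])
  qed
  have epos: "0 < e b" if "b \<in> B" for b
  proof (rule pos[rule_format, OF _ e[OF that]])
    show "b \<noteq> 0" using that B(1) dependent_zero by blast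
  qed
  show ?thesis using that[OF fin epos lin dil] by blast
qed

text \<open>The one-dimensional weight that remains after integration over the sphere. It contains
  the Jacobian \<open>r powr (Q - 1)\<close> and may be infinite.\<close>

definition spherical_integral ::
    "(real^'n \<Rightarrow> real^'n) \<Rightarrow> (real^'n) measure \<Rightarrow> (real^'n \<Rightarrow> real) \<Rightarrow> real \<Rightarrow> ennreal" where
  "spherical_integral A \<sigma> w r = (\<integral>\<^sup>+y. ennreal (r powr (homogeneous_dim A - 1) * w (dilation A r y)) \<partial>\<sigma>)"

context homogeneous_quasi_norm
begin

text \<open>\<open>N\<close> has a positive minimum m on the Euclidean unit sphere. A point of norm
  at least 1 is moved onto that sphere by a dilation with l \<le> 1, so its quasi-norm is at least
  m. A dilation that carries the quasi-ball into {N < m} thus carries it into the Euclidean unit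
  ball, and as an injective linear map it is bounded below.\<close>

lemma quasi_ball_bounded: "bounded {x. N x \<le> R}"
proof -
  have pos: "\<forall>v c. v \<noteq> 0 \<longrightarrow> A v = c *\<^sub>R v \<longrightarrow> 0 < c" using eigenvalues_pos by blast
  obtain B and e :: "real^'n \<Rightarrow> real" and \<rho> :: "real^'n \<Rightarrow> real^'n \<Rightarrow> real" where
    B: "finite B" "\<And>b. b \<in> B \<Longrightarrow> 0 < e b" "\<And>b. linear (\<rho> b)"
    "\<And>l x. 0 < l \<Longrightarrow> dilation A l x = (\<Sum>b\<in>B. (l powr e b * \<rho> b x) *\<^sub>R b)"
    by (rule dilation_eigenbasis[OF linear_A diagonalisable_A pos]) (rule that)
  define E where "E l x = (\<Sum>b\<in>B. (l powr e b * \<rho> b x) *\<^sub>R b)" for l x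
  have NE: "N (E l x) = l * N x" if "0 < l" for l x
    using homogeneous[OF that] B(4)[OF that] by (simp add: E_def)
  have linE: "linear (E l)" for l
    unfolding E_def
    by (rule linearI) (simp_all add: linear_add[OF B(3)] linear_scale[OF B(3)] algebra_simps sum.distrib scaleR_sum_right)
  have E1: "E 1 z = z" for z
  proof -
    have "dilation A 1 z = (\<Sum>k. if k = 0 then z else 0)"
      unfolding dilation_def by (intro suminf_cong) auto
    also have "\<dots> = z" by (subst suminf_finite[of "{0}"]) auto
    finally show ?thesis using B(4)[of 1 z] by (simp add: E_def)
  qed
  obtain s where s: "s \<in> sphere 0 1" "\<And>z. z \<in> sphere 0 1 \<Longrightarrow> N s \<le> N z"
    using continuous_attains_inf[of "sphere 0 1" N] continuous_on_subset[OF continuous] by auto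
  have m: "0 < N s"
    using s(1) nonneg[of s] definite[of s] by (auto simp: less_le)
  have ge: "N s \<le> N z" if z: "1 \<le> norm z" for z
  proof -
    \<comment> \<open>As the exponents are positive and \<open>0 powr e b = 0\<close>, the curve of
      dilates extends continuously to l = 0 with value 0; the intermediate value theorem then finds
      a point of the sphere on it.\<close>
    have "continuous_on {0..1} (\<lambda>l. norm (E l z))"
      unfolding E_def using B(2) by (intro continuous_intros continuous_on_powr') (auto simp: less_imp_le)
    moreover have "norm (E 0 z) \<le> 1" by (simp add: E_def)
    ultimately obtain l where l: "0 \<le> l" "l \<le> 1" "norm (E l z) = 1"
      using IVT'[of "\<lambda>l. norm (E l z)" 0 1 1] z E1 by auto
    have "l \<noteq> 0" using l(3) by (auto simp: E_def)
    then have "0 < l" using l by simp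
    have "N s \<le> N (E l z)" using l(3) by (intro s) simp
    also have "\<dots> = l * N z" by (rule NE) fact
    also have "\<dots> \<le> 1 * N z" using l(2) nonneg by (intro mult_right_mono) auto
    finally show ?thesis by simp
  qed
  define R' where "R' = max R 1"
  \<comment> \<open>The factor 1/2 makes \<open>l * R' < N s\<close> strict.\<close>
  define l where "l = N s / (2 * R')"
  have R': "0 < R'" "R \<le> R'" and l: "0 < l" using m by (auto simp: R'_def l_def)
  have "inj (E l)"
    unfolding linear_injective_0[OF linE]
  proof (intro allI impI)
    fix x assume "E l x = 0"
    then have "l * N x = 0" using NE[OF l, of x] definite[of 0] by simp
    then show "x = 0" using l definite by auto
  qed
  then obtain \<kappa> where \<kappa>: "0 < \<kappa>" "\<And>x. \<kappa> * norm x \<le> norm (E l x)"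
    using linear_inj_bounded_below_pos[OF linE] by metis
  show ?thesis unfolding bounded_iff
  proof (intro exI ballI)
    fix x assume "x \<in> {x. N x \<le> R}"
    then have "N x \<le> R'" using R' by simp
    then have "l * N x \<le> l * R'" using l by (intro mult_left_mono) auto
    also have "\<dots> < N s" using m R' by (simp add: l_def)
    finally have "N (E l x) < N s" using NE[OF l] by simp
    then have "norm (E l x) < 1" using ge[of "E l x"] by linarith
    then have "\<kappa> * norm x \<le> 1" using \<kappa>(2)[of x] by linarith
    then show "norm x \<le> 1 / \<kappa>" using \<kappa>(1) by (simp add: field_simps)
  qed
qed

lemma quasi_norm_borel [measurable]: "N \<in> borel_measurable borel"
  using continuous by (rule borel_measurable_continuous_onI)

text \<open>For \<open>l \<le> 0\<close> the series defining \<open>dilation A l\<close> has junk coefficients (\<open>ln l\<close>), hence a jointly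
  measurable substitute that agrees with it for \<open>l > 0\<close>.\<close>

lemma dilation_borel_extension:
  obtains E :: "real \<Rightarrow> real^'n \<Rightarrow> real^'n" where "(\<lambda>(l, x). E l x) \<in> borel_measurable (borel \<Otimes>\<^sub>M borel)"
    "\<And>l x. 0 < l \<Longrightarrow> dilation A l x = E l x"
proof -
  have pos: "\<forall>v c. v \<noteq> 0 \<longrightarrow> A v = c *\<^sub>R v \<longrightarrow> 0 < c" using eigenvalues_pos by blast
  obtain B and e :: "real^'n \<Rightarrow> real" and \<rho> :: "real^'n \<Rightarrow> real^'n \<Rightarrow> real" where
    B: "finite B" "\<And>b. b \<in> B \<Longrightarrow> 0 < e b" "\<And>b. linear (\<rho> b)"
    "\<And>l x. 0 < l \<Longrightarrow> dilation A l x = (\<Sum>b\<in>B. (l powr e b * \<rho> b x) *\<^sub>R b)"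
    by (rule dilation_eigenbasis[OF linear_A diagonalisable_A pos]) (rule that)
  have [measurable]: "\<rho> b \<in> borel_measurable borel" for b
    by (intro borel_measurable_continuous_onI linear_continuous_on) (simp add: B(3) linear_linear)
  have "(\<lambda>(l, x). \<Sum>b\<in>B. (l powr e b * \<rho> b x) *\<^sub>R b) \<in> borel_measurable (borel \<Otimes>\<^sub>M borel)"
    by measurable
  then show ?thesis by (rule that) (rule B(4))
qed

context
  fixes \<sigma> :: "(real^'n) measure"
  assumes polar: "polar_measure A N \<sigma>"
begin

lemma sets_polar: "sets \<sigma> = sets (restrict_space borel (quasi_sphere N))"
  using polar by (simp add: polar_measure_def)

lemma space_polar: "space \<sigma> = {y. N y = 1}"
  using sets_eq_imp_space_eq[OF sets_polar] by (simp add: space_restrict_space quasi_sphere_def)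

lemma polar_integral:
  fixes f :: "real^'n \<Rightarrow> real"
  assumes "integrable lborel f"
  shows "(LINT x|lborel. f x) = (LINT r:{0<..}|lborel. (LINT y|\<sigma>. f (dilation A r y) * r powr (homogeneous_dim A - 1)))"
  using polar assms by (simp add: polar_measure_def)

lemma measurable_ident_polar: "(\<lambda>y. y) \<in> measurable \<sigma> borel"
  using measurable_restrict_space1[of "\<lambda>y. y" borel borel "quasi_sphere N"] measurable_cong_sets[OF sets_polar refl, of borel]
  by auto

text \<open>The space of \<sigma> is the sphere, not the group; the inclusion is measurable, so
  jointly Borel maps stay measurable on the product with \<sigma>.\<close>

lemma measurable_pair_polar:
  fixes E :: "real \<Rightarrow> real^'n \<Rightarrow> real^'n"
  assumes E: "(\<lambda>(l, x). E l x) \<in> borel_measurable (borel \<Otimes>\<^sub>M borel)" and L: "sets L = sets borel"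
  shows "(\<lambda>(l, x). E l x) \<in> borel_measurable (L \<Otimes>\<^sub>M \<sigma>)"
proof -
  have id: "(\<lambda>l. l) \<in> measurable L borel" using measurable_ident_sets[OF L] by simp
  have "(\<lambda>z. (fst z, snd z)) \<in> measurable (L \<Otimes>\<^sub>M \<sigma>) (borel \<Otimes>\<^sub>M borel)"
    using measurable_compose[OF measurable_fst id] measurable_compose[OF measurable_snd measurable_ident_polar]
    by (intro measurable_Pair) auto
  from measurable_compose[OF this E] show ?thesis by (simp add: case_prod_unfold)
qed

lemma quasi_shell:
  assumes "0 < R"
  shows "{x. r \<le> N x \<and> N x \<le> R} \<in> sets borel" "emeasure lborel {x. r \<le> N x \<and> N x \<le> R} < \<infinity>"
proof -
  show m: "{x. r \<le> N x \<and> N x \<le> R} \<in> sets borel" by measurable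
  have "bounded {x. r \<le> N x \<and> N x \<le> R}" using quasi_ball_bounded[of R] by (rule bounded_subset) auto
  then show "emeasure lborel {x. r \<le> N x \<and> N x \<le> R} < \<infinity>" by (rule emeasure_bounded_finite)
qed

text \<open>If \<open>\<sigma>\<close> were infinite, the Bochner integrals over \<open>\<sigma>\<close> of the indicator of a shell would be 0 by
  convention, whereas the shell has positive volume.\<close>

lemma finite_polar: "finite_measure \<sigma>" and polar_pos: "0 < emeasure \<sigma> (space \<sigma>)"
proof -
  let ?T = "{x. 1 \<le> N x \<and> N x \<le> 2}"
  have T[measurable]: "?T \<in> sets borel" and Tfin: "emeasure lborel ?T < \<infinity>"
    using quasi_shell[of 2 1] by auto
  have "0 < emeasure lborel ?T"
  proof -
    let ?O = "{x. 1 < N x \<and> N x < 2}"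
    have O: "open ?O"
      using continuous by (intro open_Collect_conj open_Collect_less) auto
    obtain b :: "real^'n" where "b \<noteq> 0" using UNIV_not_singleton
      by blast
    then have Nb: "0 < N b" using nonneg[of b] definite[of b] by (auto simp: less_le)
    have "N (dilation A (3 / 2 / N b) b) = 3 / 2" using homogeneous[of "3 / 2 / N b" b] Nb by simp
    then have "dilation A (3 / 2 / N b) b \<in> ?O" by simp
    then have "?O \<noteq> {}" by blast
    then have "\<not> negligible ?O" using O open_not_negligible by blast
    then have "emeasure lborel ?O \<noteq> 0"
      using O by (auto simp: negligible_iff_null_sets null_sets_def)
    then have "0 < emeasure lborel ?O" by (simp add: zero_less_iff_neq_zero)
    also have "\<dots> \<le> emeasure lborel ?T" by (intro emeasure_mono) auto
    finally show ?thesis .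
  qed
  then have Tpos: "0 < measure lborel ?T" using Tfin by (simp add: measure_def enn2real_positive_iff)
  have int: "integrable lborel (indicator ?T :: _ \<Rightarrow> real)" using Tfin by (intro integrable_real_indicator) auto
  have "measure lborel ?T = (LINT r:{0<..}|lborel. (LINT y|\<sigma>. indicator ?T (dilation A r y) * r powr (homogeneous_dim A - 1)))"
    using polar_integral[OF int] by simp
  also have "\<dots> = (LINT r:{0<..}|lborel. (LINT y|\<sigma>. indicator {1..2} r * r powr (homogeneous_dim A - 1)))"
  proof (intro set_lebesgue_integral_cong allI impI)
    fix r :: real assume r: "r \<in> {0<..}"
    show "(LINT y|\<sigma>. indicator ?T (dilation A r y) * r powr (homogeneous_dim A - 1)) =
      (LINT y|\<sigma>. indicator {1..2} r * r powr (homogeneous_dim A - 1))"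
    proof (rule Bochner_Integration.integral_cong[OF refl])
      fix y assume "y \<in> space \<sigma>"
      then have "N (dilation A r y) = r" using homogeneous[of r y] r by (simp add: space_polar)
      then show "indicator ?T (dilation A r y) * r powr (homogeneous_dim A - 1) = (indicator {1..2} r * r powr (homogeneous_dim A - 1) :: real)"
        by (simp add: indicator_def)
    qed
  qed simp
  also have "\<dots> = (LINT r:{0<..}|lborel. measure \<sigma> (space \<sigma>) * (indicator {1..2} r * r powr (homogeneous_dim A - 1)))"
    by (simp only: lebesgue_integral_const real_scaleR_def)
  also have "\<dots> = measure \<sigma> (space \<sigma>) * (LINT r:{0<..}|lborel. indicator {1..2} r * r powr (homogeneous_dim A - 1))"
    by (rule set_integral_mult_right)
  finally have "measure \<sigma> (space \<sigma>) \<noteq> 0" using Tpos by auto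
  \<comment> \<open>\<open>measure\<close> is 0 both for mass 0 and for infinite mass, so its being
    nonzero excludes the two at once.\<close>
  then have ne: "emeasure \<sigma> (space \<sigma>) \<noteq> 0" "emeasure \<sigma> (space \<sigma>) \<noteq> \<infinity>"
    by (auto simp: measure_def)
  then show "finite_measure \<sigma>" "0 < emeasure \<sigma> (space \<sigma>)"
    by (auto intro: finite_measureI simp: zero_less_iff_neq_zero)
qed

text \<open>For Borel subsets of a shell \<open>T k\<close> all functions involved are integrable,
  so the polar formula for their indicators becomes an integral over the product by Fubini's
  theorem. The shells exhaust the complement of 0, and {0} is a null set of both measures.\<close>

lemma lborel_eq_polar:
  assumes [measurable]: "(\<lambda>(l, x). E l x) \<in> borel_measurable (borel \<Otimes>\<^sub>M borel)"
    and E: "\<And>l x. 0 < l \<Longrightarrow> dilation A l x = E l x"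
  shows "lborel = distr (density (lborel \<Otimes>\<^sub>M \<sigma>) (\<lambda>(r, y). ennreal (indicator {0<..} r * r powr (homogeneous_dim A - 1))))
    borel (\<lambda>(r, y). E r y)" (is "lborel = ?M")
proof -
  interpret \<sigma>: finite_measure \<sigma> by (rule finite_polar)
  interpret pair_sigma_finite lborel \<sigma> ..
  let ?Q = "homogeneous_dim A - 1"
  let ?d = "\<lambda>r. indicator {0<..} r * r powr ?Q :: real"
  have mE[measurable]: "(\<lambda>(r, y). E r y) \<in> borel_measurable (lborel \<Otimes>\<^sub>M \<sigma>)"
    by (rule measurable_pair_polar[OF assms(1)]) simp
  have M: "emeasure ?M X = (\<integral>\<^sup>+z. ennreal (?d (fst z) * indicator X (E (fst z) (snd z))) \<partial>(lborel \<Otimes>\<^sub>M \<sigma>))"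
    if [measurable]: "X \<in> sets borel" for X
  proof -
    have "emeasure ?M X = (\<integral>\<^sup>+x. indicator X x \<partial>?M)" by simp
    also have "\<dots> = (\<integral>\<^sup>+z. indicator X (case z of (r, y) \<Rightarrow> E r y)
        \<partial>density (lborel \<Otimes>\<^sub>M \<sigma>) (\<lambda>(r, y). ennreal (?d r)))"
      by (rule nn_integral_distr) (simp_all add: mE)
    also have "\<dots> = (\<integral>\<^sup>+z. (case z of (r, y) \<Rightarrow> ennreal (?d r)) * indicator X (case z of (r, y) \<Rightarrow> E r y) \<partial>(lborel \<Otimes>\<^sub>M \<sigma>))"
      by (rule nn_integral_density) measurable
    also have "\<dots> = (\<integral>\<^sup>+z. ennreal (?d (fst z)) * indicator X (E (fst z) (snd z)) \<partial>(lborel \<Otimes>\<^sub>M \<sigma>))"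
      by (simp only: case_prod_unfold)
    also have "\<dots> = (\<integral>\<^sup>+z. ennreal (?d (fst z) * indicator X (E (fst z) (snd z))) \<partial>(lborel \<Otimes>\<^sub>M \<sigma>))"
      by (intro nn_integral_cong) (simp add: indicator_def)
    finally show ?thesis .
  qed
  have NE: "N (E r y) = r" if "0 < r" "y \<in> space \<sigma>" for r y
    using homogeneous[OF that(1), of y] that E by (simp add: space_polar)
  define T where "T k = {x. 1 / real (Suc k) \<le> N x \<and> N x \<le> real (Suc k)}" for k
  have T: "T k \<in> sets borel" "emeasure lborel (T k) < \<infinity>" for k
    unfolding T_def using quasi_shell[of "real (Suc k)"] by auto
  have eqT: "emeasure lborel X = emeasure ?M X" if X[measurable]: "X \<in> sets borel" and XT: "X \<subseteq> T k" for X k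
  proof -
    let ?g = "\<lambda>z. ?d (fst z) * indicator X (E (fst z) (snd z)) :: real"
    have Xfin: "emeasure lborel X < \<infinity>"
      using emeasure_mono[OF XT, of lborel] T[of k] by (auto elim: order.strict_trans1)
    \<comment> \<open>Bounds \<open>r powr (Q - 1)\<close> for 1/(k+1) \<le> r \<le> k+1, whatever
      the sign of Q - 1.\<close>
    define C where "C = real (Suc k) powr \<bar>?Q\<bar>"
    have gle: "?g z \<le> C * indicator ({1 / real (Suc k)..real (Suc k)} \<times> space \<sigma>) z" if z: "z \<in> space (lborel \<Otimes>\<^sub>M \<sigma>)" for z
    proof (cases "0 < fst z \<and> E (fst z) (snd z) \<in> X")
      case True
      then have r: "1 / real (Suc k) \<le> fst z" "fst z \<le> real (Suc k)"
        using XT NE[of "fst z" "snd z"] z by (auto simp: T_def space_pair_measure)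
      have rpos: "0 < fst z" using True by simp
      have "fst z powr ?Q \<le> C"
      proof (cases "0 \<le> ?Q")
        case True
        then show ?thesis unfolding C_def using r(2) rpos by (auto intro!: powr_mono2)
      next
        case False
        then have "fst z powr ?Q \<le> (1 / real (Suc k)) powr ?Q"
          using r(1) rpos by (intro powr_mono2') auto
        also have "\<dots> = C" using False by (simp add: C_def powr_divide powr_minus_divide[symmetric])
        finally show ?thesis .
      qed
      then show ?thesis using True r z by (auto simp: indicator_def space_pair_measure)
    next
      case False
      then show ?thesis by (auto simp: indicator_def C_def)
    qed
    have gnn: "0 \<le> ?g z" for z by simp
    have bound: "integrable (lborel \<Otimes>\<^sub>M \<sigma>) (\<lambda>z. C * indicator ({1 / real (Suc k)..real (Suc k)} \<times> space \<sigma>) z)"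
    proof (intro integrable_mult_right integrable_real_indicator)
      have "emeasure lborel {1 / real (Suc k)..real (Suc k)} < \<infinity>"
        using emeasure_lborel_cbox_finite[of "1 / real (Suc k)" "real (Suc k)"] by (simp only: cbox_interval infinity_ennreal_def)
      moreover have "emeasure \<sigma> (space \<sigma>) < \<infinity>" using \<sigma>.emeasure_finite[of "space \<sigma>"] by (simp add: less_top[symmetric])
      ultimately show "emeasure (lborel \<Otimes>\<^sub>M \<sigma>) ({1 / real (Suc k)..real (Suc k)} \<times> space \<sigma>) < \<infinity>"
        by (subst \<sigma>.emeasure_pair_measure_Times) (simp_all only: ennreal_mult_less_top sets.top sets_lborel infinity_ennreal_def, simp_all)
    qed simp
    have gi: "integrable (lborel \<Otimes>\<^sub>M \<sigma>) ?g"
    proof (rule Bochner_Integration.integrable_bound[OF bound])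
      show "AE z in lborel \<Otimes>\<^sub>M \<sigma>. norm (?g z) \<le> norm (C * indicator ({1 / real (Suc k)..real (Suc k)} \<times> space \<sigma>) z)"
        using gle gnn by (intro AE_I2) (smt (verit) real_norm_def)
    qed measurable
    have "integrable lborel (indicator X :: _ \<Rightarrow> real)" using Xfin by (intro integrable_real_indicator) auto
    then have "measure lborel X = (LINT r:{0<..}|lborel. (LINT y|\<sigma>. indicator X (dilation A r y) * r powr ?Q))"
      using polar_integral[of "indicator X"] by simp
    also have "\<dots> = (LINT r|lborel. (LINT y|\<sigma>. ?g (r, y)))"
      unfolding set_lebesgue_integral_def
      by (intro Bochner_Integration.integral_cong refl) (auto simp: indicator_def E)
    also have "\<dots> = (LINT z|(lborel \<Otimes>\<^sub>M \<sigma>). ?g z)"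
      using integral_fst'[OF gi] by simp
    finally have "measure lborel X = (LINT z|(lborel \<Otimes>\<^sub>M \<sigma>). ?g z)" .
    then have "emeasure lborel X = ennreal (LINT z|(lborel \<Otimes>\<^sub>M \<sigma>). ?g z)"
      using Xfin by (simp add: emeasure_eq_ennreal_measure top.not_eq_extremum)
    also have "\<dots> = emeasure ?M X"
      unfolding M[OF X] by (rule nn_integral_eq_integral[symmetric, OF gi]) auto
    finally show ?thesis .
  qed
  have Tinc: "incseq (\<lambda>k. X \<inter> T k)" for X :: "(real^'n) set"
  proof -
    have "T k \<subseteq> T l" if "k \<le> l" for k l :: nat
    proof -
      have "1 / real (Suc l) \<le> 1 / real (Suc k)" using that by (simp add: frac_le)
      then show ?thesis using that by (auto simp: T_def)
    qed
    then show ?thesis by (auto simp: incseq_def)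
  qed
  have TU: "(\<Union>k. T k) = - {0}"
  proof (intro set_eqI iffI)
    fix x assume "x \<in> (\<Union>k. T k)"
    then obtain k where "1 / real (Suc k) \<le> N x" by (auto simp: T_def)
    then have "0 < N x" by (rule order.strict_trans2[rotated]) simp
    then show "x \<in> - {0}" using definite[of x] by auto
  next
    fix x :: "real^'n" assume "x \<in> - {0}"
    then have "0 < N x" using nonneg[of x] definite[of x] by (auto simp: less_le)
    obtain k :: nat where k: "max (N x) (1 / N x) < real k" using reals_Archimedean2 by blast
    then have "1 / N x \<le> real (Suc k)" "N x \<le> real (Suc k)" by auto
    then have "x \<in> T k" using \<open>0 < N x\<close> by (simp add: T_def field_simps)
    then show "x \<in> (\<Union>k. T k)" by blast
  qed
  show ?thesis
  proof (rule measure_eqI)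
    fix X assume "X \<in> sets (lborel :: (real^'n) measure)"
    then have X[measurable]: "X \<in> sets borel" by simp
    have XT: "X \<inter> T k \<in> sets borel" for k using X T by auto
    have UX: "(\<Union>k. X \<inter> T k) = X - {0}" using TU by blast
    have "emeasure lborel (X - {0}) = (SUP k. emeasure lborel (X \<inter> T k))"
      unfolding UX[symmetric] using Tinc XT by (intro SUP_emeasure_incseq[symmetric]) auto
    also have "\<dots> = (SUP k. emeasure ?M (X \<inter> T k))" using eqT XT by (intro SUP_cong refl) auto
    also have "\<dots> = emeasure ?M (X - {0})"
      unfolding UX[symmetric] using Tinc XT by (intro SUP_emeasure_incseq) auto
    finally have eq: "emeasure lborel (X - {0}) = emeasure ?M (X - {0})" .
    have "emeasure lborel X = emeasure lborel (X - {0})"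
      by (rule emeasure_Diff_null_set[symmetric]) auto
    \<comment> \<open>No point with r > 0 is mapped to 0, because \<open>N (E r y) = r\<close> on
      the sphere.\<close>
    moreover have "emeasure ?M X = emeasure ?M (X - {0})"
    proof (rule emeasure_Diff_null_set[symmetric])
      have "emeasure ?M {0} = (\<integral>\<^sup>+z. ennreal (?d (fst z) * indicator {0} (E (fst z) (snd z))) \<partial>(lborel \<Otimes>\<^sub>M \<sigma>))"
        by (rule M) simp
      also have "\<dots> = (\<integral>\<^sup>+z. 0 \<partial>((lborel :: real measure) \<Otimes>\<^sub>M \<sigma>))"
      proof (rule nn_integral_cong)
        fix z :: "real \<times> (real^'n)" assume "z \<in> space (lborel \<Otimes>\<^sub>M \<sigma>)"
        then have "snd z \<in> space \<sigma>" by (auto simp: space_pair_measure)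
        then have "E (fst z) (snd z) \<noteq> 0" if "0 < fst z" using NE[OF that] that definite[of 0] by force
        then show "ennreal (?d (fst z) * indicator {0} (E (fst z) (snd z))) = 0" by (auto simp: indicator_def)
      qed
      finally have "emeasure ?M {0} = 0" by simp
      then show "{0} \<in> null_sets ?M" by (auto simp: null_sets_def)
    qed simp
    ultimately show "emeasure lborel X = emeasure ?M X" using eq by simp
  qed simp
qed

text \<open>The indicator cuts off r \<le> 0, where \<open>dilation\<close> need not agree with the
  measurable family \<open>E\<close>. What remains is a parameter integral over a finite
  measure.\<close>

lemma spherical_integral_borel:
  assumes [measurable]: "w \<in> borel_measurable borel"
  shows "(\<lambda>r. spherical_integral A \<sigma> w r * indicator {0<..} r) \<in> borel_measurable borel"
proof -
  interpret \<sigma>: finite_measure \<sigma> by (rule finite_polar)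
  obtain E :: "real \<Rightarrow> real^'n \<Rightarrow> real^'n" where E[measurable]: "(\<lambda>(l, x). E l x) \<in> borel_measurable (borel \<Otimes>\<^sub>M borel)"
    "\<And>l x. 0 < l \<Longrightarrow> dilation A l x = E l x"
    by (rule dilation_borel_extension) (rule that)
  have [measurable]: "(\<lambda>(r, y). E r y) \<in> borel_measurable (borel \<Otimes>\<^sub>M \<sigma>)"
    by (rule measurable_pair_polar[OF E(1)]) simp
  have "(\<lambda>r. (\<integral>\<^sup>+y. ennreal (r powr (homogeneous_dim A - 1) * w (E r y)) \<partial>\<sigma>) * indicator {0<..} r) \<in> borel_measurable borel"
    by measurable
  also have "(\<lambda>r. (\<integral>\<^sup>+y. ennreal (r powr (homogeneous_dim A - 1) * w (E r y)) \<partial>\<sigma>) * indicator {0<..} r)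
    = (\<lambda>r. spherical_integral A \<sigma> w r * indicator {0<..} r)"
    by (auto simp: fun_eq_iff spherical_integral_def E indicator_def)
  finally show ?thesis .
qed

text \<open>A strictly positive integrand cannot vanish almost everywhere, since \<sigma> has
  positive mass.\<close>

lemma spherical_integral_pos:
  assumes w: "w \<in> borel_measurable borel" "\<And>x. 0 < w x" and r: "0 < r"
  shows "0 < spherical_integral A \<sigma> w r"
proof -
  obtain E :: "real \<Rightarrow> real^'n \<Rightarrow> real^'n" where E[measurable]: "(\<lambda>(l, x). E l x) \<in> borel_measurable (borel \<Otimes>\<^sub>M borel)"
    "\<And>l x. 0 < l \<Longrightarrow> dilation A l x = E l x"
    by (rule dilation_borel_extension) (rule that)
  have Em: "E r \<in> borel_measurable borel" using measurable_compose[OF measurable_Pair1' E(1), of r] by simp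
  have [measurable]: "(\<lambda>y. w (E r y)) \<in> borel_measurable \<sigma>"
    by (rule measurable_compose[OF measurable_ident_polar measurable_compose[OF Em w(1)]])
  have "spherical_integral A \<sigma> w r \<noteq> 0"
  proof
    assume "spherical_integral A \<sigma> w r = 0"
    then have "(\<integral>\<^sup>+y. ennreal (r powr (homogeneous_dim A - 1) * w (E r y)) \<partial>\<sigma>) = 0"
      by (simp add: spherical_integral_def E(2)[OF r])
    then have "AE y in \<sigma>. ennreal (r powr (homogeneous_dim A - 1) * w (E r y)) = 0"
      by (subst (asm) nn_integral_0_iff_AE) measurable
    then have "AE y in \<sigma>. False"
    proof eventually_elim
      case (elim y)
      have "0 < r powr (homogeneous_dim A - 1) * w (E r y)" using r w(2) by simp
      then show ?case using elim by (simp only: ennreal_eq_0_iff)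
    qed
    then have "emeasure \<sigma> (space \<sigma>) = 0" by (simp add: AE_iff_measurable[OF sets.top])
    then show False using polar_pos by simp
  qed
  then show ?thesis by (simp add: zero_less_iff_neq_zero)
qed

lemma polar_nn_integral:
  assumes f[measurable]: "f \<in> borel_measurable borel"
  shows "(\<integral>\<^sup>+x. f x \<partial>lborel) =
    (\<integral>\<^sup>+r\<in>{0<..}. (\<integral>\<^sup>+y. ennreal (r powr (homogeneous_dim A - 1)) * f (dilation A r y) \<partial>\<sigma>) \<partial>lborel)"
proof -
  interpret \<sigma>: finite_measure \<sigma> by (rule finite_polar)
  obtain E :: "real \<Rightarrow> real^'n \<Rightarrow> real^'n" where E[measurable]: "(\<lambda>(l, x). E l x) \<in> borel_measurable (borel \<Otimes>\<^sub>M borel)"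
    "\<And>l x. 0 < l \<Longrightarrow> dilation A l x = E l x"
    by (rule dilation_borel_extension) (rule that)
  have [measurable]: "(\<lambda>(r, y). E r y) \<in> borel_measurable (lborel \<Otimes>\<^sub>M \<sigma>)"
    by (rule measurable_pair_polar[OF E(1)]) simp
  let ?d = "\<lambda>r. indicator {0<..} r * r powr (homogeneous_dim A - 1) :: real"
  have "(\<integral>\<^sup>+x. f x \<partial>lborel) = (\<integral>\<^sup>+z. ennreal (?d (fst z)) * f (E (fst z) (snd z)) \<partial>(lborel \<Otimes>\<^sub>M \<sigma>))"
    by (subst lborel_eq_polar[OF E]) (simp_all add: nn_integral_distr nn_integral_density case_prod_unfold)
  also have "\<dots> = (\<integral>\<^sup>+r. (\<integral>\<^sup>+y. ennreal (?d r) * f (E r y) \<partial>\<sigma>) \<partial>lborel)"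
    by (subst \<sigma>.nn_integral_fst[symmetric]) simp_all
  also have "\<dots> = (\<integral>\<^sup>+r\<in>{0<..}. (\<integral>\<^sup>+y. ennreal (r powr (homogeneous_dim A - 1)) * f (dilation A r y) \<partial>\<sigma>) \<partial>lborel)"
    by (intro nn_integral_cong) (auto simp: indicator_def E)
  finally show ?thesis .
qed

text \<open>On the sphere \<open>N (dilation A r y) = r\<close>, so the radial factor leaves the
  inner integral.\<close>

lemma radial_nn_integral:
  assumes w[measurable]: "w \<in> borel_measurable borel" and wnn: "\<And>x. 0 \<le> w x"
    and k[measurable]: "k \<in> borel_measurable borel"
  shows "(\<integral>\<^sup>+x. ennreal (w x) * k (N x) \<partial>lborel) = (\<integral>\<^sup>+r\<in>{0<..}. spherical_integral A \<sigma> w r * k r \<partial>lborel)"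
proof -
  obtain E :: "real \<Rightarrow> real^'n \<Rightarrow> real^'n" where E[measurable]: "(\<lambda>(l, x). E l x) \<in> borel_measurable (borel \<Otimes>\<^sub>M borel)"
    "\<And>l x. 0 < l \<Longrightarrow> dilation A l x = E l x"
    by (rule dilation_borel_extension) (rule that)
  have Em: "E r \<in> borel_measurable borel" for r using measurable_compose[OF measurable_Pair1' E(1), of r] by simp
  have wE[measurable]: "(\<lambda>y. w (E r y)) \<in> borel_measurable \<sigma>" for r
    using measurable_compose[OF measurable_ident_polar measurable_compose[OF Em w]] .
  have "(\<integral>\<^sup>+x. ennreal (w x) * k (N x) \<partial>lborel) =
    (\<integral>\<^sup>+r\<in>{0<..}. (\<integral>\<^sup>+y. ennreal (r powr (homogeneous_dim A - 1)) * (ennreal (w (dilation A r y)) * k (N (dilation A r y))) \<partial>\<sigma>) \<partial>lborel)"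
    by (rule polar_nn_integral) measurable
  also have "\<dots> = (\<integral>\<^sup>+r\<in>{0<..}. spherical_integral A \<sigma> w r * k r \<partial>lborel)"
  proof (rule nn_integral_cong)
    fix r :: real
    have "(\<integral>\<^sup>+y. ennreal (r powr (homogeneous_dim A - 1)) * (ennreal (w (dilation A r y)) * k (N (dilation A r y))) \<partial>\<sigma>)
      = spherical_integral A \<sigma> w r * k r" if r: "0 < r"
    proof -
      have "(\<integral>\<^sup>+y. ennreal (r powr (homogeneous_dim A - 1)) * (ennreal (w (dilation A r y)) * k (N (dilation A r y))) \<partial>\<sigma>)
        = (\<integral>\<^sup>+y. ennreal (r powr (homogeneous_dim A - 1) * w (E r y)) * k r \<partial>\<sigma>)"
        using r wnn by (intro nn_integral_cong) (simp add: homogeneous space_polar ennreal_mult' mult.assoc E(2)[OF r, symmetric])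
      also have "\<dots> = (\<integral>\<^sup>+y. ennreal (r powr (homogeneous_dim A - 1) * w (E r y)) \<partial>\<sigma>) * k r"
        by (rule nn_integral_multc) measurable
      finally show ?thesis using r E by (simp add: spherical_integral_def)
    qed
    then show "(\<integral>\<^sup>+y. ennreal (r powr (homogeneous_dim A - 1)) * (ennreal (w (dilation A r y)) * k (N (dilation A r y))) \<partial>\<sigma>) * indicator {0<..} r
      = spherical_integral A \<sigma> w r * k r * indicator {0<..} r" by (simp add: indicator_def)
  qed
  finally show ?thesis .
qed

text \<open>The points whose quasi-norm lies in a null set of radii form a null set, by the radial
  formula with weight 1. This carries the almost everywhere differentiability of a profile over to
  the group.\<close>

lemma AE_radial:
  assumes P: "AE r in lborel. 0 < r \<longrightarrow> P r"
  shows "AE x in lborel. x \<noteq> 0 \<longrightarrow> P (N x)"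
proof -
  obtain Z where Z: "Z \<in> null_sets lborel" "{r. \<not> (0 < r \<longrightarrow> P r)} \<subseteq> Z"
    using P unfolding eventually_ae_filter by auto
  have [measurable]: "Z \<in> sets borel" using Z by auto
  have "(\<integral>\<^sup>+x. ennreal 1 * indicator Z (N x) \<partial>lborel) = (\<integral>\<^sup>+r\<in>{0<..}. spherical_integral A \<sigma> (\<lambda>_. 1) r * indicator Z r \<partial>lborel)"
    by (rule radial_nn_integral) auto
  also have "\<dots> = (\<integral>\<^sup>+r. 0 \<partial>(lborel :: real measure))"
    by (intro nn_integral_cong_AE, use AE_not_in[OF Z(1)] in eventually_elim) auto
  finally have "emeasure lborel {x. N x \<in> Z} = 0"
    using nn_integral_indicator[of "{x. N x \<in> Z}" lborel] by (simp add: indicator_def of_bool_def)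
  then have "{x. N x \<in> Z} \<in> null_sets lborel" by (auto simp: null_sets_def)
  then have "AE x in lborel. N x \<notin> Z" using AE_not_in by fastforce
  then show ?thesis
  proof eventually_elim
    case (elim x)
    show ?case
    proof
      assume "x \<noteq> 0"
      then have "0 < N x" using nonneg[of x] definite[of x] by (auto simp: less_le)
      then show "P (N x)" using Z(2) elim by auto
    qed
  qed
qed

end

end

section \<open>The weighted Hardy inequality on the half-line\<close>

text \<open>A positive exponent needs no separate case at 0, as \<open>0 powr a = 0\<close>.\<close>

lemma ennreal_powr_pos:
  "0 < a \<Longrightarrow> x powr\<^sub>e a = (if x = \<infinity> then \<infinity> else ennreal (enn2real x powr a))"
  by (auto simp: ennreal_powr_def)

lemma ennreal_powr_ennreal [simp]: "0 < a \<Longrightarrow> 0 \<le> r \<Longrightarrow> ennreal r powr\<^sub>e a = ennreal (r powr a)"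
  by (simp add: ennreal_powr_pos)

lemma ennreal_powr_top [simp]: "0 < a \<Longrightarrow> top powr\<^sub>e a = top"
  by (simp add: ennreal_powr_pos)

lemma ennreal_powr_0 [simp]: "0 < a \<Longrightarrow> 0 powr\<^sub>e a = 0"
  by (simp add: ennreal_powr_pos)

lemma ennreal_powr_one [simp]: "x powr\<^sub>e 1 = x"
  by (cases x) (auto simp: ennreal_powr_def)

lemma ennreal_powr_eq_0_iff: "0 < a \<Longrightarrow> x powr\<^sub>e a = 0 \<longleftrightarrow> x = 0"
  by (cases x) auto

lemma ennreal_powr_mono: "0 \<le> a \<Longrightarrow> x \<le> y \<Longrightarrow> x powr\<^sub>e a \<le> y powr\<^sub>e a"
proof (cases "a = 0")
  case False
  assume "0 \<le> a" "x \<le> y"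
  then show ?thesis using False
    by (cases x; cases y) (auto simp: ennreal_le_iff intro!: powr_mono2 simp: top_unique)
qed (simp add: ennreal_powr_def)

lemma ennreal_powr_powr: "0 < a \<Longrightarrow> 0 < b \<Longrightarrow> (x powr\<^sub>e a) powr\<^sub>e b = x powr\<^sub>e (a * b)"
  by (cases x) (auto simp: powr_powr)

lemma ennreal_powr_mult: "0 < a \<Longrightarrow> (x * y) powr\<^sub>e a = x powr\<^sub>e a * y powr\<^sub>e a"
proof (cases "x = 0 \<or> y = 0 \<or> x = top \<or> y = top")
  case True
  assume "0 < a"
  then show ?thesis using True
    by (elim disjE; cases "x = 0"; cases "y = 0") (auto simp: ennreal_mult_top ennreal_top_mult ennreal_powr_eq_0_iff)
next
  case False
  assume "0 < a"
  then show ?thesis using False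
    by (cases x; cases y) (auto simp: ennreal_mult[symmetric] powr_mult)
qed

lemma ennreal_powr_eq_mult: "1 \<le> a \<Longrightarrow> x powr\<^sub>e a = x * x powr\<^sub>e (a - 1)"
proof (cases "a = 1")
  case True
  then show ?thesis by (simp add: ennreal_powr_def[of x 0])
next
  case False
  assume "1 \<le> a"
  then have a: "1 < a" using False by simp
  show ?thesis
  proof (cases x)
    case (real r)
    have "r powr a = r * r powr (a - 1)"
      using real powr_mult_base[of r "a - 1"] by simp
    then show ?thesis using real a by (simp add: ennreal_mult)
  next
    case top
    then show ?thesis using a by (simp add: ennreal_top_mult)
  qed
qed

lemma ennreal_powr_borel [measurable (raw)]:
  "f \<in> borel_measurable M \<Longrightarrow> (\<lambda>x. f x powr\<^sub>e a) \<in> borel_measurable M"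
proof -
  assume f[measurable]: "f \<in> borel_measurable M"
  have [measurable]: "{x \<in> space M. f x = \<infinity>} \<in> sets M" "{x \<in> space M. f x = 0} \<in> sets M"
    using measurable_sets[OF f, of "{\<infinity>}"] measurable_sets[OF f, of "{0}"]
    by (simp_all add: vimage_def Int_def conj_commute)
  have [measurable]: "(\<lambda>x. ennreal (enn2real (f x) powr a)) \<in> borel_measurable M"
    by measurable
  show ?thesis
    unfolding ennreal_powr_def
    by (cases "a = 0") (auto intro!: measurable_If)
qed

section \<open>Inequalities for power sums, Young's and Hoelder's inequality\<close>

text \<open>Each term is at most the sum T, so x^s = x * x^(s-1) \<le> x * T^(s-1). With s = q/p
  this recombines the levels, which needs q \<ge> p. Sums are integrals over a counting measure so
  that they can be exchanged with integrals over the line.\<close>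

lemma sum_powr_le_powr_sum:
  fixes x :: "'i \<Rightarrow> ennreal"
  assumes "1 \<le> s"
  shows "(\<integral>\<^sup>+k. x k powr\<^sub>e s \<partial>count_space K) \<le> (\<integral>\<^sup>+k. x k \<partial>count_space K) powr\<^sub>e s"
proof -
  let ?T = "\<integral>\<^sup>+k. x k \<partial>count_space K"
  have "x k \<le> ?T" if "k \<in> K" for k by (rule nn_integral_ge_point[OF that])
  then have "(\<integral>\<^sup>+k. x k powr\<^sub>e s \<partial>count_space K) \<le> (\<integral>\<^sup>+k. x k * ?T powr\<^sub>e (s - 1) \<partial>count_space K)"
    using assms unfolding ennreal_powr_eq_mult[OF assms]
    by (intro nn_integral_mono mult_left_mono ennreal_powr_mono) auto
  also have "\<dots> = ?T * ?T powr\<^sub>e (s - 1)" by (rule nn_integral_multc) simp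
  also have "\<dots> = ?T powr\<^sub>e s" by (rule ennreal_powr_eq_mult[symmetric, OF assms])
  finally show ?thesis .
qed

text \<open>Young's inequality for the factors l |h| w^(1/p) and w^(-1/p) / l, together with -p'/p =
  1 - p'. The parameter l stays free and is optimised only after integration. For infinite w the
  right-hand side is infinite unless h = 0.\<close>

lemma young_weighted:
  fixes h l p p' :: real and w :: ennreal
  assumes p: "1 < p" "1 / p + 1 / p' = 1" and w: "0 < w" and l: "0 < l"
  shows "ennreal \<bar>h\<bar> \<le> ennreal (l powr p / p) * (w * ennreal (\<bar>h\<bar> powr p)) + ennreal (l powr (- p') / p') * w powr\<^sub>e (1 - p')"
proof -
  have p': "1 < p'" using p by (smt (verit) divide_le_eq_1 le_divide_eq_1 zero_less_divide_iff divide_less_eq_1)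
  show ?thesis
  proof (cases w)
    case (real u)
    then have u: "0 < u" using w by auto
    define a b where "a = l * \<bar>h\<bar> * u powr (1 / p)" and "b = inverse l * u powr (- 1 / p)"
    have "u powr (1 / p) * u powr (- 1 / p) = 1" using powr_add[of u "1 / p" "- 1 / p"] u by simp
    moreover have "a * b = (l * inverse l) * \<bar>h\<bar> * (u powr (1 / p) * u powr (- 1 / p))"
      by (simp only: a_def b_def mult_ac)
    ultimately have "a * b = \<bar>h\<bar>" using l by simp
    have e: "- p' / p = 1 - p'" using p p' by (simp add: field_simps)
    have e2: "u powr (1 - p') = inverse (u powr (p' / p))" using powr_minus[of u "p' / p"] e by simp
    have "a powr p = l powr p * \<bar>h\<bar> powr p * u"
      using l u p by (simp add: a_def powr_mult powr_powr)
    moreover have "b powr p' = l powr (- p') * u powr (1 - p')"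
      using l u p e2 by (simp add: b_def powr_mult powr_powr powr_minus inverse_powr)
    moreover have "a * b \<le> a powr p / p + b powr p' / p'"
      by (rule Youngs_inequality) (use p p' l u in \<open>auto simp: a_def b_def\<close>)
    ultimately have "\<bar>h\<bar> \<le> (l powr p / p) * (u * \<bar>h\<bar> powr p) + (l powr (- p') / p') * u powr (1 - p')"
      using \<open>a * b = \<bar>h\<bar>\<close> by (simp add: field_simps)
    moreover have "w powr\<^sub>e (1 - p') = ennreal (u powr (1 - p'))"
      using real u p' by (simp add: ennreal_powr_def)
    ultimately show ?thesis
      using real p p' l by (simp add: ennreal_mult[symmetric] ennreal_plus[symmetric] ennreal_le_iff del: ennreal_plus)
  next
    case top
    show ?thesis
    proof (cases "h = 0")
      case False
      then have "0 < l powr p / p" "0 < \<bar>h\<bar> powr p" using l p by auto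
      then have "ennreal (l powr p / p) \<noteq> 0" "ennreal (\<bar>h\<bar> powr p) \<noteq> 0" by (simp_all only: ennreal_eq_0_iff not_le)
      then have "ennreal (l powr p / p) * (w * ennreal (\<bar>h\<bar> powr p)) = top"
        unfolding top by (simp only: ennreal_top_mult ennreal_mult_top if_False)
      then show ?thesis by simp
    qed simp
  qed
qed

text \<open>The pointwise inequality, which admits infinite weights, is integrated and then
  optimised over l. The optimal l involves the quotient of the two integrals; adding e > 0 to both
  keeps it meaningful when one of them vanishes, and finally e tends to 0.\<close>

lemma weighted_holder:
  fixes h :: "'a \<Rightarrow> real" and w :: "'a \<Rightarrow> ennreal" and p p' :: real
  assumes p: "1 < p" "1 / p + 1 / p' = 1"
    and [measurable]: "h \<in> borel_measurable M" "w \<in> borel_measurable M" "I \<in> sets M"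
    and w: "\<And>x. x \<in> I \<Longrightarrow> 0 < w x"
    and X: "(\<integral>\<^sup>+x\<in>I. w x * ennreal (\<bar>h x\<bar> powr p) \<partial>M) < \<infinity>" (is "?X < _")
    and Y: "(\<integral>\<^sup>+x\<in>I. w x powr\<^sub>e (1 - p') \<partial>M) < \<infinity>" (is "?Y < _")
  shows "(\<integral>\<^sup>+x\<in>I. ennreal \<bar>h x\<bar> \<partial>M) \<le>
    (\<integral>\<^sup>+x\<in>I. w x * ennreal (\<bar>h x\<bar> powr p) \<partial>M) powr\<^sub>e (1 / p) * (\<integral>\<^sup>+x\<in>I. w x powr\<^sub>e (1 - p') \<partial>M) powr\<^sub>e (1 / p')"
proof -
  have p': "1 < p'" using p by (smt (verit) divide_le_eq_1 le_divide_eq_1 zero_less_divide_iff divide_less_eq_1)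
  obtain x where x: "?X = ennreal x" "0 \<le> x" using X by (cases ?X) auto
  obtain y where y: "?Y = ennreal y" "0 \<le> y" using Y by (cases ?Y) auto
  let ?J = "\<integral>\<^sup>+x\<in>I. ennreal \<bar>h x\<bar> \<partial>M"
  have le: "?J \<le> ennreal (l powr p / p * x + l powr (- p') / p' * y)" if l: "0 < l" for l
  proof -
    have "?J \<le> (\<integral>\<^sup>+x. (ennreal (l powr p / p) * (w x * ennreal (\<bar>h x\<bar> powr p) * indicator I x) +
        ennreal (l powr (- p') / p') * (w x powr\<^sub>e (1 - p') * indicator I x)) \<partial>M)"
      using young_weighted[OF p w l] by (intro nn_integral_mono) (auto simp: indicator_def)
    also have "\<dots> = ennreal (l powr p / p) * ?X + ennreal (l powr (- p') / p') * ?Y"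
      by (simp add: nn_integral_add nn_integral_cmult)
    also have "\<dots> = ennreal (l powr p / p * x + l powr (- p') / p' * y)"
      using x(2) y(2) p p' unfolding x(1) y(1) by (simp add: ennreal_mult[symmetric] ennreal_plus[symmetric] del: ennreal_plus)
    finally show ?thesis .
  qed
  have le2: "?J \<le> ennreal ((x + e) powr (1 / p) * (y + e) powr (1 / p'))" if e: "0 < e" for e
  proof -
    \<comment> \<open>This l makes \<open>l powr p * (x + e)\<close> and
      \<open>l powr (- p') * (y + e)\<close> equal, so that their mean with weights 1/p and 1/p' is
      the common value.\<close>
    define l where "l = ((y + e) / (x + e)) powr (1 / (p * p'))"
    have pos: "0 < x + e" "0 < y + e" "0 < l" using e x y by (auto simp: l_def)
    have q: "1 / p' = 1 - 1 / p" using p by simp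
    have c: "1 / (p * p') * p = 1 / p'" "1 / (p * p') * (- p') = - (1 / p)" using p p' by simp_all
    have d: "((y + e) / (x + e)) powr b = (y + e) powr b * (x + e) powr (- b)" for b
      using pos powr_divide[of "y + e" "x + e" b] by (simp add: powr_minus divide_inverse)
    have t1: "l powr p * (x + e) = (x + e) powr (1 / p) * (y + e) powr (1 / p')"
    proof -
      have "l powr p = (y + e) powr (1 / p') * (x + e) powr (- (1 / p'))"
        by (subst l_def, subst powr_powr, subst c(1), rule d)
      moreover have "(x + e) powr (- (1 / p')) * (x + e) = (x + e) powr (1 / p)"
        using pos q powr_add[of "x + e" "- (1 / p')" 1] by simp
      ultimately show ?thesis by (metis mult.assoc mult.commute)
    qed
    have t2: "l powr (- p') * (y + e) = (x + e) powr (1 / p) * (y + e) powr (1 / p')"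
    proof -
      have "l powr (- p') = (y + e) powr (- (1 / p)) * (x + e) powr (1 / p)"
        by (subst l_def, subst powr_powr, subst c(2), subst d) simp
      moreover have "(y + e) powr (- (1 / p)) * (y + e) = (y + e) powr (1 / p')"
        using pos q powr_add[of "y + e" "- (1 / p)" 1] by simp
      ultimately show ?thesis by (metis mult.assoc mult.commute)
    qed
    have "l powr p / p * x + l powr (- p') / p' * y \<le> l powr p / p * (x + e) + l powr (- p') / p' * (y + e)"
      using e p p' by (intro add_mono mult_left_mono) auto
    also have "\<dots> = (1 / p + 1 / p') * ((x + e) powr (1 / p) * (y + e) powr (1 / p'))"
      using t1 t2 by (simp add: algebra_simps)
    also have "\<dots> = (x + e) powr (1 / p) * (y + e) powr (1 / p')" using p by simp
    finally show ?thesis using le[OF pos(3)] by (meson ennreal_leI order.trans)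
  qed
  have Jfin: "?J < \<infinity>" using le[of 1] by (simp add: le_less_trans)
  obtain j where j: "?J = ennreal j" "0 \<le> j" using Jfin by (cases ?J) auto
  have lim: "((\<lambda>e. (c + e) powr b) \<longlongrightarrow> c powr b) (at_right 0)" if "0 \<le> c" "0 < b" for b c :: real
  proof (rule tendsto_powr')
    show "((\<lambda>e. c + e) \<longlongrightarrow> c) (at_right 0)"
      using tendsto_add[OF tendsto_const tendsto_ident_at, of c 0 "{0<..}"] by simp
    have "\<forall>\<^sub>F e in at_right 0. 0 \<le> c + e"
      using eventually_at_right_less[of "0::real"] by (rule eventually_mono) (use that in simp)
    then show "c \<noteq> 0 \<or> 0 < b \<and> (\<forall>\<^sub>F e in at_right 0. 0 \<le> c + e)" using that by simp
  qed simp
  have "((\<lambda>e. (x + e) powr (1 / p) * (y + e) powr (1 / p')) \<longlongrightarrow> x powr (1 / p) * y powr (1 / p')) (at_right 0)"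
    using x y p p' by (intro tendsto_mult lim) auto
  moreover have "eventually (\<lambda>e. j \<le> (x + e) powr (1 / p) * (y + e) powr (1 / p')) (at_right 0)"
    using eventually_at_right_less[of "0::real"]
  proof (rule eventually_mono)
    fix e :: real assume "0 < e"
    then have "ennreal j \<le> ennreal ((x + e) powr (1 / p) * (y + e) powr (1 / p'))" using le2[of e] j(1) by simp
    then show "j \<le> (x + e) powr (1 / p) * (y + e) powr (1 / p')" by (subst (asm) ennreal_le_iff) auto
  qed
  ultimately have "j \<le> x powr (1 / p) * y powr (1 / p')"
    by (rule tendsto_lowerbound) simp
  then show ?thesis using x y j p p' by (simp add: ennreal_mult[symmetric])
qed

lemma lipschitz_imp_locally_absolutely_continuous:
  assumes L: "0 < L" and lip: "\<And>s t. s \<le> t \<Longrightarrow> \<bar>g t - g s\<bar> \<le> L * (t - s)"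
  shows "locally_absolutely_continuous g"
  unfolding locally_absolutely_continuous_def absolutely_continuous_on_def
proof (intro allI impI)
  fix b \<epsilon> :: real assume "0 < \<epsilon>"
  show "\<exists>\<delta>>0. \<forall>I :: (real \<times> real) set.
        finite I \<and> (\<forall>(s, t)\<in>I. 0 \<le> s \<and> s < t \<and> t \<le> b) \<and>
        pairwise (\<lambda>(s, t) (u, v). disjnt {s<..<t} {u<..<v}) I \<and>
        (\<Sum>(s, t)\<in>I. t - s) < \<delta> \<longrightarrow> (\<Sum>(s, t)\<in>I. \<bar>g t - g s\<bar>) < \<epsilon>"
  proof (intro exI[of _ "\<epsilon> / L"] conjI allI impI)
    show "0 < \<epsilon> / L" using L \<open>0 < \<epsilon>\<close> by simp
    fix I :: "(real \<times> real) set"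
    assume I: "finite I \<and> (\<forall>(s, t)\<in>I. 0 \<le> s \<and> s < t \<and> t \<le> b) \<and>
        pairwise (\<lambda>(s, t) (u, v). disjnt {s<..<t} {u<..<v}) I \<and> (\<Sum>(s, t)\<in>I. t - s) < \<epsilon> / L"
    have "(\<Sum>(s, t)\<in>I. \<bar>g t - g s\<bar>) \<le> (\<Sum>(s, t)\<in>I. L * (t - s))"
      using I by (intro sum_mono) (auto intro!: lip)
    also have "\<dots> = L * (\<Sum>(s, t)\<in>I. t - s)" by (simp add: sum_distrib_left case_prod_unfold)
    also have "\<dots> < L * (\<epsilon> / L)" using I L by (intro mult_strict_left_mono) auto
    finally show "(\<Sum>(s, t)\<in>I. \<bar>g t - g s\<bar>) < \<epsilon>" using L by simp
  qed
qed

section \<open>The two implications on the half-line\<close>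

context
  fixes \<Phi> \<Psi> :: "real \<Rightarrow> ennreal" and p p' q :: real
  assumes \<Phi>[measurable]: "\<Phi> \<in> borel_measurable borel"
    and \<Psi>[measurable]: "\<Psi> \<in> borel_measurable borel" and \<Psi>_pos: "\<And>r. 0 < r \<Longrightarrow> 0 < \<Psi> r"
    and p: "1 < p" "1 / p + 1 / p' = 1" and q: "p \<le> q"
begin

lemma p'_gt_1: "1 < p'"
  using p by (smt (verit) divide_le_eq_1 le_divide_eq_1 zero_less_divide_iff divide_less_eq_1)

text \<open>For a truncation k with integral I and primitive g, the bound \<Psi> k^p \<le> k makes
  the right-hand side at most C I^(1/p), while g = I on [R, \<infinity>) makes the left-hand side at
  least V^(1/q) I, with V the tail of \<Phi>. Division by I^(1/p) leaves V^(1/q) I^(1/p') \<le>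
  C.\<close>

lemma hardy_necessity:
  fixes C :: real
  assumes C: "0 < C"
    and hardy: "\<And>g h. locally_absolutely_continuous g \<Longrightarrow> g 0 = 0 \<Longrightarrow> h \<in> borel_measurable borel \<Longrightarrow>
      (AE r in lborel. 0 < r \<longrightarrow> (g has_real_derivative h r) (at r)) \<Longrightarrow>
      (\<integral>\<^sup>+r\<in>{0<..}. \<Phi> r * ennreal (\<bar>g r\<bar> powr q) \<partial>lborel) powr\<^sub>e (1 / q) \<le>
      ennreal C * (\<integral>\<^sup>+r\<in>{0<..}. \<Psi> r * ennreal (\<bar>h r\<bar> powr p) \<partial>lborel) powr\<^sub>e (1 / p)"
    and R: "0 < R"
  shows "(\<integral>\<^sup>+r\<in>{R..}. \<Phi> r \<partial>lborel) powr\<^sub>e (1 / q) *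
    (\<integral>\<^sup>+r\<in>{0<..<R}. \<Psi> r powr\<^sub>e (1 - p') \<partial>lborel) powr\<^sub>e (1 / p') \<le> ennreal C"
proof -
  have p0: "0 < p" "0 < q" "1 < p'" "0 < p'" using p q p'_gt_1 by auto
  let ?V = "\<integral>\<^sup>+r\<in>{R..}. \<Phi> r \<partial>lborel"
  let ?W = "\<integral>\<^sup>+r\<in>{0<..<R}. \<Psi> r powr\<^sub>e (1 - p') \<partial>lborel"
  define k where "k n r = (if r \<in> {0<..<R} then min (enn2real (\<Psi> r powr\<^sub>e (1 - p'))) (real n) else 0)" for n r
  have km[measurable]: "k n \<in> borel_measurable borel" for n unfolding k_def by measurable
  have knn: "0 \<le> k n r" for n r by (simp add: k_def)
  have kn: "k n r \<le> real n * indicator {0<..<R} r" for n r by (simp add: k_def)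
  have kint: "integrable lborel (k n)" for n
  proof (rule Bochner_Integration.integrable_bound)
    show "integrable lborel (\<lambda>r. real n * indicator {0<..<R} r)"
      by (intro integrable_mult_right integrable_real_indicator) auto
    show "AE r in lborel. norm (k n r) \<le> norm (real n * indicator {0<..<R} r)"
      using knn kn by (intro AE_I2) (smt (verit) real_norm_def)
  qed simp
  \<comment> \<open>A negative exponent produces \<infinity> only at 0, and \<Psi> is
    positive.\<close>
  have \<omega>_fin: "\<Psi> r powr\<^sub>e (1 - p') < \<infinity>" if "0 < r" for r
    using \<Psi>_pos[OF that] p0 by (simp add: ennreal_powr_def)
  \<comment> \<open>From k \<le> \<Psi>^(1-p') follows k^(p-1) \<le> 1/\<Psi>, as (1 - p')(p - 1) =
    -1. Where \<Psi> is infinite, k is 0.\<close>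
  have k\<Psi>: "\<Psi> r * ennreal (\<bar>k n r\<bar> powr p) \<le> ennreal (k n r)" if r: "0 < r" for n r
  proof (cases "k n r = 0")
    case True
    then show ?thesis by simp
  next
    case False
    then have rR: "r < R" and kpos: "0 < k n r" using knn[of n r] r by (auto simp: k_def split: if_splits)
    have kle: "k n r \<le> enn2real (\<Psi> r powr\<^sub>e (1 - p'))" using r rR by (simp add: k_def)
    have "\<Psi> r \<noteq> \<infinity>" using kpos kle p0 by (auto simp: ennreal_powr_def)
    then obtain u where u: "\<Psi> r = ennreal u" "0 < u" using \<Psi>_pos[OF r] by (cases "\<Psi> r") auto
    have ku: "k n r \<le> u powr (1 - p')" using kle u p0 by (simp add: ennreal_powr_def)
    have e: "(1 - p') * (p - 1) = - 1" using p p0 by (simp add: field_simps)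
    have "u * k n r powr p = u * k n r powr (p - 1) * k n r"
      using kpos powr_mult_base[of "k n r" "p - 1"] by (simp add: mult.commute)
    also have "\<dots> \<le> u * (u powr (1 - p')) powr (p - 1) * k n r"
      using ku kpos u p by (intro mult_right_mono mult_left_mono powr_mono2) auto
    also have "(u powr (1 - p')) powr (p - 1) = inverse u"
      using u by (simp add: powr_powr e powr_minus)
    also have "u * inverse u * k n r = k n r" using u by simp
    finally show ?thesis using u kpos by (simp add: ennreal_mult[symmetric])
  qed
  define I where "I n = (LINT r|lborel. k n r)" for n
  have Inn: "0 \<le> I n" for n unfolding I_def using knn by (intro integral_nonneg_AE) auto
  have In: "ennreal (I n) = (\<integral>\<^sup>+r. ennreal (k n r) \<partial>lborel)" for n
    unfolding I_def using kint knn by (simp add: nn_integral_eq_integral)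
  \<comment> \<open>The bound is stated after raising to the power p', which makes it linear in
    \<open>I n\<close>, so that the supremum over n can be taken.\<close>
  have step: "ennreal (I n) * ?V powr\<^sub>e (p' / q) \<le> ennreal (C powr p')" for n
  proof -
    define g where "g x = (LINT t:{..x}|lborel. k n t)" for x
    have kset: "set_integrable lborel X (k n)" if "X \<in> sets borel" for X
      using kint that unfolding set_integrable_def by (intro integrable_mult_indicator) auto
    \<comment> \<open>\<open>Suc n\<close> instead of \<open>n\<close>, because the Lipschitz
      criterion asks for a positive constant.\<close>
    have g_lip: "\<bar>g t - g s\<bar> \<le> real (Suc n) * (t - s)" if st: "s \<le> t" for s t
    proof -
      have "g t = (LINT r:{..s} \<union> {s<..t}|lborel. k n r)"
        unfolding g_def using st by (simp add: ivl_disj_un_one(3))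
      also have "\<dots> = g s + (LINT r:{s<..t}|lborel. k n r)"
        unfolding g_def by (intro set_integral_Un kset) auto
      finally have "g t - g s = (LINT r:{s<..t}|lborel. k n r)" by simp
      moreover have "0 \<le> (LINT r:{s<..t}|lborel. k n r)"
        unfolding set_lebesgue_integral_def using knn by (intro integral_nonneg_AE) auto
      moreover have "(LINT r:{s<..t}|lborel. k n r) \<le> (LINT r:{s<..t}|lborel. real (Suc n))"
      proof (rule set_integral_mono)
        show "set_integrable lborel {s<..t} (\<lambda>r. real (Suc n))"
          using st by (auto simp: set_integrable_def)
        fix r show "k n r \<le> real (Suc n)" by (simp add: k_def min_le_iff_disj)
      qed (intro kset, simp)
      moreover have "(LINT r:{s<..t}|lborel. real (Suc n)) = real (Suc n) * (t - s)"
        using st by (simp add: set_lebesgue_integral_def)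
      ultimately show ?thesis by simp
    qed
    have lac: "locally_absolutely_continuous g"
      by (rule lipschitz_imp_locally_absolutely_continuous[OF _ g_lip]) simp_all
    have g0: "g 0 = 0"
    proof -
      have "g 0 = (LINT t:{..0}|(lborel :: real measure). (0 :: real))"
        unfolding g_def by (intro set_lebesgue_integral_cong) (auto simp: k_def)
      then show ?thesis by simp
    qed
    have gR: "g r = I n" if "R \<le> r" for r
    proof -
      have "g r = (LINT t:UNIV|lborel. k n t)"
        unfolding g_def set_lebesgue_integral_def using that
        by (intro Bochner_Integration.integral_cong) (auto simp: k_def indicator_def)
      then show ?thesis by (simp add: I_def set_lebesgue_integral_def)
    qed
    have "AE r in lborel. (g has_real_derivative k n r) (at r)"
      unfolding g_def by (rule lebesgue_differentiation[OF kint])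
    then have "(\<integral>\<^sup>+r\<in>{0<..}. \<Phi> r * ennreal (\<bar>g r\<bar> powr q) \<partial>lborel) powr\<^sub>e (1 / q) \<le>
      ennreal C * (\<integral>\<^sup>+r\<in>{0<..}. \<Psi> r * ennreal (\<bar>k n r\<bar> powr p) \<partial>lborel) powr\<^sub>e (1 / p)" (is "?lhs \<le> ?rhs")
      using lac g0 km by (intro hardy) auto
    also have "?rhs \<le> ennreal C * ennreal (I n) powr\<^sub>e (1 / p)"
      unfolding In using k\<Psi> p0
      by (intro mult_left_mono ennreal_powr_mono nn_integral_mono) (auto simp: indicator_def)
    finally have 1: "?lhs \<le> ennreal C * ennreal (I n) powr\<^sub>e (1 / p)" .
    have "?V * ennreal (I n powr q) = (\<integral>\<^sup>+r. \<Phi> r * indicator {R..} r * ennreal (I n powr q) \<partial>lborel)"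
      by (rule nn_integral_multc[symmetric]) simp
    also have "\<dots> \<le> (\<integral>\<^sup>+r\<in>{0<..}. \<Phi> r * ennreal (\<bar>g r\<bar> powr q) \<partial>lborel)"
      using R Inn by (intro nn_integral_mono) (auto simp: indicator_def gR)
    finally have "(?V * ennreal (I n powr q)) powr\<^sub>e (1 / q) \<le> ?lhs" using p0 by (intro ennreal_powr_mono) auto
    also have "(?V * ennreal (I n powr q)) powr\<^sub>e (1 / q) = ?V powr\<^sub>e (1 / q) * ennreal (I n)"
      using p0 Inn[of n] by (simp add: ennreal_powr_mult powr_powr)
    finally have 2: "?V powr\<^sub>e (1 / q) * ennreal (I n) \<le> ennreal C * ennreal (I n powr (1 / p))"
      using 1 p0 Inn[of n] by simp
    have 3: "?V powr\<^sub>e (1 / q) * ennreal (I n powr (1 / p')) \<le> ennreal C"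
    proof (cases "I n = 0")
      case True
      then show ?thesis by simp
    next
      case False
      then have Ipos: "0 < I n" using Inn[of n] by simp
      have "I n * I n powr (- 1 / p) = I n powr (1 + - 1 / p)" using Ipos by (simp only: powr_add) simp
      also have "1 + - 1 / p = 1 / p'" using p by simp
      finally have a: "I n * I n powr (- 1 / p) = I n powr (1 / p')" .
      have b: "I n powr (1 / p) * I n powr (- 1 / p) = 1"
        using powr_add[of "I n" "1 / p" "- 1 / p"] Ipos by simp
      have "?V powr\<^sub>e (1 / q) * ennreal (I n powr (1 / p')) = ?V powr\<^sub>e (1 / q) * ennreal (I n) * ennreal (I n powr (- 1 / p))"
        using Ipos by (simp add: a[symmetric] ennreal_mult mult.assoc)
      also have "\<dots> \<le> ennreal C * ennreal (I n powr (1 / p)) * ennreal (I n powr (- 1 / p))"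
        by (intro mult_right_mono 2) simp
      also have "\<dots> = ennreal C" using b by (simp add: mult.assoc flip: ennreal_mult)
      finally show ?thesis .
    qed
    have "(?V powr\<^sub>e (1 / q) * ennreal (I n powr (1 / p'))) powr\<^sub>e p' \<le> ennreal C powr\<^sub>e p'"
      using 3 p0 by (intro ennreal_powr_mono) auto
    also have "(?V powr\<^sub>e (1 / q) * ennreal (I n powr (1 / p'))) powr\<^sub>e p' = ?V powr\<^sub>e (p' / q) * ennreal (I n)"
      using p0 Inn[of n] by (simp add: ennreal_powr_mult ennreal_powr_powr powr_powr)
    finally show ?thesis using C p0 by (simp add: mult.commute)
  qed
  have "?W = (SUP n. ennreal (I n))"
  proof -
    have "(\<integral>\<^sup>+r. (SUP n. ennreal (k n r)) \<partial>lborel) = (SUP n. \<integral>\<^sup>+r. ennreal (k n r) \<partial>lborel)"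
      by (rule nn_integral_monotone_convergence_SUP) (auto simp: incseq_def le_fun_def k_def intro!: ennreal_leI)
    moreover have "(SUP n. ennreal (k n r)) = \<Psi> r powr\<^sub>e (1 - p') * indicator {0<..<R} r" for r
    proof (cases "r \<in> {0<..<R}")
      case True
      then obtain u where u: "\<Psi> r powr\<^sub>e (1 - p') = ennreal u" "0 \<le> u"
        using \<omega>_fin[of r] by (cases "\<Psi> r powr\<^sub>e (1 - p')") auto
      obtain m :: nat where m: "u \<le> real m" using real_arch_simple by blast
      have "(SUP n. ennreal (k n r)) = ennreal u"
      proof (rule antisym)
        show "(SUP n. ennreal (k n r)) \<le> ennreal u" using u by (intro SUP_least) (auto simp: k_def intro!: ennreal_leI)
        have "ennreal u = ennreal (k m r)" using True u m by (simp add: k_def)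
        then show "ennreal u \<le> (SUP n. ennreal (k n r))" by (metis SUP_upper UNIV_I)
      qed
      then show ?thesis using True u by simp
    next
      case False
      then have "k n r = 0" for n by (simp only: k_def if_False)
      then show ?thesis using False by simp
    qed
    ultimately show ?thesis by (simp add: In)
  qed
  then have "?W * ?V powr\<^sub>e (p' / q) = (SUP n. ennreal (I n) * ?V powr\<^sub>e (p' / q))"
    by (simp add: SUP_mult_right_ennreal)
  also have "\<dots> \<le> ennreal (C powr p')" using step by (intro SUP_least)
  finally have "(?W * ?V powr\<^sub>e (p' / q)) powr\<^sub>e (1 / p') \<le> ennreal (C powr p') powr\<^sub>e (1 / p')"
    using p0 by (intro ennreal_powr_mono) auto
  then show ?thesis
    using p0 C by (simp add: ennreal_powr_mult ennreal_powr_powr powr_powr mult.commute)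
qed

text \<open>Each level is estimated with the whole tail of \<Phi> beyond \<xi>(k), although it may
  occupy only part of it. The condition at R = \<xi>(k) then applies directly, and the level need
  not have an upper end.\<close>

lemma hardy_sufficiency:
  fixes a :: real
  assumes a: "0 \<le> a"
    and \<Phi>_pos: "\<And>R. 0 < R \<Longrightarrow> 0 < (\<integral>\<^sup>+r\<in>{R..}. \<Phi> r \<partial>lborel)"
    and A: "\<And>R. 0 < R \<Longrightarrow> (\<integral>\<^sup>+r\<in>{R..}. \<Phi> r \<partial>lborel) powr\<^sub>e (1 / q) *
       (\<integral>\<^sup>+r\<in>{0<..<R}. \<Psi> r powr\<^sub>e (1 - p') \<partial>lborel) powr\<^sub>e (1 / p') \<le> ennreal a"
    and h[measurable]: "h \<in> borel_measurable borel"
    and hint: "\<And>x. 0 \<le> x \<Longrightarrow> set_integrable lborel {0..x} h"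
    and X: "(\<integral>\<^sup>+r\<in>{0<..}. \<Psi> r * ennreal (\<bar>h r\<bar> powr p) \<partial>lborel) < \<infinity>" (is "?X < _")
  shows "(\<integral>\<^sup>+r\<in>{0<..}. \<Phi> r * ennreal ((LINT t:{0..r}|lborel. \<bar>h t\<bar>) powr q) \<partial>lborel) powr\<^sub>e (1 / q) \<le>
      ennreal (4 * a) * (\<integral>\<^sup>+r\<in>{0<..}. \<Psi> r * ennreal (\<bar>h r\<bar> powr p) \<partial>lborel) powr\<^sub>e (1 / p)"
proof -
  have p0: "0 < p" "0 < q" "1 < p'" "0 < p'" using p q p'_gt_1 by auto
  define F where "F x = (LINT t:{0..x}|lborel. \<bar>h t\<bar>)" for x
  define V where "V R = (\<integral>\<^sup>+r\<in>{R..}. \<Phi> r \<partial>lborel)" for R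
  define W where "W R = (\<integral>\<^sup>+r\<in>{0<..<R}. \<Psi> r powr\<^sub>e (1 - p') \<partial>lborel)" for R
  have AV: "V R powr\<^sub>e (1 / q) * W R powr\<^sub>e (1 / p') \<le> ennreal a" if "0 < R" for R
    unfolding V_def W_def by (rule A[OF that])
  \<comment> \<open>If \<open>W R\<close> were infinite, the product in the condition would be
    infinite too, because \<open>\<Phi>_pos\<close> makes its other factor nonzero.\<close>
  have Wfin: "W R < \<infinity>" if R: "0 < R" for R
  proof (rule ccontr)
    assume "\<not> W R < \<infinity>"
    then have "W R powr\<^sub>e (1 / p') = top" using p0 by (simp add: not_less top_unique)
    moreover have "V R powr\<^sub>e (1 / q) \<noteq> 0"
      using \<Phi>_pos[OF R] p0 by (subst ennreal_powr_eq_0_iff) (auto simp: V_def)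
    ultimately show False using AV[OF R] by (simp add: ennreal_mult_top top_unique)
  qed
  have habs: "set_integrable lborel X (\<lambda>t. \<bar>h t\<bar>)" if "X \<in> sets borel" "X \<subseteq> {0..x}" "0 \<le> x" for X x
    using set_integrable_abs[OF set_integrable_subset[OF hint[OF that(3)] _ that(2)]] that(1) by simp
  have Fdiff: "F t - F s = (LINT r:{s<..t}|lborel. \<bar>h r\<bar>)" if "0 \<le> s" "s \<le> t" for s t
  proof -
    have "F t = (LINT r:{0..s} \<union> {s<..t}|lborel. \<bar>h r\<bar>)"
      unfolding F_def using that by (simp add: ivl_disj_un_two(8))
    also have "\<dots> = F s + (LINT r:{s<..t}|lborel. \<bar>h r\<bar>)"
      unfolding F_def using that by (intro set_integral_Un habs[of _ t]) auto
    finally show ?thesis by simp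
  qed
  have Fnn: "0 \<le> (LINT r:{s<..t}|lborel. \<bar>h r\<bar>)" for s t
    unfolding set_lebesgue_integral_def by (intro integral_nonneg_AE) auto
  have Fmono: "F s \<le> F t" if "0 \<le> s" "s \<le> t" for s t
    using Fdiff[OF that] Fnn[of s t] by linarith
  have F0: "F 0 = 0"
  proof -
    have "F 0 = (LINT r|(lborel :: real measure). (0 :: real))"
      unfolding F_def set_lebesgue_integral_def
      by (intro integral_cong_AE, simp, simp, use AE_lborel_singleton[of 0] in eventually_elim) auto
    then show ?thesis by simp
  qed
  have Fcont: "continuous_on {0..b} F" if "0 \<le> b" for b
  proof -
    have "(\<lambda>t. \<bar>h t\<bar>) integrable_on {0..b}"
      using set_borel_integral_eq_integral(1)[OF habs[of "{0..b}" b]] that by simp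
    then have "continuous_on {0..b} (\<lambda>x. integral {0..x} (\<lambda>t. \<bar>h t\<bar>))"
      by (rule indefinite_integral_continuous_1)
    moreover have "integral {0..x} (\<lambda>t. \<bar>h t\<bar>) = F x" if "x \<in> {0..b}" for x
      unfolding F_def using set_borel_integral_eq_integral(2)[OF habs[of "{0..x}" x]] that by simp
    ultimately show ?thesis by (rule continuous_on_eq)
  qed
  \<comment> \<open>Only the attained levels, since F may be bounded. By continuity and F 0 = 0,
    every level below an attained one is attained.\<close>
  define K where "K = {k :: int. \<exists>x>0. F x = 2 powr k}"
  \<comment> \<open>Any choice will do: monotonicity of F puts the chosen points in the order of
    their levels.\<close>
  define \<xi> where "\<xi> k = (SOME x. 0 < x \<and> F x = 2 powr of_int k)" for k :: int
  have \<xi>: "0 < \<xi> k" "F (\<xi> k) = 2 powr k" if "k \<in> K" for k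
    using someI_ex[of "\<lambda>x. 0 < x \<and> F x = 2 powr of_int k"] that by (auto simp: K_def \<xi>_def)
  have attain: "k \<in> K" if r: "0 < r" "2 powr k \<le> F r" for r and k :: int
  proof -
    obtain x where x: "0 \<le> x" "x \<le> r" "F x = 2 powr k"
      using IVT'[of F 0 "2 powr k" r] r F0 Fcont[of r] by auto
    then have "x \<noteq> 0" using F0 by auto
    then show ?thesis using x by (auto simp: K_def intro!: exI[of _ x])
  qed
  have \<xi>_less: "\<xi> k < r" if "k \<in> K" "0 < r" "2 powr k < F r" for k r
    using \<xi>[OF that(1)] Fmono[of r "\<xi> k"] that by (smt (verit))
  have Kpred: "k - 1 \<in> K" "\<xi> (k - 1) < \<xi> k" if k: "k \<in> K" for k
  proof -
    have lt: "2 powr (of_int (k - 1)) < F (\<xi> k)" using \<xi>(2)[OF k] by simp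
    then show "k - 1 \<in> K" using attain[OF \<xi>(1)[OF k], of "k - 1"] by simp
    then show "\<xi> (k - 1) < \<xi> k" using \<xi>_less[OF _ \<xi>(1)[OF k] lt] by blast
  qed
  define J where "J k = {\<xi> (k - 1)<..<\<xi> k}" for k
  have [measurable]: "J k \<in> sets borel" for k by (simp add: J_def)
  define x where "x k = (\<integral>\<^sup>+r\<in>J k. \<Psi> r * ennreal (\<bar>h r\<bar> powr p) \<partial>lborel)" for k
  have Jpos: "J k \<subseteq> {0<..<\<xi> k}" if "k \<in> K" for k
    using \<xi>(1)[OF Kpred(1)[OF that]] by (auto simp: J_def)
  have Jdisj: "J k \<inter> J l = {}" if "k \<in> K" "l \<in> K" "k < l" for k l
  proof -
    have "\<xi> k \<le> \<xi> (l - 1)"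
    proof (cases "k = l - 1")
      case False
      then have "2 powr k < F (\<xi> (l - 1))" using \<xi>(2)[OF Kpred(1)[OF that(2)]] that(3) by simp
      then show ?thesis using \<xi>_less[OF that(1) \<xi>(1)[OF Kpred(1)[OF that(2)]]] by simp
    qed simp
    then show ?thesis by (auto simp: J_def)
  qed
  \<comment> \<open>Each r lies in at most one \<open>J k\<close>, so after exchanging sum and
    integral the inner sum has at most one nonzero term.\<close>
  have xX: "(\<integral>\<^sup>+k. x k \<partial>count_space K) \<le> ?X"
  proof -
    have "(\<integral>\<^sup>+k. x k \<partial>count_space K) =
       (\<integral>\<^sup>+r. (\<integral>\<^sup>+k. \<Psi> r * ennreal (\<bar>h r\<bar> powr p) * indicator (J k) r \<partial>count_space K) \<partial>lborel)"
      unfolding x_def by (rule nn_integral_count_space_nn_integral[symmetric]) auto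
    also have "\<dots> \<le> ?X"
    proof (rule nn_integral_mono)
      fix r :: real
      show "(\<integral>\<^sup>+k. \<Psi> r * ennreal (\<bar>h r\<bar> powr p) * indicator (J k) r \<partial>count_space K)
        \<le> \<Psi> r * ennreal (\<bar>h r\<bar> powr p) * indicator {0<..} r"
      proof (cases "\<exists>k\<in>K. r \<in> J k")
        case True
        then obtain k where k: "k \<in> K" "r \<in> J k" by blast
        have uniq: "l = k" if "l \<in> K" "r \<in> J l" for l
          using Jdisj[OF k(1) that(1)] Jdisj[OF that(1) k(1)] k(2) that(2) by (metis IntI empty_iff linorder_neqE)
        have "(\<integral>\<^sup>+l. \<Psi> r * ennreal (\<bar>h r\<bar> powr p) * indicator (J l) r \<partial>count_space K) =
          (\<integral>\<^sup>+l. \<Psi> r * ennreal (\<bar>h r\<bar> powr p) * indicator {k} l \<partial>count_space K)"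
        proof (rule nn_integral_cong)
          fix l assume "l \<in> space (count_space K)"
          then have "l \<in> K" by simp
          then have "r \<in> J l \<longleftrightarrow> l = k" using uniq[of l] k by blast
          then show "\<Psi> r * ennreal (\<bar>h r\<bar> powr p) * indicator (J l) r = \<Psi> r * ennreal (\<bar>h r\<bar> powr p) * indicator {k} l"
            by (simp add: indicator_def)
        qed
        also have "\<dots> = \<Psi> r * ennreal (\<bar>h r\<bar> powr p)"
          using k(1) by (subst nn_integral_cmult) auto
        finally show ?thesis using k Jpos[OF k(1)] by auto
      next
        case False
        then have "(\<integral>\<^sup>+k. \<Psi> r * ennreal (\<bar>h r\<bar> powr p) * indicator (J k) r \<partial>count_space K) = (\<integral>\<^sup>+k. 0 \<partial>count_space K)"
          by (intro nn_integral_cong) (auto simp: indicator_def)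
        then show ?thesis by simp
      qed
    qed
    finally show ?thesis .
  qed
  \<comment> \<open>Hoelder's bound for 2^(k-1) is multiplied by V^(1/q), which together with
    W^(1/p') is at most a, and the result is raised to the power q.\<close>
  have level: "ennreal (2 powr ((of_int k + 1) * q)) * V (\<xi> k) \<le> ennreal ((4 * a) powr q) * x k powr\<^sub>e (q / p)" if k: "k \<in> K" for k
  proof -
    note k1 = Kpred[OF k]
    have Jk: "J k \<subseteq> {0<..}" using Jpos[OF k] by auto
    have xfin: "x k < \<infinity>"
    proof -
      have "x k \<le> ?X" unfolding x_def using Jk by (intro nn_integral_mono) (auto simp: indicator_def)
      then show ?thesis using X by (rule order.strict_trans1)
    qed
    have Wk: "(\<integral>\<^sup>+r\<in>J k. \<Psi> r powr\<^sub>e (1 - p') \<partial>lborel) \<le> W (\<xi> k)"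
      unfolding W_def using Jpos[OF k] by (intro nn_integral_mono) (auto simp: indicator_def)
    have "2 powr (of_int k - 1) = F (\<xi> k) - F (\<xi> (k - 1))"
      using \<xi>(2)[OF k] \<xi>(2)[OF k1(1)] by (simp add: powr_diff)
    also have "\<dots> = (LINT r:{\<xi> (k - 1)<..\<xi> k}|lborel. \<bar>h r\<bar>)"
      using \<xi>(1)[OF k1(1)] k1(2) by (intro Fdiff) auto
    finally have "ennreal (2 powr (of_int k - 1)) = ennreal (LINT r:{\<xi> (k - 1)<..\<xi> k}|lborel. \<bar>h r\<bar>)" by simp
    also have "\<dots> = (\<integral>\<^sup>+r. ennreal (indicator {\<xi> (k - 1)<..\<xi> k} r *\<^sub>R \<bar>h r\<bar>) \<partial>lborel)"
      unfolding set_lebesgue_integral_def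
    proof (rule nn_integral_eq_integral[symmetric])
      have "{\<xi> (k - 1)<..\<xi> k} \<subseteq> {0..\<xi> k}" using \<xi>(1)[OF k1(1)] by auto
      then show "integrable lborel (\<lambda>r. indicator {\<xi> (k - 1)<..\<xi> k} r *\<^sub>R \<bar>h r\<bar>)"
        using habs[of "{\<xi> (k - 1)<..\<xi> k}" "\<xi> k"] \<xi>(1)[OF k] by (simp add: set_integrable_def)
    qed simp
    \<comment> \<open>The half-open interval differs from \<open>J k\<close> only by the null set
      {\<xi> k}.\<close>
    also have "\<dots> = (\<integral>\<^sup>+r\<in>J k. ennreal \<bar>h r\<bar> \<partial>lborel)"
      by (intro nn_integral_cong_AE, use AE_lborel_singleton[of "\<xi> k"] in eventually_elim)
         (auto simp: J_def indicator_def)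
    also have "\<dots> \<le> x k powr\<^sub>e (1 / p) * (\<integral>\<^sup>+r\<in>J k. \<Psi> r powr\<^sub>e (1 - p') \<partial>lborel) powr\<^sub>e (1 / p')"
      unfolding x_def
    proof (rule weighted_holder[OF p])
      show "0 < \<Psi> r" if "r \<in> J k" for r using that Jk \<Psi>_pos by auto
      show "(\<integral>\<^sup>+r\<in>J k. \<Psi> r * ennreal (\<bar>h r\<bar> powr p) \<partial>lborel) < \<infinity>" using xfin by (simp add: x_def)
      show "(\<integral>\<^sup>+r\<in>J k. \<Psi> r powr\<^sub>e (1 - p') \<partial>lborel) < \<infinity>"
        using Wk Wfin[OF \<xi>(1)[OF k]] by (rule order.strict_trans1)
    qed auto
    also have "\<dots> \<le> x k powr\<^sub>e (1 / p) * W (\<xi> k) powr\<^sub>e (1 / p')"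
      using Wk p0 by (intro mult_left_mono ennreal_powr_mono) auto
    finally have "ennreal (2 powr (of_int k - 1)) * V (\<xi> k) powr\<^sub>e (1 / q)
      \<le> x k powr\<^sub>e (1 / p) * W (\<xi> k) powr\<^sub>e (1 / p') * V (\<xi> k) powr\<^sub>e (1 / q)"
      by (rule mult_right_mono) simp
    also have "\<dots> \<le> x k powr\<^sub>e (1 / p) * ennreal a"
      using mult_left_mono[OF AV[OF \<xi>(1)[OF k]], of "x k powr\<^sub>e (1 / p)"] by (simp add: mult_ac)
    finally have "(ennreal (2 powr (of_int k - 1)) * V (\<xi> k) powr\<^sub>e (1 / q)) powr\<^sub>e q \<le> (x k powr\<^sub>e (1 / p) * ennreal a) powr\<^sub>e q"
      using p0 by (intro ennreal_powr_mono) auto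
    then have *: "ennreal (2 powr ((of_int k - 1) * q)) * V (\<xi> k) \<le> ennreal (a powr q) * x k powr\<^sub>e (q / p)"
      using p0 a by (simp add: ennreal_powr_mult ennreal_powr_powr powr_powr mult.commute)
    have 4: "2 powr ((of_int k + 1) * q) = 4 powr q * 2 powr ((of_int k - 1) * q)"
    proof -
      have "(4::real) powr q = 2 powr (2 * q)" using powr_powr[of 2 2 q] by simp
      moreover have "(of_int k + 1) * q = 2 * q + (of_int k - 1) * q" by (simp add: algebra_simps)
      ultimately show ?thesis by (simp only: powr_add)
    qed
    have "ennreal (2 powr ((of_int k + 1) * q)) * V (\<xi> k) = ennreal (4 powr q) * (ennreal (2 powr ((of_int k - 1) * q)) * V (\<xi> k))"
      unfolding 4 by (simp add: ennreal_mult mult.assoc)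
    also have "\<dots> \<le> ennreal (4 powr q) * (ennreal (a powr q) * x k powr\<^sub>e (q / p))"
      by (intro mult_left_mono *) simp
    also have "\<dots> = ennreal ((4 * a) powr q) * x k powr\<^sub>e (q / p)"
      using a by (simp add: powr_mult ennreal_mult mult.assoc)
    finally show ?thesis .
  qed
  have "(\<integral>\<^sup>+r\<in>{0<..}. \<Phi> r * ennreal (F r powr q) \<partial>lborel) \<le>
     (\<integral>\<^sup>+r. (\<integral>\<^sup>+k. ennreal (2 powr ((of_int k + 1) * q)) * (\<Phi> r * indicator {\<xi> k..} r) \<partial>count_space K) \<partial>lborel)"
  proof (rule nn_integral_mono)
    fix r :: real
    show "\<Phi> r * ennreal (F r powr q) * indicator {0<..} r \<le>
      (\<integral>\<^sup>+k. ennreal (2 powr ((of_int k + 1) * q)) * (\<Phi> r * indicator {\<xi> k..} r) \<partial>count_space K)"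
    proof (cases "0 < r \<and> 0 < F r")
      case True
      \<comment> \<open>This k satisfies 2^k < F r \<le> 2^(k+1); strictness on the left gives \<xi>
        k < r.\<close>
      define k where "k = \<lceil>log 2 (F r)\<rceil> - 1"
      have k: "of_int k < log 2 (F r)" "log 2 (F r) \<le> of_int k + 1" unfolding k_def by linarith+
      have lt: "2 powr k < F r" using True k(1) less_log_iff[of 2 "F r" "of_int k"] by simp
      have le: "F r \<le> 2 powr (of_int k + 1)" using True k(2) log_le_iff[of 2 "F r" "of_int k + 1"] by simp
      have kK: "k \<in> K" using attain[of r k] True lt by simp
      have "\<xi> k < r" using \<xi>_less[OF kK] True lt by simp
      have "F r powr q \<le> (2 powr (of_int k + 1)) powr q" using le True p0 by (intro powr_mono2) auto
      also have "\<dots> = 2 powr ((of_int k + 1) * q)" by (simp add: powr_powr)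
      finally have "\<Phi> r * ennreal (F r powr q) * indicator {0<..} r \<le> \<Phi> r * ennreal (2 powr ((of_int k + 1) * q))"
        using True by (auto intro!: mult_left_mono ennreal_leI)
      also have "\<dots> = ennreal (2 powr ((of_int k + 1) * q)) * (\<Phi> r * indicator {\<xi> k..} r)"
        using \<open>\<xi> k < r\<close> by (simp add: mult.commute)
      also have "\<dots> \<le> (\<integral>\<^sup>+k. ennreal (2 powr ((of_int k + 1) * q)) * (\<Phi> r * indicator {\<xi> k..} r) \<partial>count_space K)"
        by (rule nn_integral_ge_point[OF kK])
      finally show ?thesis .
    next
      case False
      then have "F r powr q * indicator {0<..} r = 0"
        using Fmono[of 0 r] F0 by (auto simp: indicator_def)
      then show ?thesis by (auto simp: indicator_def split: if_splits)
    qed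
  qed
  also have "\<dots> = (\<integral>\<^sup>+k. (\<integral>\<^sup>+r. ennreal (2 powr ((of_int k + 1) * q)) * (\<Phi> r * indicator {\<xi> k..} r) \<partial>lborel) \<partial>count_space K)"
    by (rule nn_integral_count_space_nn_integral) auto
  also have "\<dots> = (\<integral>\<^sup>+k. ennreal (2 powr ((of_int k + 1) * q)) * V (\<xi> k) \<partial>count_space K)"
    unfolding V_def by (intro nn_integral_cong nn_integral_cmult) auto
  also have "\<dots> \<le> (\<integral>\<^sup>+k. ennreal ((4 * a) powr q) * x k powr\<^sub>e (q / p) \<partial>count_space K)"
    using level by (intro nn_integral_mono) auto
  also have "\<dots> = ennreal ((4 * a) powr q) * (\<integral>\<^sup>+k. x k powr\<^sub>e (q / p) \<partial>count_space K)"
    by (rule nn_integral_cmult) simp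
  also have "\<dots> \<le> ennreal ((4 * a) powr q) * ?X powr\<^sub>e (q / p)"
  proof (rule mult_left_mono)
    have "(\<integral>\<^sup>+k. x k powr\<^sub>e (q / p) \<partial>count_space K) \<le> (\<integral>\<^sup>+k. x k \<partial>count_space K) powr\<^sub>e (q / p)"
      using p0 q by (intro sum_powr_le_powr_sum) simp
    also have "\<dots> \<le> ?X powr\<^sub>e (q / p)" using xX p0 by (intro ennreal_powr_mono) auto
    finally show "(\<integral>\<^sup>+k. x k powr\<^sub>e (q / p) \<partial>count_space K) \<le> ?X powr\<^sub>e (q / p)" .
  qed simp
  finally have "(\<integral>\<^sup>+r\<in>{0<..}. \<Phi> r * ennreal (F r powr q) \<partial>lborel) powr\<^sub>e (1 / q) \<le>
     (ennreal ((4 * a) powr q) * ?X powr\<^sub>e (q / p)) powr\<^sub>e (1 / q)"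
    using p0 by (intro ennreal_powr_mono) auto
  also have "\<dots> = ennreal (4 * a) * ?X powr\<^sub>e (1 / p)"
    using p0 a by (simp add: ennreal_powr_mult ennreal_powr_powr powr_powr)
  finally show ?thesis unfolding F_def .
qed

end

section \<open>Radial functions\<close>

text \<open>The density is known to be integrable only over bounded intervals, so the
  differentiation theorem is applied to its cut-offs at n. On (0, n) the primitive of the cut-off
  plus g 0 equals g.\<close>

lemma locally_absolutely_continuous_derivative:
  assumes g: "locally_absolutely_continuous g"
  obtains h :: "real \<Rightarrow> real" where "h \<in> borel_measurable borel"
    "\<And>x. 0 \<le> x \<Longrightarrow> set_integrable lborel {0..x} h"
    "\<And>x. 0 \<le> x \<Longrightarrow> (LINT y:{0..x}|lborel. h y) = g x - g 0"
    "AE x in lborel. 0 < x \<longrightarrow> (g has_real_derivative h x) (at x)"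
proof -
  obtain h :: "real \<Rightarrow> real" where h: "h \<in> borel_measurable borel"
    "\<And>x. 0 \<le> x \<Longrightarrow> set_integrable lborel {0..x} h"
    "\<And>x. 0 \<le> x \<Longrightarrow> (LINT y:{0..x}|lborel. h y) = g x - g 0"
    by (rule locally_absolutely_continuous_density[OF g]) (rule that)
  define k where "k n x = indicator {0..real n} x *\<^sub>R h x" for n x
  have "AE x in lborel. \<forall>n. ((\<lambda>x. LINT t:{..x}|lborel. k n t) has_real_derivative k n x) (at x)"
    unfolding AE_all_countable
    using h(2) by (intro allI lebesgue_differentiation) (simp add: k_def set_integrable_def)
  then have "AE x in lborel. 0 < x \<longrightarrow> (g has_real_derivative h x) (at x)"
  proof eventually_elim
    case (elim x)
    show ?case
    proof
      assume x: "0 < x"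
      obtain n :: nat where n: "x < real n" using reals_Archimedean2 by blast
      have "((\<lambda>y. (LINT t:{..y}|lborel. k n t) + g 0) has_real_derivative k n x + 0) (at x)"
        by (intro DERIV_add DERIV_const) (use elim in blast)
      then have "((\<lambda>y. (LINT t:{..y}|lborel. k n t) + g 0) has_real_derivative h x) (at x)"
        using x n by (simp add: k_def)
      then show "(g has_real_derivative h x) (at x)"
      proof (rule has_field_derivative_transform_within_open[of _ _ _ "{0<..<real n}"])
        fix y assume y: "y \<in> {0<..<real n}"
        have "(LINT t:{..y}|lborel. k n t) = (LINT t:{0..y}|lborel. h t)"
          unfolding set_lebesgue_integral_def k_def using y
          by (intro Bochner_Integration.integral_cong) (auto simp: indicator_def)
        then show "(LINT t:{..y}|lborel. k n t) + g 0 = g y" using h(3)[of y] y by simp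
      qed (use x n in auto)
    qed
  qed
  with h show ?thesis by (rule that)
qed

context homogeneous_quasi_norm
begin

context
  fixes \<sigma> :: "(real^'n) measure"
  assumes polar: "polar_measure A N \<sigma>"
begin

text \<open>On the negative axis \<open>g\<close> is arbitrary and need not be measurable, so it is
  replaced by the continuous function \<open>g (max 0 x)\<close>. The inner indicator belongs to the
  weight, which it makes Borel on the whole line.\<close>

lemma nn_integral_radial_profile:
  assumes g: "locally_absolutely_continuous g" and w: "weight w"
  shows "(\<integral>\<^sup>+x. ennreal (w x * \<bar>g (N x)\<bar> powr q) \<partial>lborel) =
    (\<integral>\<^sup>+r\<in>{0<..}. (spherical_integral A \<sigma> w r * indicator {0<..} r) * ennreal (\<bar>g r\<bar> powr q) \<partial>lborel)"
proof -
  have [measurable]: "w \<in> borel_measurable borel" and wpos: "\<And>x. 0 < w x" using w by (auto simp: weight_def)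
  have "continuous_on UNIV (\<lambda>x. g (max 0 x))"
    using locally_absolutely_continuous_imp_continuous[OF g]
    by (rule continuous_on_compose2) (auto intro: continuous_on_max continuous_on_const continuous_on_id)
  then have [measurable]: "(\<lambda>x. g (max 0 x)) \<in> borel_measurable borel" by (rule borel_measurable_continuous_onI)
  have "(\<integral>\<^sup>+x. ennreal (w x * \<bar>g (N x)\<bar> powr q) \<partial>lborel) = (\<integral>\<^sup>+x. ennreal (w x) * ennreal (\<bar>g (max 0 (N x))\<bar> powr q) \<partial>lborel)"
    using wpos nonneg by (intro nn_integral_cong) (simp add: ennreal_mult less_imp_le max_absorb2)
  also have "\<dots> = (\<integral>\<^sup>+r\<in>{0<..}. spherical_integral A \<sigma> w r * ennreal (\<bar>g (max 0 r)\<bar> powr q) \<partial>lborel)"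
    using wpos by (intro radial_nn_integral[OF polar]) (auto intro: less_imp_le)
  also have "\<dots> = (\<integral>\<^sup>+r\<in>{0<..}. (spherical_integral A \<sigma> w r * indicator {0<..} r) * ennreal (\<bar>g r\<bar> powr q) \<partial>lborel)"
    by (intro nn_integral_cong) (auto simp: indicator_def max_def)
  finally show ?thesis .
qed

text \<open>\<open>deriv g\<close> is replaced by the Borel function \<open>h\<close>, which agrees
  with it at almost every positive radius and hence at almost every point of the group; the origin
  is a null set.\<close>

lemma nn_integral_radial_deriv:
  assumes h[measurable]: "h \<in> borel_measurable borel"
    and der: "AE r in lborel. 0 < r \<longrightarrow> (g has_real_derivative h r) (at r)" and w: "weight w"
  shows "(\<integral>\<^sup>+x. ennreal (w x * \<bar>radial_deriv N g x\<bar> powr p) \<partial>lborel) =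
    (\<integral>\<^sup>+r\<in>{0<..}. (spherical_integral A \<sigma> w r * indicator {0<..} r) * ennreal (\<bar>h r\<bar> powr p) \<partial>lborel)"
proof -
  have [measurable]: "w \<in> borel_measurable borel" and wpos: "\<And>x. 0 < w x" using w by (auto simp: weight_def)
  have "AE x in lborel. x \<noteq> 0 \<longrightarrow> (g has_real_derivative h (N x)) (at (N x))"
    by (rule AE_radial[OF polar der])
  then have "AE x in lborel. radial_deriv N g x = h (N x)"
    using AE_lborel_singleton[of "0 :: real^'n"]
    by eventually_elim (auto simp: radial_deriv_def DERIV_imp_deriv)
  then have "AE x in lborel. ennreal (w x * \<bar>radial_deriv N g x\<bar> powr p) = ennreal (w x) * ennreal (\<bar>h (N x)\<bar> powr p)"
    by eventually_elim (use wpos in \<open>simp add: ennreal_mult less_imp_le\<close>)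
  then have "(\<integral>\<^sup>+x. ennreal (w x * \<bar>radial_deriv N g x\<bar> powr p) \<partial>lborel) = (\<integral>\<^sup>+x. ennreal (w x) * ennreal (\<bar>h (N x)\<bar> powr p) \<partial>lborel)"
    by (rule nn_integral_cong_AE)
  also have "\<dots> = (\<integral>\<^sup>+r\<in>{0<..}. spherical_integral A \<sigma> w r * ennreal (\<bar>h r\<bar> powr p) \<partial>lborel)"
    using wpos by (intro radial_nn_integral[OF polar]) (auto intro: less_imp_le)
  also have "\<dots> = (\<integral>\<^sup>+r\<in>{0<..}. (spherical_integral A \<sigma> w r * indicator {0<..} r) * ennreal (\<bar>h r\<bar> powr p) \<partial>lborel)"
    by (intro nn_integral_cong) (auto simp: indicator_def)
  finally show ?thesis .
qed

text \<open>The set {R \<le> N x} is radial, which turns the first factor into an integral over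
  radii. In the second factor the inserted indicator equals 1 on (0, R).\<close>

lemma A5_eq:
  assumes w: "weight \<phi>"
  shows "A5 A N \<sigma> \<phi> \<psi> p p' q = (SUP R\<in>{0<..}.
     (\<integral>\<^sup>+r\<in>{R..}. spherical_integral A \<sigma> \<phi> r * indicator {0<..} r \<partial>lborel) powr\<^sub>e (1 / q) *
     (\<integral>\<^sup>+r\<in>{0<..<R}. (spherical_integral A \<sigma> \<psi> r * indicator {0<..} r) powr\<^sub>e (1 - p') \<partial>lborel) powr\<^sub>e (1 / p'))"
proof -
  have [measurable]: "\<phi> \<in> borel_measurable borel" and wpos: "\<And>x. 0 < \<phi> x" using w by (auto simp: weight_def)
  have 1: "(\<integral>\<^sup>+x\<in>{x. R \<le> N x}. ennreal (\<phi> x) \<partial>lborel) = (\<integral>\<^sup>+r\<in>{R..}. spherical_integral A \<sigma> \<phi> r * indicator {0<..} r \<partial>lborel)" for R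
  proof -
    have "(\<integral>\<^sup>+x\<in>{x. R \<le> N x}. ennreal (\<phi> x) \<partial>lborel) = (\<integral>\<^sup>+x. ennreal (\<phi> x) * indicator {R..} (N x) \<partial>lborel)"
      by (intro nn_integral_cong) (auto simp: indicator_def)
    also have "\<dots> = (\<integral>\<^sup>+r\<in>{0<..}. spherical_integral A \<sigma> \<phi> r * indicator {R..} r \<partial>lborel)"
      using wpos by (intro radial_nn_integral[OF polar]) (auto intro: less_imp_le)
    also have "\<dots> = (\<integral>\<^sup>+r\<in>{R..}. spherical_integral A \<sigma> \<phi> r * indicator {0<..} r \<partial>lborel)"
      by (intro nn_integral_cong) (auto simp: indicator_def)
    finally show ?thesis .
  qed
  have 2: "(\<integral>\<^sup>+r\<in>{0<..<R}. (\<integral>\<^sup>+y. ennreal (r powr (homogeneous_dim A - 1) * \<psi> (dilation A r y)) \<partial>\<sigma>) powr\<^sub>e (1 - p') \<partial>lborel) =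
    (\<integral>\<^sup>+r\<in>{0<..<R}. (spherical_integral A \<sigma> \<psi> r * indicator {0<..} r) powr\<^sub>e (1 - p') \<partial>lborel)" for R
    by (intro nn_integral_cong) (auto simp: indicator_def spherical_integral_def)
  show ?thesis unfolding A5_def 1 2 ..
qed

text \<open>Provides the positivity that rules out a concealed 0 * \<infinity> in the condition: the
  integrand is positive on [R, R + 1], a set of positive length.\<close>

lemma spherical_integral_tail_pos:
  assumes w: "weight w" and R: "0 < R"
  shows "0 < (\<integral>\<^sup>+r\<in>{R..}. spherical_integral A \<sigma> w r * indicator {0<..} r \<partial>lborel)"
proof -
  have [measurable]: "(\<lambda>r. spherical_integral A \<sigma> w r * indicator {0<..} r) \<in> borel_measurable borel"
    using w by (intro spherical_integral_borel[OF polar]) (simp add: weight_def)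
  have pos: "0 < spherical_integral A \<sigma> w r" if "0 < r" for r
    using w that by (intro spherical_integral_pos[OF polar]) (auto simp: weight_def)
  have "(\<integral>\<^sup>+r\<in>{R..}. spherical_integral A \<sigma> w r * indicator {0<..} r \<partial>lborel) \<noteq> 0"
  proof
    assume "(\<integral>\<^sup>+r\<in>{R..}. spherical_integral A \<sigma> w r * indicator {0<..} r \<partial>lborel) = 0"
    then have "AE r in lborel. spherical_integral A \<sigma> w r * indicator {0<..} r * indicator {R..} r = 0"
      by (subst (asm) nn_integral_0_iff_AE) auto
    then have "AE r in lborel. r \<notin> {R..R + 1}"
    proof eventually_elim
      case (elim r)
      show ?case using elim pos[of r] R by (auto simp: indicator_def split: if_splits)
    qed
    then have "{R..R + 1} \<in> null_sets lborel" by (subst AE_iff_null_sets) auto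
    then show False by (simp add: null_sets_def)
  qed
  then show ?thesis by (simp add: zero_less_iff_neq_zero)
qed

text \<open>Every profile g with g 0 = 0 arises, from the radial function g (N x), and N 0 = 0 makes
  f 0 = 0 equivalent to g 0 = 0. Quantifying over f and g is therefore quantifying over
  profiles.\<close>

lemma radial_hardy_iff:
  assumes w: "weight \<phi>" "weight \<psi>" and p: "1 < p" "1 / p + 1 / p' = 1" and q: "p \<le> q"
  shows "(\<exists>C>0. \<forall>f g. radial_with_profile N f g \<and> f 0 = 0 \<longrightarrow>
            (\<integral>\<^sup>+x. ennreal (\<phi> x * \<bar>f x\<bar> powr q) \<partial>lborel) powr\<^sub>e (1 / q)
            \<le> ennreal C *
              (\<integral>\<^sup>+x. ennreal (\<psi> x * \<bar>radial_deriv N g x\<bar> powr p) \<partial>lborel) powr\<^sub>e (1 / p))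
         \<longleftrightarrow> A5 A N \<sigma> \<phi> \<psi> p p' q < \<infinity>" (is "?L \<longleftrightarrow> ?R")
proof -
  define \<Phi> where "\<Phi> r = spherical_integral A \<sigma> \<phi> r * indicator {0<..} r" for r
  define \<Psi> where "\<Psi> r = spherical_integral A \<sigma> \<psi> r * indicator {0<..} r" for r
  have \<Phi>: "\<Phi> \<in> borel_measurable borel" and \<Psi>: "\<Psi> \<in> borel_measurable borel"
    using w by (auto simp: \<Phi>_def[abs_def] \<Psi>_def[abs_def] weight_def intro!: spherical_integral_borel[OF polar])
  have \<Psi>_pos: "0 < \<Psi> r" if "0 < r" for r
    using w that by (auto simp: \<Psi>_def weight_def intro!: spherical_integral_pos[OF polar])
  note 1 = nn_integral_radial_profile[OF _ w(1), of _ q, folded \<Phi>_def]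
  note 2 = nn_integral_radial_deriv[OF _ _ w(2), of _ _ p, folded \<Psi>_def]
  note A5 = A5_eq[OF w(1), of \<psi> p p' q, folded \<Phi>_def \<Psi>_def]
  have N0: "N 0 = 0" using definite by simp
  show ?thesis
  proof
    assume ?L
    then obtain C where C: "0 < C" and L: "\<And>f g. radial_with_profile N f g \<Longrightarrow> f 0 = 0 \<Longrightarrow>
            (\<integral>\<^sup>+x. ennreal (\<phi> x * \<bar>f x\<bar> powr q) \<partial>lborel) powr\<^sub>e (1 / q)
            \<le> ennreal C *
              (\<integral>\<^sup>+x. ennreal (\<psi> x * \<bar>radial_deriv N g x\<bar> powr p) \<partial>lborel) powr\<^sub>e (1 / p)" by blast
    have "A5 A N \<sigma> \<phi> \<psi> p p' q \<le> ennreal C"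
      unfolding A5
    proof (rule SUP_least, rule hardy_necessity[OF \<Phi> \<Psi> \<Psi>_pos p q C])
      fix g h
      assume g: "locally_absolutely_continuous g" "g 0 = 0" and h: "h \<in> borel_measurable borel"
        "AE r in lborel. 0 < r \<longrightarrow> (g has_real_derivative h r) (at r)"
      show "(\<integral>\<^sup>+r\<in>{0<..}. \<Phi> r * ennreal (\<bar>g r\<bar> powr q) \<partial>lborel) powr\<^sub>e (1 / q) \<le>
        ennreal C * (\<integral>\<^sup>+r\<in>{0<..}. \<Psi> r * ennreal (\<bar>h r\<bar> powr p) \<partial>lborel) powr\<^sub>e (1 / p)"
        using L[of "\<lambda>x. g (N x)" g] g N0 unfolding 1[OF g(1)] 2[OF h] by (simp add: radial_with_profile_def)
    qed auto
    then show ?R by (rule order.strict_trans1) simp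
  next
    assume R: ?R
    define a where "a = enn2real (A5 A N \<sigma> \<phi> \<psi> p p' q)"
    have a: "0 \<le> a" "A5 A N \<sigma> \<phi> \<psi> p p' q = ennreal a" using R by (auto simp: a_def)
    have bound: "(\<integral>\<^sup>+r\<in>{R..}. \<Phi> r \<partial>lborel) powr\<^sub>e (1 / q) *
       (\<integral>\<^sup>+r\<in>{0<..<R}. \<Psi> r powr\<^sub>e (1 - p') \<partial>lborel) powr\<^sub>e (1 / p') \<le> ennreal a" if "0 < R" for R
      unfolding a(2)[symmetric] A5 using that by (intro SUP_upper) simp
    \<comment> \<open>The summand 1 in the constant serves two purposes: the constant has to be
      positive, and where the right-hand integral diverges the product has to be infinite even if a
      = 0.\<close>
    show ?L
    proof (intro exI[of _ "4 * a + 1"] conjI allI impI)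
      show "0 < 4 * a + 1" using a by simp
      fix f g assume "radial_with_profile N f g \<and> f 0 = 0"
      then have profile: "radial_with_profile N f g" and f0: "f 0 = 0" by blast+
      have f: "f x = g (N x)" for x using profile unfolding radial_with_profile_def by blast
      have g: "locally_absolutely_continuous g" using profile unfolding radial_with_profile_def by blast
      have g0: "g 0 = 0" using f[of 0] f0 N0 by simp
      obtain h :: "real \<Rightarrow> real" where h: "h \<in> borel_measurable borel"
        "\<And>x. 0 \<le> x \<Longrightarrow> set_integrable lborel {0..x} h"
        "\<And>x. 0 \<le> x \<Longrightarrow> (LINT y:{0..x}|lborel. h y) = g x - g 0"
        "AE x in lborel. 0 < x \<longrightarrow> (g has_real_derivative h x) (at x)"
        by (rule locally_absolutely_continuous_derivative[OF g]) (rule that)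
      let ?X = "\<integral>\<^sup>+r\<in>{0<..}. \<Psi> r * ennreal (\<bar>h r\<bar> powr p) \<partial>lborel"
      let ?F = "\<lambda>r. LINT t:{0..r}|lborel. \<bar>h t\<bar>"
      have gF: "\<bar>g r\<bar> \<le> ?F r" if "0 < r" for r
      proof -
        have "\<bar>g r\<bar> = \<bar>LINT y:{0..r}|lborel. h y\<bar>" using h(3)[of r] that g0 by simp
        also have "\<dots> \<le> ?F r"
          using set_integral_norm_bound[OF h(2)[of r]] that by simp
        finally show ?thesis .
      qed
      have "(\<integral>\<^sup>+r\<in>{0<..}. \<Phi> r * ennreal (\<bar>g r\<bar> powr q) \<partial>lborel) powr\<^sub>e (1 / q) \<le> ennreal (4 * a + 1) * ?X powr\<^sub>e (1 / p)"
      proof (cases "?X < \<infinity>")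
        case False
        then have "?X = top" by (simp only: infinity_ennreal_def less_top[symmetric] not_not)
        then have "ennreal (4 * a + 1) * ?X powr\<^sub>e (1 / p) = top"
          using a p by (simp add: ennreal_mult_top del: ennreal_plus)
        then show ?thesis by simp
      next
        case True
        have "(\<integral>\<^sup>+r\<in>{0<..}. \<Phi> r * ennreal (\<bar>g r\<bar> powr q) \<partial>lborel) powr\<^sub>e (1 / q) \<le>
            (\<integral>\<^sup>+r\<in>{0<..}. \<Phi> r * ennreal (?F r powr q) \<partial>lborel) powr\<^sub>e (1 / q)"
          using p q gF
          by (intro ennreal_powr_mono nn_integral_mono) (auto simp: indicator_def intro!: mult_left_mono ennreal_leI powr_mono2)
        also have "\<dots> \<le> ennreal (4 * a) * ?X powr\<^sub>e (1 / p)"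
          by (rule hardy_sufficiency[OF \<Phi> \<Psi> \<Psi>_pos p q a(1) _ bound h(1,2) True])
             (simp_all add: spherical_integral_tail_pos[OF w(1), folded \<Phi>_def])
        also have "\<dots> \<le> ennreal (4 * a + 1) * ?X powr\<^sub>e (1 / p)"
          by (intro mult_right_mono ennreal_leI) auto
        finally show ?thesis .
      qed
      then show "(\<integral>\<^sup>+x. ennreal (\<phi> x * \<bar>f x\<bar> powr q) \<partial>lborel) powr\<^sub>e (1 / q) \<le>
        ennreal (4 * a + 1) * (\<integral>\<^sup>+x. ennreal (\<psi> x * \<bar>radial_deriv N g x\<bar> powr p) \<partial>lborel) powr\<^sub>e (1 / p)"
        unfolding f 1[OF g] 2[OF h(1,4)] .
    qed
  qed
qed

end

end

theorem theorem3p4: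
  fixes mul :: "real^'n \<Rightarrow> real^'n \<Rightarrow> real^'n"
    and ginv A :: "real^'n \<Rightarrow> real^'n"
    and N \<phi> \<psi> :: "real^'n \<Rightarrow> real"
    and \<sigma> :: "(real^'n) measure"
    and p q p' :: real
  assumes "homogeneous_quasi_norm mul ginv A N"
    and "polar_measure A N \<sigma>"
    and "weight \<phi>" and "weight \<psi>"
    and "1 < p" and "p \<le> q" and "1 / p + 1 / p' = 1"
  shows "(\<exists>C>0. \<forall>f g. radial_with_profile N f g \<and> f 0 = 0 \<longrightarrow>
            (\<integral>\<^sup>+x. ennreal (\<phi> x * \<bar>f x\<bar> powr q) \<partial>lborel) powr\<^sub>e (1 / q)
            \<le> ennreal C *
              (\<integral>\<^sup>+x. ennreal (\<psi> x * \<bar>radial_deriv N g x\<bar> powr p) \<partial>lborel) powr\<^sub>e (1 / p))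
         \<longleftrightarrow> A5 A N \<sigma> \<phi> \<psi> p p' q < \<infinity>"
  by (rule homogeneous_quasi_norm.radial_hardy_iff[OF assms(1,2,3,4,5,7,6)])

end
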